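(* Let $\varphi \colon \mathbb S \to \mathbb S$ be an orientation-preserving homeomorphism of the unit circle onto itself. Then $\varphi$ satisfies the bi-Douglas condition \[ \int_{\mathbb S}\int_{\mathbb S} \left|\frac{\varphi(\xi)-\varphi(\eta)}{\xi-\eta}\right|^2 + \left|\frac{\varphi^{-1}(\xi)-\varphi^{-1}(\eta)}{\xi-\eta}\right|^2 \, |\mathrm d\xi|\, |\mathrm d\eta| < \infty \] if and only if $\varphi$ admits an extension to $\mathbb D$ of finite bi-conformal energy, i.e. there is an orientation-preserving homeomorphism $h\colon \overline{\mathbb D}\to\overline{\mathbb D}$ with $h=\varphi$ on $\mathbb S$ such that, with $f=h^{-1}$, \[ \int_{\mathbb D} |Dh(x)|^2\,\mathrm dx + \int_{\mathbb D}|Df(y)|^2\,\mathrm dy < \infty . \]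
   Context: $\mathbb D$ is the open unit disk in $\mathbb C$, $\mathbb S=\partial\mathbb D$, and integrals over $\mathbb S$ are with respect to arc length. $Dh$ denotes the weak differential of $h$ (the maps $h$ and $h^{-1}$ are required to be Sobolev maps, $h, h^{-1}\in\mathscr W^{1,1}_{\mathrm{loc}}(\mathbb D,\mathbb C)$) and $|Dh(x)|$ its operator norm. *)

theory Defs
  imports "HOL-Analysis.Analysis" "HOL-Complex_Analysis.Complex_Analysis"
begin

definition circle_orient_pres :: "(complex \<Rightarrow> complex) \<Rightarrow> bool" where
  "circle_orient_pres \<phi> \<longleftrightarrow> winding_number (\<phi> \<circ> circlepath 0 1) 0 = 1"

definition disk_orient_pres :: "(complex \<Rightarrow> complex) \<Rightarrow> bool" where
  "disk_orient_pres h \<longleftrightarrow>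
     (\<forall>z r. r > 0 \<and> cball z r \<subseteq> ball 0 1 \<longrightarrow>
        winding_number (h \<circ> circlepath z r) (h z) = 1)"

text \<open>C-infinity real functions on the plane: all iterated partial derivatives
  (in the directions 1 and i) exist everywhere and are continuous.  The list
  ds records the sequence of differentiations (True = d/dx, False = d/dy).\<close>
definition smooth_fun :: "(complex \<Rightarrow> real) \<Rightarrow> bool" where
  "smooth_fun \<psi> \<longleftrightarrow>
     (\<exists>D :: bool list \<Rightarrow> complex \<Rightarrow> real. D [] = \<psi> \<and>
        (\<forall>ds. continuous_on UNIV (D ds) \<and>
           (\<forall>z. ((\<lambda>t. D ds (z + of_real t)) has_real_derivative D (True # ds) z) (at 0) \<and>
                ((\<lambda>t. D ds (z + \<i> * of_real t)) has_real_derivative D (False # ds) z) (at 0))))"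

definition test_function :: "complex set \<Rightarrow> (complex \<Rightarrow> real) \<Rightarrow> bool" where
  "test_function U \<psi> \<longleftrightarrow> smooth_fun \<psi> \<and>
     compact (closure {z. \<psi> z \<noteq> 0}) \<and> closure {z. \<psi> z \<noteq> 0} \<subseteq> U"

definition dx :: "(complex \<Rightarrow> real) \<Rightarrow> complex \<Rightarrow> real" where
  "dx \<psi> z = deriv (\<lambda>t. \<psi> (z + of_real t)) 0"

definition dy :: "(complex \<Rightarrow> real) \<Rightarrow> complex \<Rightarrow> real" where
  "dy \<psi> z = deriv (\<lambda>t. \<psi> (z + \<i> * of_real t)) 0"

definition locally_integrable_on :: "complex set \<Rightarrow> (complex \<Rightarrow> complex) \<Rightarrow> bool" where
  "locally_integrable_on U g \<longleftrightarrow>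
     (\<forall>K. compact K \<and> K \<subseteq> U \<longrightarrow> set_integrable lborel K g)"

definition weak_partials ::
  "(complex \<Rightarrow> complex) \<Rightarrow> complex set \<Rightarrow> (complex \<Rightarrow> complex) \<Rightarrow> (complex \<Rightarrow> complex) \<Rightarrow> bool" where
  "weak_partials h U g1 g2 \<longleftrightarrow>
     locally_integrable_on U h \<and> locally_integrable_on U g1 \<and> locally_integrable_on U g2 \<and>
     (\<forall>\<psi>. test_function U \<psi> \<longrightarrow>
        (LINT z|lborel. of_real (dx \<psi> z) * h z) = - (LINT z|lborel. of_real (\<psi> z) * g1 z) \<and>
        (LINT z|lborel. of_real (dy \<psi> z) * h z) = - (LINT z|lborel. of_real (\<psi> z) * g2 z))"

definition finite_sobolev_energy :: "(complex \<Rightarrow> complex) \<Rightarrow> bool" where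
  "finite_sobolev_energy h \<longleftrightarrow>
     (\<exists>g1 g2. weak_partials h (ball 0 1) g1 g2 \<and>
        (\<integral>\<^sup>+ z. indicator (ball 0 1) z *
            ennreal ((onorm (\<lambda>v. Re v *\<^sub>R g1 z + Im v *\<^sub>R g2 z))\<^sup>2) \<partial>lborel) < \<infinity>)"

definition bi_douglas :: "(complex \<Rightarrow> complex) \<Rightarrow> (complex \<Rightarrow> complex) \<Rightarrow> ennreal" where
  "bi_douglas \<phi> \<phi>' =
     (\<integral>\<^sup>+ s. indicator {0..2*pi} s * (\<integral>\<^sup>+ t. indicator {0..2*pi} t *
        ennreal ((cmod ((\<phi> (cis s) - \<phi> (cis t)) / (cis s - cis t)))\<^sup>2 +
                 (cmod ((\<phi>' (cis s) - \<phi>' (cis t)) / (cis s - cis t)))\<^sup>2) \<partial>lborel) \<partial>lborel)"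

end

theory Submission
  imports Defs
begin

text \<open>
  From energy to Douglas: mollify \<open>h\<close> inside the disk, bound the difference of two values on a circle
  by integrals of the gradient along two spirals running inwards until they meet, and apply Hardy's
  inequality on each spiral; rotation invariance and polar coordinates turn the result into the
  Dirichlet integral, and Fatou's lemma passes to the boundary.

  From Douglas to energy: let \<open>\<Phi>\<close> be a lift of \<open>\<phi>\<close> to the line and \<open>\<Psi>\<close> its inverse, and let \<open>U(x, r)\<close>,
  \<open>V(x, r)\<close> be their means over \<open>[x - (1 - r), x + (1 - r)]\<close>. Define \<open>h(r cis x) = r cis w\<close> where
  \<open>w + V(w, r) = x + U(x, r)\<close>. For \<open>r = 1\<close> this gives \<open>w = \<Phi>(x)\<close>, and the inverse of \<open>h\<close> arises from
  exchanging \<open>\<Phi>\<close> and \<open>\<Psi>\<close>. Since \<open>\<bar>U_r\<bar> \<le> U_x\<close> and \<open>\<bar>V_r\<bar> \<le> V_x\<close>, implicit differentiation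
  bounds both partial derivatives of \<open>w\<close> by \<open>1 + U_x\<close>; and \<open>U_x\<close> is the difference quotient
  \<open>(\<Phi>(x + d) - \<Phi>(x - d)) / (2 d)\<close> with \<open>d = 1 - r\<close>, whose square integral is the Douglas integral.
\<close>

section \<open>Polar coordinates\<close>

text \<open>Extending \<phi> alone, for instance harmonically, controls the energy of that extension
  only: its inverse is in general not the extension of the inverse by the same recipe. Determining
  \<open>w\<close> by an equation in which both lifts enter symmetrically removes this obstacle,
  since inversion merely exchanges them. The summands \<open>x\<close> and \<open>w\<close> give
  both sides slope at least 1, so the equation can be solved and differentiated even where the means
  are nearly flat; they also produce the denominator 1 + V_x that absorbs V_r. The modulus is kept,
  so only the angle has to be estimated. In the other direction, a weak gradient has no values along
  curves, whence the mollification. The spirals have length proportional to the distance of the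
  points that they join. Dividing by that distance leaves an average of the gradient over (0, t),
  which is what Hardy's inequality controls in L^2; an arc of the circle itself would instead
  require the gradient on that single circle.\<close>

abbreviation (input) nnint :: "real set \<Rightarrow> (real \<Rightarrow> ennreal) \<Rightarrow> ennreal" where
  "nnint A f \<equiv> \<integral>\<^sup>+x. indicator A x * f x \<partial>lborel"

text \<open>A measure that gives every box the product of its side lengths is Lebesgue measure.
  Integrals over the plane thereby become iterated real integrals.\<close>

lemma lborel_complex_eq:
  "(lborel :: complex measure) = distr (lborel \<Otimes>\<^sub>M lborel) borel (\<lambda>(x, y). Complex x y)"
proof (rule lborel_eqI)
  fix l u :: complex
  assume le: "\<And>b. b \<in> Basis \<Longrightarrow> l \<bullet> b \<le> u \<bullet> b"
  have le': "Re l \<le> Re u" "Im l \<le> Im u"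
    using le[of 1] le[of \<i>] by (auto simp: Basis_complex_def)
  have m: "(\<lambda>(x, y). Complex x y) \<in> (lborel \<Otimes>\<^sub>M lborel) \<rightarrow>\<^sub>M borel"
    unfolding Complex_eq split_beta by measurable
  have *: "(\<lambda>(x, y). Complex x y) -` box l u \<inter> space (lborel \<Otimes>\<^sub>M lborel)
      = {Re l<..<Re u} \<times> {Im l<..<Im u}"
    by (auto simp: space_pair_measure box_def Basis_complex_def)
  show "emeasure (distr (lborel \<Otimes>\<^sub>M lborel) borel (\<lambda>(x, y). Complex x y)) (box l u)
      = ennreal (\<Prod>b\<in>Basis. (u - l) \<bullet> b)"
    using le' by (subst emeasure_distr[OF m])
      (auto simp: * lborel.emeasure_pair_measure_Times Basis_complex_def ennreal_mult)
qed simp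

lemma borel_measurable_Complex[measurable (raw)]:
  assumes "f \<in> borel_measurable M" "g \<in> borel_measurable M"
  shows "(\<lambda>x. Complex (f x) (g x)) \<in> borel_measurable M"
  using assms by (simp add: Complex_eq)

lemma borel_measurable_cis [measurable]: "cis \<in> borel_measurable borel"
  by (intro borel_measurable_continuous_onI continuous_intros)

lemma nn_integral_complex:
  assumes [measurable]: "F \<in> borel_measurable borel"
  shows "(\<integral>\<^sup>+z. F z \<partial>(lborel :: complex measure)) = (\<integral>\<^sup>+x. \<integral>\<^sup>+y. F (Complex x y) \<partial>lborel \<partial>lborel)"
  by (subst lborel_complex_eq, subst nn_integral_distr)
     (auto simp: split_beta lborel.nn_integral_fst[symmetric])

lemma nn_integral_complex_swap:
  assumes [measurable]: "F \<in> borel_measurable borel"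
  shows "(\<integral>\<^sup>+z. F z \<partial>(lborel :: complex measure)) = (\<integral>\<^sup>+y. \<integral>\<^sup>+x. F (Complex x y) \<partial>lborel \<partial>lborel)"
  unfolding nn_integral_complex[OF assms]
  by (rule lborel_pair.Fubini'[symmetric]) measurable

lemma nn_integral_real_uminus:
  fixes f :: "real \<Rightarrow> ennreal"
  assumes [measurable]: "f \<in> borel_measurable borel"
  shows "(\<integral>\<^sup>+x. f (- x) \<partial>lborel) = (\<integral>\<^sup>+x. f x \<partial>lborel)"
  using nn_integral_real_affine[of f "-1" 0] by simp

text \<open>Multiplication by \<open>\<i>\<close> swaps the coordinates and reflects one of them, so
  Fubini and a reflection of the line suffice. The tiling of the plane by four sectors calls for no
  rotations other than multiples of this one.\<close>

lemma nn_integral_complex_rotate_quarter: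
  assumes [measurable]: "F \<in> borel_measurable borel"
  shows "(\<integral>\<^sup>+z. F (\<i> * z) \<partial>(lborel :: complex measure)) = (\<integral>\<^sup>+z. F z \<partial>lborel)"
proof -
  have "(\<integral>\<^sup>+z. F (\<i> * z) \<partial>(lborel :: complex measure)) = (\<integral>\<^sup>+x. \<integral>\<^sup>+y. F (Complex (-y) x) \<partial>lborel \<partial>lborel)"
    by (subst nn_integral_complex) (auto simp: complex_eq_iff intro!: nn_integral_cong arg_cong[where f=F])
  also have "\<dots> = (\<integral>\<^sup>+x. \<integral>\<^sup>+y. F (Complex y x) \<partial>lborel \<partial>lborel)"
    by (intro nn_integral_cong nn_integral_real_uminus) measurable
  also have "\<dots> = (\<integral>\<^sup>+z. F z \<partial>lborel)"
    by (rule nn_integral_complex_swap[symmetric]) measurable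
  finally show ?thesis .
qed

text \<open>For fixed x > 0 substitute y = x tan t, then for fixed t substitute x = r cos t; the
  factors x / cos^2 t and cos t multiply to the Jacobian r. On the sector cos t is positive. It is
  half-open so that its quarter turns do not overlap.\<close>

lemma nn_integral_complex_sector:
  assumes [measurable]: "F \<in> borel_measurable borel"
  shows "(\<integral>\<^sup>+z. indicator {z. - Re z < Im z \<and> Im z \<le> Re z} z * F z \<partial>(lborel :: complex measure))
    = nnint {-pi/4..pi/4} (\<lambda>t. nnint {0<..} (\<lambda>r. ennreal r * F (of_real r * cis t)))"
proof -
  have tm[measurable]: "tan \<in> borel_measurable (borel :: real measure)"
    unfolding tan_def by measurable
  have cosp: "cos t > 0" if "t \<in> {-pi/4..pi/4}" for t
  proof (rule cos_gt_zero_pi)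
    have "- (pi/4) \<le> t" "t \<le> pi/4" using that by auto
    then show "- (pi/2) < t" "t < pi/2" using pi_gt_zero by linarith+
  qed
  have "(\<integral>\<^sup>+z. indicator {z. - Re z < Im z \<and> Im z \<le> Re z} z * F z \<partial>(lborel :: complex measure))
     = (\<integral>\<^sup>+x. \<integral>\<^sup>+y. indicator {z. - Re z < Im z \<and> Im z \<le> Re z} (Complex x y) * F (Complex x y) \<partial>lborel \<partial>lborel)"
    by (intro nn_integral_complex) measurable
  also have "\<dots> = (\<integral>\<^sup>+x. \<integral>\<^sup>+t. indicator {0<..} x * (indicator {-pi/4..pi/4} t *
         (ennreal (x / (cos t)\<^sup>2) * F (Complex x (x * tan t)))) \<partial>lborel \<partial>lborel)"
  proof (rule nn_integral_cong)
    fix x :: real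
    show "(\<integral>\<^sup>+y. indicator {z. - Re z < Im z \<and> Im z \<le> Re z} (Complex x y) * F (Complex x y) \<partial>lborel)
       = (\<integral>\<^sup>+t. indicator {0<..} x * (indicator {-pi/4..pi/4} t *
         (ennreal (x / (cos t)\<^sup>2) * F (Complex x (x * tan t)))) \<partial>lborel)"
    proof (cases "x > 0")
      case True
      have "(\<integral>\<^sup>+y. indicator {z. - Re z < Im z \<and> Im z \<le> Re z} (Complex x y) * F (Complex x y) \<partial>lborel)
          = (\<integral>\<^sup>+y. F (Complex x y) * indicator {x * tan (-pi/4) .. x * tan (pi/4)} y \<partial>lborel)"
      proof (rule nn_integral_cong_AE)
        have "AE y in lborel. y \<noteq> -x" by (rule AE_lborel_singleton)
        then show "AE y in lborel. indicator {z. - Re z < Im z \<and> Im z \<le> Re z} (Complex x y) * F (Complex x y)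
           = F (Complex x y) * indicator {x * tan (-pi/4) .. x * tan (pi/4)} y"
          by eventually_elim (auto simp: indicator_def tan_45)
      qed
      also have "\<dots> = (\<integral>\<^sup>+t. F (Complex x (x * tan t)) * ennreal (x / (cos t)\<^sup>2) * indicator {-pi/4..pi/4} t \<partial>lborel)"
      proof (rule nn_integral_substitution_aux)
        show "((\<lambda>t. x * tan t) has_real_derivative x / (cos t)\<^sup>2) (at t)" if "t \<in> {-pi/4..pi/4}" for t
          using cosp[OF that] unfolding divide_inverse by (intro DERIV_cmult DERIV_tan) simp
        show "continuous_on {-pi/4..pi/4} (\<lambda>t. x / (cos t)\<^sup>2)"
          by (intro continuous_intros ballI) (use cosp in force)
        show "- pi / 4 < pi / 4" by simp
        show "0 \<le> x / (cos t)\<^sup>2" for t using True by simp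
      qed simp_all
      finally show ?thesis using True
        by (simp add: mult_ac)
    next
      case False
      then have "indicator {z. - Re z < Im z \<and> Im z \<le> Re z} (Complex x y) = (0::ennreal)" for y
        by (auto simp: indicator_def)
      with False show ?thesis by simp
    qed
  qed
  also have "\<dots> = (\<integral>\<^sup>+t. \<integral>\<^sup>+x. indicator {0<..} x * (indicator {-pi/4..pi/4} t *
         (ennreal (x / (cos t)\<^sup>2) * F (Complex x (x * tan t)))) \<partial>lborel \<partial>lborel)"
    by (rule lborel_pair.Fubini'[symmetric]) measurable
  also have "\<dots> = nnint {-pi/4..pi/4} (\<lambda>t. nnint {0<..} (\<lambda>r. ennreal r * F (of_real r * cis t)))"
  proof (rule nn_integral_cong)
    fix t :: real
    show "nnint {0<..} (\<lambda>x. indicator {-pi/4..pi/4} t *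
         (ennreal (x / (cos t)\<^sup>2) * F (Complex x (x * tan t))))
      = indicator {-pi/4..pi/4} t *
         (nnint {0<..} (\<lambda>r. ennreal r * F (of_real r * cis t)))"
    proof (cases "t \<in> {-pi/4..pi/4}")
      case True
      have c: "cos t > 0" by (rule cosp[OF True])
      have "nnint {0<..} (\<lambda>x. indicator {-pi/4..pi/4} t *
         (ennreal (x / (cos t)\<^sup>2) * F (Complex x (x * tan t))))
        = ennreal \<bar>cos t\<bar> * (\<integral>\<^sup>+r. indicator {0<..} (0 + cos t * r) * (indicator {-pi/4..pi/4} t *
         (ennreal ((0 + cos t * r) / (cos t)\<^sup>2) * F (Complex (0 + cos t * r) ((0 + cos t * r) * tan t)))) \<partial>lborel)"
        by (rule nn_integral_real_affine) (use c in simp_all)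
      also have "\<dots> = (\<integral>\<^sup>+r. ennreal (cos t) * (indicator {0<..} (0 + cos t * r) * (indicator {-pi/4..pi/4} t *
         (ennreal ((0 + cos t * r) / (cos t)\<^sup>2) * F (Complex (0 + cos t * r) ((0 + cos t * r) * tan t))))) \<partial>lborel)"
        using c by (subst nn_integral_cmult) auto
      also have "\<dots> = nnint {0<..} (\<lambda>r. ennreal r * F (of_real r * cis t))"
      proof (rule nn_integral_cong)
        fix r :: real
        have e: "Complex (cos t * r) (cos t * r * tan t) = of_real r * cis t"
          using c by (auto simp: complex_eq_iff tan_def)
        have e2: "ennreal (cos t) * (ennreal (cos t * r / (cos t)\<^sup>2) * y) = ennreal r * y" if "r > 0" for y
        proof -
          have "ennreal (cos t) * ennreal (cos t * r / (cos t)\<^sup>2) = ennreal (cos t * (cos t * r / (cos t)\<^sup>2))"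
            using c that by (intro ennreal_mult[symmetric]) auto
          also have "cos t * (cos t * r / (cos t)\<^sup>2) = r"
            using c by (simp add: power2_eq_square)
          finally show ?thesis by (simp add: mult.assoc[symmetric])
        qed
        show "ennreal (cos t) * (indicator {0<..} (0 + cos t * r) * (indicator {-pi/4..pi/4} t *
         (ennreal ((0 + cos t * r) / (cos t)\<^sup>2) * F (Complex (0 + cos t * r) ((0 + cos t * r) * tan t)))))
         = indicator {0<..} r * (ennreal r * F (of_real r * cis t))"
          using c True e e2 by (auto simp: indicator_def zero_less_mult_iff)
      qed
      finally show ?thesis using True by simp
    qed auto
  qed
  finally show ?thesis .
qed

section \<open>Integrals of functions of period 2 pi\<close>

lemma periodic_2pi_int:
  fixes F :: "real \<Rightarrow> 'a"
  assumes per: "\<And>x. F (x + 2*pi) = F x"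
  shows "F (x + 2*pi * of_int k) = F x"
proof -
  have per_nat: "F (x + 2*pi * real n) = F x" for x n
  proof (induction n)
    case (Suc n)
    have "F (x + 2*pi * real (Suc n)) = F ((x + 2*pi * real n) + 2*pi)" by (simp add: algebra_simps)
    then show ?case using Suc per by simp
  qed simp
  show ?thesis
  proof (cases "k \<ge> 0")
    case True
    then show ?thesis using per_nat[of x "nat k"] by simp
  next
    case False
    then show ?thesis using per_nat[of "x + 2*pi * of_int k" "nat (-k)"] by (simp add: algebra_simps)
  qed
qed

text \<open>By periodicity the shift may be taken in [0, 2 pi]. The interval is then cut at 2 pi -
  d, and its two pieces become [d, 2 pi] and, after one more use of the period, [0, d]. This is the
  rotation invariance of arc length.\<close>

lemma nn_integral_period_shift:
  fixes F :: "real \<Rightarrow> ennreal"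
  assumes [measurable]: "F \<in> borel_measurable borel" and per: "\<And>x. F (x + 2*pi) = F x"
  shows "nnint {0..2*pi} (\<lambda>s. F (s + c)) = nnint {0..2*pi} (\<lambda>s. F s)"
proof -
  define k where "k = \<lfloor>c / (2*pi)\<rfloor>"
  define d where "d = c - 2*pi * of_int k"
  have d: "0 \<le> d" "d \<le> 2*pi"
  proof -
    have "of_int k \<le> c / (2*pi)" "c / (2*pi) < of_int k + 1" unfolding k_def by linarith+
    then show "0 \<le> d" "d \<le> 2*pi" unfolding d_def using pi_gt_zero by (auto simp: field_simps)
  qed
  have Fc: "F (s + c) = F (s + d)" for s
    using periodic_2pi_int[of F "s + d" k, OF per] by (simp add: d_def)
  have "nnint {0..2*pi} (\<lambda>s. F (s + c)) = nnint {0..2*pi} (\<lambda>s. F (s + d))"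
    by (simp add: Fc)
  also have "\<dots> = (\<integral>\<^sup>+s. indicator {0..2*pi-d} s * F (s + d) + indicator {2*pi-d..2*pi} s * F (s + d) \<partial>lborel)"
  proof (rule nn_integral_cong_AE)
    have "AE s in lborel. s \<noteq> 2*pi-d" by (rule AE_lborel_singleton)
    then show "AE s in lborel. indicator {0..2*pi} s * F (s + d) =
        indicator {0..2*pi-d} s * F (s + d) + indicator {2*pi-d..2*pi} s * F (s + d)"
      by eventually_elim (use d in \<open>auto simp: indicator_def\<close>)
  qed
  also have "\<dots> = (nnint {0..2*pi-d} (\<lambda>s. F (s + d)))
       + (nnint {2*pi-d..2*pi} (\<lambda>s. F (s + d)))"
    by (rule nn_integral_add) measurable
  also have "nnint {0..2*pi-d} (\<lambda>s. F (s + d)) = nnint {d..2*pi} (\<lambda>s. F s)"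
    by (subst nn_integral_real_affine[of "\<lambda>s. indicator {d..2*pi} s * F s" 1 d])
       (auto intro!: nn_integral_cong simp: indicator_def add.commute)
  also have "nnint {2*pi-d..2*pi} (\<lambda>s. F (s + d)) = nnint {0..d} (\<lambda>s. F s)"
  proof -
    have "F (d - 2*pi + s) = F (s + d)" for s
      using per[of "d - 2*pi + s"] by (simp add: add.commute)
    then show ?thesis
      by (subst nn_integral_real_affine[of "\<lambda>s. indicator {0..d} s * F s" 1 "d-2*pi"])
        (auto intro!: nn_integral_cong simp: indicator_def)
  qed
  also have "(nnint {d..2*pi} (\<lambda>s. F s)) + (nnint {0..d} (\<lambda>s. F s))
     = (\<integral>\<^sup>+s. indicator {d..2*pi} s * F s + indicator {0..d} s * F s \<partial>lborel)"
    by (rule nn_integral_add[symmetric]) measurable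
  also have "\<dots> = nnint {0..2*pi} (\<lambda>s. F s)"
  proof (rule nn_integral_cong_AE)
    have "AE s in lborel. s \<noteq> d" by (rule AE_lborel_singleton)
    then show "AE s in lborel. indicator {d..2*pi} s * F s + indicator {0..d} s * F s = indicator {0..2*pi} s * F s"
      by eventually_elim (use d in \<open>auto simp: indicator_def\<close>)
  qed
  finally show ?thesis .
qed

lemma nn_integral_polar:
  fixes F :: "complex \<Rightarrow> ennreal"
  assumes [measurable]: "F \<in> borel_measurable borel"
  shows "(\<integral>\<^sup>+z. F z \<partial>lborel) = nnint {0..2*pi} (\<lambda>t. nnint {0<..} (\<lambda>r. ennreal r * F (of_real r * cis t)))"
proof -
  define A where "A = {z. - Re z < Im z \<and> Im z \<le> Re z}"
  define P where "P t = nnint {0<..} (\<lambda>r. ennreal r * F (of_real r * cis t))" for t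
  have [measurable]: "A \<in> sets borel" unfolding A_def by measurable
  have Pm[measurable]: "P \<in> borel_measurable borel" unfolding P_def by measurable
  have Pper: "P (t + 2*pi) = P t" for t unfolding P_def by (simp add: cis_mult[symmetric])
  \<comment> \<open>The preimage of \<open>A\<close> under multiplication by \<open>cis b\<close>
    consists of the arguments between -pi/4 - b and pi/4 - b. Below, b is 0, pi/2, pi and 3
    pi/2.\<close>
  have sector: "(\<integral>\<^sup>+z. indicator A (c * z) * F z \<partial>lborel) =
      (nnint {-pi/4-b..pi/4-b} (\<lambda>t. P t))"
    if rot: "\<And>G. G \<in> borel_measurable borel \<Longrightarrow> (\<integral>\<^sup>+z. G (c * z) \<partial>lborel) = (\<integral>\<^sup>+z. G z \<partial>lborel)"
      and c: "c = cis b" for b c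
  proof -
    have "(\<integral>\<^sup>+z. indicator A (c * z) * F z \<partial>lborel) = (\<integral>\<^sup>+z. indicator A (c * z) * F (cis (-b) * (c * z)) \<partial>lborel)"
      unfolding c by (simp add: mult.assoc[symmetric] cis_mult)
    also have "\<dots> = (\<integral>\<^sup>+z. indicator A z * F (cis (-b) * z) \<partial>lborel)"
      by (rule rot) measurable
    also have "\<dots> = nnint {-pi/4..pi/4} (\<lambda>t. nnint {0<..} (\<lambda>r. ennreal r * F (cis (-b) * (of_real r * cis t))))"
      unfolding A_def by (rule nn_integral_complex_sector) measurable
    also have "\<dots> = nnint {-pi/4..pi/4} (\<lambda>t. P (t - b))"
    proof -
      have "cis (-b) * (of_real r * cis t) = of_real r * cis (t - b)" for r t
        by (simp only: mult.left_commute[of "cis (-b)"] cis_mult) simp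
      then show ?thesis by (simp only: P_def)
    qed
    also have "\<dots> = nnint {-pi/4-b..pi/4-b} (\<lambda>t. P t)"
      by (subst nn_integral_real_affine[of "\<lambda>t. indicator {-pi/4-b..pi/4-b} t * P t" 1 "-b"])
         (auto intro!: nn_integral_cong simp: indicator_def)
    finally show ?thesis .
  qed
  have rot1: "(\<integral>\<^sup>+z. G (\<i> * z) \<partial>lborel) = (\<integral>\<^sup>+z. G z \<partial>lborel)"
    if "G \<in> borel_measurable borel" for G :: "complex \<Rightarrow> ennreal"
    by (rule nn_integral_complex_rotate_quarter[OF that])
  have rot2: "(\<integral>\<^sup>+z. G (-1 * z) \<partial>lborel) = (\<integral>\<^sup>+z. G z \<partial>lborel)"
    if [measurable]: "G \<in> borel_measurable borel" for G :: "complex \<Rightarrow> ennreal"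
    using rot1[of "\<lambda>z. G (\<i> * z)"] rot1[OF that] by (simp add: mult.assoc[symmetric])
  have rot3: "(\<integral>\<^sup>+z. G (-\<i> * z) \<partial>lborel) = (\<integral>\<^sup>+z. G z \<partial>lborel)"
    if [measurable]: "G \<in> borel_measurable borel" for G :: "complex \<Rightarrow> ennreal"
    using rot1[of "\<lambda>z. G (-1 * z)"] rot2[OF that] by simp
  have "(\<integral>\<^sup>+z. F z \<partial>lborel) = (\<integral>\<^sup>+z. indicator A (1 * z) * F z + (indicator A (\<i> * z) * F z
      + (indicator A (-1 * z) * F z + indicator A (-\<i> * z) * F z)) \<partial>lborel)"
  proof (rule nn_integral_cong_AE)
    have "AE z in lborel. (z::complex) \<noteq> 0" by (rule AE_lborel_singleton)
    then show "AE z in lborel. F z = indicator A (1 * z) * F z + (indicator A (\<i> * z) * F z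
      + (indicator A (-1 * z) * F z + indicator A (-\<i> * z) * F z))"
    proof eventually_elim
      case (elim z)
      then have "Re z \<noteq> 0 \<or> Im z \<noteq> 0" by (auto simp: complex_eq_iff)
      then consider "- Re z < Im z" "Im z \<le> Re z" | "Im z < Re z" "Re z \<le> - Im z"
        | "Re z \<le> Im z" "Im z < - Re z" | "Re z < Im z" "- Re z \<le> Im z" by linarith
      then show ?case by cases (simp_all add: indicator_def A_def)
    qed
  qed
  also have "\<dots> = (\<integral>\<^sup>+z. indicator A (1 * z) * F z \<partial>lborel) + ((\<integral>\<^sup>+z. indicator A (\<i> * z) * F z \<partial>lborel)
      + ((\<integral>\<^sup>+z. indicator A (-1 * z) * F z \<partial>lborel) + (\<integral>\<^sup>+z. indicator A (-\<i> * z) * F z \<partial>lborel)))"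
    by (simp add: nn_integral_add)
  also have "\<dots> = (nnint {-pi/4-0..pi/4-0} (\<lambda>t. P t)) + ((nnint {-pi/4-pi/2..pi/4-pi/2} (\<lambda>t. P t))
      + ((nnint {-pi/4-pi..pi/4-pi} (\<lambda>t. P t)) + (nnint {-pi/4-3*pi/2..pi/4-3*pi/2} (\<lambda>t. P t))))"
  proof -
    have "cis (3*pi/2) = -\<i>"
      using cos_3over2_pi sin_3over2_pi by (auto simp: complex_eq_iff)
    then have "cis 0 = 1" "cis (pi/2) = \<i>" "cis pi = -1" "cis (3*pi/2) = -\<i>" by auto
    note c = this[symmetric]
    show ?thesis
      by (intro arg_cong2[where f="(+)"] sector c rot1 rot2 rot3) simp_all
  qed
  also have "\<dots> = (\<integral>\<^sup>+t. indicator {-pi/4-0..pi/4-0} t * P t + (indicator {-pi/4-pi/2..pi/4-pi/2} t * P t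
      + (indicator {-pi/4-pi..pi/4-pi} t * P t + indicator {-pi/4-3*pi/2..pi/4-3*pi/2} t * P t)) \<partial>lborel)"
    by (simp add: nn_integral_add)
  \<comment> \<open>The four angular intervals abut, descending from pi/4 to -7 pi/4, and meet only
    in the three excluded points.\<close>
  also have "\<dots> = nnint {-7*pi/4..pi/4} (\<lambda>t. P t)"
  proof (rule nn_integral_cong_AE)
    have "AE t in lborel. t \<noteq> -pi/4" "AE t in lborel. t \<noteq> -3*pi/4" "AE t in lborel. t \<noteq> -5*pi/4" 
      by (rule AE_lborel_singleton)+
    then show "AE t in lborel. indicator {-pi/4-0..pi/4-0} t * P t + (indicator {-pi/4-pi/2..pi/4-pi/2} t * P t
      + (indicator {-pi/4-pi..pi/4-pi} t * P t + indicator {-pi/4-3*pi/2..pi/4-3*pi/2} t * P t))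
      = indicator {-7*pi/4..pi/4} t * P t"
    proof eventually_elim
      case (elim t)
      have "pi > 0" by simp
      consider "t < -7*pi/4" | "-7*pi/4 \<le> t" "t < -5*pi/4" | "-5*pi/4 < t" "t < -3*pi/4"
        | "-3*pi/4 < t" "t < -pi/4" | "-pi/4 < t" "t \<le> pi/4" | "t > pi/4"
        using elim by linarith
      then show ?case
        by cases (use \<open>pi > 0\<close> in \<open>simp_all add: indicator_def\<close>)
    qed
  qed
  also have "\<dots> = nnint {0..2*pi} (\<lambda>t. P (t + (-7*pi/4)))"
    by (subst nn_integral_real_affine[of "\<lambda>t. indicator {-7*pi/4..pi/4} t * P t" 1 "-7*pi/4"])
         (auto intro!: nn_integral_cong simp: indicator_def add.commute)
  also have "\<dots> = nnint {0..2*pi} (\<lambda>t. P t)"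
    by (rule nn_integral_period_shift[OF Pm Pper])
  finally show ?thesis unfolding P_def .
qed

section \<open>Smooth bump functions\<close>

text \<open>The functions \<open>p(1/t) exp(-1/t)\<close>, extended by \<open>0\<close> to \<open>t \<le> 0\<close>, are closed under differentiation;
  sums of products of their affine pullbacks are therefore closed under partial derivatives, which
  yields smooth bumps without iterating Leibniz rules.\<close>

definition flat :: "real poly \<Rightarrow> real \<Rightarrow> real" where
  "flat p t = (if t > 0 then poly p (1 / t) * exp (- (1 / t)) else 0)"

lemma tendsto_poly_exp_minus_at_top: "((\<lambda>s. poly p s * exp (- s)) \<longlongrightarrow> (0::real)) at_top"
proof -
  have "((\<lambda>s::real. \<Sum>i\<le>degree p. coeff p i * (s ^ i / exp s)) \<longlongrightarrow> (\<Sum>i\<le>degree p. coeff p i * 0)) at_top"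
    by (intro tendsto_sum tendsto_mult tendsto_const tendsto_power_div_exp_0)
  then show ?thesis
    by (simp add: poly_altdef sum_distrib_right exp_minus divide_inverse mult.assoc)
qed

text \<open>With s = 1 / t, the derivative of p(s) exp(-s) in t is s^2 (p(s) - p'(s)) exp(-s), which
  explains the polynomial on the right. At 0 both one-sided difference quotients tend to 0.\<close>

lemma DERIV_flat:
  "(flat p has_real_derivative flat (monom 1 2 * (p - pderiv p)) t) (at t)"
proof -
  consider "t > 0" | "t < 0" | "t = 0" by linarith
  then show ?thesis
  proof cases
    case 1
    have "((\<lambda>t. poly p (1 / t) * exp (- (1 / t))) has_real_derivative
        poly (monom 1 2 * (p - pderiv p)) (1 / t) * exp (- (1 / t))) (at t)"
      using 1 by (auto intro!: derivative_eq_intros DERIV_chain'[OF _ poly_DERIV]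
          simp: poly_monom field_simps power2_eq_square)
    then have "(flat p has_real_derivative
        poly (monom 1 2 * (p - pderiv p)) (1 / t) * exp (- (1 / t))) (at t)"
      by (rule has_field_derivative_transform_within_open[where S="{0<..}"]) (use 1 in \<open>auto simp: flat_def\<close>)
    then show ?thesis using 1 by (simp add: flat_def)
  next
    case 2
    have "((\<lambda>t. 0) has_real_derivative 0) (at t)" by simp
    then have "(flat p has_real_derivative 0) (at t)"
      by (rule has_field_derivative_transform_within_open[where S="{..<0}"]) (use 2 in \<open>auto simp: flat_def\<close>)
    then show ?thesis using 2 by (simp add: flat_def)
  next
    case 3
    \<comment> \<open>Dividing by \<open>h\<close> multiplies the polynomial in 1 / h by its
      variable, which is \<open>pCons 0 p\<close>.\<close>
    have "((\<lambda>h. poly (pCons 0 p) (inverse h) * exp (- inverse h)) \<longlongrightarrow> (0::real)) (at_right 0)"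
      by (rule filterlim_compose[OF tendsto_poly_exp_minus_at_top filterlim_inverse_at_top_right])
    then have r: "((\<lambda>h. flat p h / h) \<longlongrightarrow> 0) (at_right 0)"
      by (rule Lim_transform_eventually)
         (auto simp: eventually_at_right_less flat_def field_simps intro!: eventually_at_rightI[of 0 1])
    have l: "((\<lambda>h. flat p h / h) \<longlongrightarrow> 0) (at_left 0)"
      by (rule Lim_transform_eventually[of "\<lambda>_. 0"])
         (auto simp: flat_def intro!: eventually_at_leftI[of "-1" 0])
    have "((\<lambda>h. flat p h / h) \<longlongrightarrow> 0) (at 0)"
      using l r by (simp add: filterlim_at_split)
    then show ?thesis using 3 by (simp add: DERIV_def flat_def)
  qed
qed

inductive_set flat_algebra :: "(complex \<Rightarrow> real) set" where
  base: "(\<lambda>z. flat p (a + b * Re z + c * Im z)) \<in> flat_algebra"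
| add: "F \<in> flat_algebra \<Longrightarrow> G \<in> flat_algebra \<Longrightarrow> (\<lambda>z. F z + G z) \<in> flat_algebra"
| mult: "F \<in> flat_algebra \<Longrightarrow> G \<in> flat_algebra \<Longrightarrow> (\<lambda>z. F z * G z) \<in> flat_algebra"

lemma flat_algebra_const: "(\<lambda>z. k) \<in> flat_algebra"
  \<comment> \<open>The affine argument is constantly 1, where the exponential factor equals exp
    (-1); the factor \<open>exp 1\<close> in the coefficient cancels it.\<close>
  using flat_algebra.base[of "[:k * exp 1:]" 1 0 0] by (simp add: flat_def mult.assoc exp_minus_inverse)

lemma flat_algebra_translate: "F \<in> flat_algebra \<Longrightarrow> (\<lambda>w. F (w - z)) \<in> flat_algebra"
proof (induction rule: flat_algebra.induct)
  case (base p a b c)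
  show ?case
    using flat_algebra.base[of p "a - b * Re z - c * Im z" b c] by (simp add: algebra_simps)
qed (auto intro: flat_algebra.intros)

text \<open>Closure is stated with the total derivative, so that members can later be differentiated
  along curves by the chain rule and not only in the coordinate directions.\<close>

lemma flat_algebra_has_derivative:
  "F \<in> flat_algebra \<Longrightarrow> \<exists>Fx\<in>flat_algebra. \<exists>Fy\<in>flat_algebra.
     \<forall>z. (F has_derivative (\<lambda>v. Re v * Fx z + Im v * Fy z)) (at z)"
proof (induction rule: flat_algebra.induct)
  case (base p a b c)
  define q where "q = monom 1 2 * (p - pderiv p)"
  have b: "b * flat q t = flat (smult b q) t" for b t by (simp add: flat_def)
  have "((\<lambda>z. flat p (a + b * Re z + c * Im z)) has_derivative
      (\<lambda>v. Re v * flat (smult b q) (a + b * Re z + c * Im z) + Im v * flat (smult c q) (a + b * Re z + c * Im z))) (at z)" for z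
  proof -
    have "((\<lambda>z. a + b * Re z + c * Im z) has_derivative (\<lambda>v. b * Re v + c * Im v)) (at z)"
      by (auto intro!: derivative_eq_intros)
    from has_derivative_compose[OF this DERIV_flat[THEN has_field_derivative_imp_has_derivative], of p]
    show ?thesis unfolding q_def[symmetric] b[symmetric] by (simp add: algebra_simps)
  qed
  then show ?case
    by (intro bexI[of _ "\<lambda>z. flat (smult b q) (a + b * Re z + c * Im z)"]
        bexI[of _ "\<lambda>z. flat (smult c q) (a + b * Re z + c * Im z)"] allI flat_algebra.base)
next
  case (add F G)
  then obtain Fx Fy Gx Gy where *: "Fx \<in> flat_algebra" "Fy \<in> flat_algebra" "Gx \<in> flat_algebra" "Gy \<in> flat_algebra"
    "\<And>z. (F has_derivative (\<lambda>v. Re v * Fx z + Im v * Fy z)) (at z)"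
    "\<And>z. (G has_derivative (\<lambda>v. Re v * Gx z + Im v * Gy z)) (at z)" by blast
  have "((\<lambda>z. F z + G z) has_derivative (\<lambda>v. Re v * (Fx z + Gx z) + Im v * (Fy z + Gy z))) (at z)" for z
    by (rule has_derivative_eq_rhs[OF has_derivative_add[OF *(5,6)]]) (auto simp: algebra_simps)
  then show ?case using * by (intro bexI[of _ "\<lambda>z. Fx z + Gx z"] bexI[of _ "\<lambda>z. Fy z + Gy z"] allI flat_algebra.add)
next
  case (mult F G)
  then obtain Fx Fy Gx Gy where *: "Fx \<in> flat_algebra" "Fy \<in> flat_algebra" "Gx \<in> flat_algebra" "Gy \<in> flat_algebra"
    "\<And>z. (F has_derivative (\<lambda>v. Re v * Fx z + Im v * Fy z)) (at z)"
    "\<And>z. (G has_derivative (\<lambda>v. Re v * Gx z + Im v * Gy z)) (at z)" by blast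
  have "((\<lambda>z. F z * G z) has_derivative
      (\<lambda>v. Re v * (F z * Gx z + Fx z * G z) + Im v * (F z * Gy z + Fy z * G z))) (at z)" for z
    by (rule has_derivative_eq_rhs[OF has_derivative_mult[OF *(5,6)]]) (auto simp: algebra_simps)
  then show ?case using * mult.hyps
    by (intro bexI[of _ "\<lambda>z. F z * Gx z + Fx z * G z"] bexI[of _ "\<lambda>z. F z * Gy z + Fy z * G z"] allI flat_algebra.intros)
qed

lemma flat_algebra_continuous: "F \<in> flat_algebra \<Longrightarrow> continuous_on UNIV F"
  using flat_algebra_has_derivative[of F] has_derivative_continuous
  by (blast intro: continuous_at_imp_continuous_on)

lemma has_derivative_imp_partials:
  assumes "(F has_derivative (\<lambda>v. Re v * a + Im v * b)) (at z)"
  shows "((\<lambda>t. F (z + of_real t)) has_real_derivative a) (at 0)"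
    and "((\<lambda>t. F (z + \<i> * of_real t)) has_real_derivative b) (at 0)"
proof -
  have F: "(F has_derivative (\<lambda>v. Re v * a + Im v * b)) (at (z + c * of_real 0))" for c using assms by simp
  have "((\<lambda>t. z + c * of_real t) has_derivative (\<lambda>t. c * of_real t)) (at (0::real))" for c :: complex
    by (auto intro!: derivative_eq_intros)
  note D = has_derivative_compose[OF this F]
  show "((\<lambda>t. F (z + of_real t)) has_real_derivative a) (at 0)"
    using D[of 1] by (simp add: has_field_derivative_def mult_commute_abs)
  show "((\<lambda>t. F (z + \<i> * of_real t)) has_real_derivative b) (at 0)"
    using D[of \<i>] by (simp add: has_field_derivative_def mult_commute_abs)
qed

text \<open>Choice functions for the two partial derivatives stay inside the algebra, so folding
  them along the list of directions yields all iterated derivatives at once.\<close>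

lemma flat_algebra_smooth:
  assumes "\<psi> \<in> flat_algebra"
  shows "smooth_fun \<psi>"
proof -
  have "\<exists>X Y. \<forall>F\<in>flat_algebra. X F \<in> flat_algebra \<and> Y F \<in> flat_algebra \<and>
     (\<forall>z. (F has_derivative (\<lambda>v. Re v * X F z + Im v * Y F z)) (at z))"
    using flat_algebra_has_derivative by metis
  then obtain X Y where XY: "\<And>F. F \<in> flat_algebra \<Longrightarrow> X F \<in> flat_algebra"
      "\<And>F. F \<in> flat_algebra \<Longrightarrow> Y F \<in> flat_algebra"
      "\<And>F z. F \<in> flat_algebra \<Longrightarrow> (F has_derivative (\<lambda>v. Re v * X F z + Im v * Y F z)) (at z)"
    by blast
  define D where "D ds = foldr (\<lambda>b F. if b then X F else Y F) ds \<psi>" for ds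
  have mem: "D ds \<in> flat_algebra" for ds
    by (induction ds) (auto simp: D_def assms XY)
  have "D (True # ds) = X (D ds)" "D (False # ds) = Y (D ds)" for ds by (simp_all add: D_def)
  then show ?thesis unfolding smooth_fun_def
    using flat_algebra_continuous[OF mem] has_derivative_imp_partials[OF XY(3)[OF mem]]
    by (intro exI[of _ D]) (simp add: D_def)
qed

lemma mollifier_exists:
  assumes "e > 0"
  obtains \<eta> where "\<eta> \<in> flat_algebra" "\<And>w. \<eta> w \<ge> 0" "\<And>w. \<eta> w \<noteq> 0 \<Longrightarrow> cmod w \<le> 2 * e"
    "(\<integral>\<^sup>+w. ennreal (\<eta> w) \<partial>lborel) = 1"
proof -
  \<comment> \<open>The four factors are positive exactly for Re w < e, Re w > -e, Im w < e and Im w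
    > -e, so the support is a square. Every point of it satisfies cmod w <= |Re w| + |Im w| < 2 e,
    the source of the radius 2 e.\<close>
  define \<beta> where "\<beta> w = flat 1 (e + (-1) * Re w + 0 * Im w) * flat 1 (e + 1 * Re w + 0 * Im w)
     * flat 1 (e + 0 * Re w + (-1) * Im w) * flat 1 (e + 0 * Re w + 1 * Im w)" for w
  have mem: "\<beta> \<in> flat_algebra" unfolding \<beta>_def by (intro flat_algebra.intros)
  have pos: "\<beta> w \<ge> 0" for w by (simp add: \<beta>_def flat_def)
  have supp: "\<beta> w \<noteq> 0 \<longleftrightarrow> \<bar>Re w\<bar> < e \<and> \<bar>Im w\<bar> < e" for w by (auto simp: \<beta>_def flat_def)
  have supp2: "cmod w \<le> 2 * e" if "\<beta> w \<noteq> 0" for w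
    using supp[of w] that cmod_le[of w] by linarith
  have le1: "flat 1 t \<le> 1" "flat 1 t \<ge> 0" for t by (auto simp: flat_def)
  have bd: "\<beta> w \<le> 1" for w unfolding \<beta>_def by (intro mult_le_one le1 mult_nonneg_nonneg)
  have [measurable]: "\<beta> \<in> borel_measurable borel"
    using flat_algebra_continuous[OF mem] by (rule borel_measurable_continuous_onI)
  define I where "I = (\<integral>\<^sup>+w. ennreal (\<beta> w) \<partial>lborel)"
  have "I \<le> (\<integral>\<^sup>+w. indicator (cball 0 (2*e)) (w::complex) \<partial>lborel)"
    unfolding I_def
  proof (rule nn_integral_mono)
    fix w
    show "ennreal (\<beta> w) \<le> indicator (cball 0 (2*e)) w"
      by (cases "\<beta> w = 0") (use bd[of w] supp2[of w] in \<open>auto simp: ennreal_le_1\<close>)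
  qed
  also have "\<dots> < \<infinity>" using emeasure_bounded_finite[of "cball (0::complex) (2*e)"] by simp
  finally have fin: "I < \<infinity>" .
  have "I \<noteq> 0"
  proof
    assume "I = 0"
    then have "AE w in lborel. ennreal (\<beta> w) = 0" unfolding I_def by (subst (asm) nn_integral_0_iff_AE) auto
    then have "AE w in lborel. \<not> (\<bar>Re w\<bar> < e \<and> \<bar>Im w\<bar> < e)"
    proof eventually_elim
      case (elim w)
      then have "\<beta> w = 0" using pos[of w] by (simp add: ennreal_eq_0_iff)
      then show ?case using supp[of w] by simp
    qed
    then have "emeasure lborel {w. \<bar>Re w\<bar> < e \<and> \<bar>Im w\<bar> < e} = 0"
      by (subst (asm) AE_iff_measurable[OF _ refl]) auto
    moreover have "{w. \<bar>Re w\<bar> < e \<and> \<bar>Im w\<bar> < e} = box (Complex (-e) (-e)) (Complex e e)"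
      by (auto simp: box_def Basis_complex_def abs_less_iff)
    ultimately show False using assms by (simp add: emeasure_lborel_box_eq Basis_complex_def)
  qed
  define k where "k = 1 / enn2real I"
  have Ie: "I = ennreal (enn2real I)" using fin by simp
  have Ip: "enn2real I > 0" using fin \<open>I \<noteq> 0\<close> by (simp add: enn2real_positive_iff zero_less_iff_neq_zero)
  have k: "k > 0" using Ip by (simp add: k_def)
  show ?thesis
  proof (rule that[of "\<lambda>w. k * \<beta> w"])
    show "(\<lambda>w. k * \<beta> w) \<in> flat_algebra" by (intro flat_algebra.mult flat_algebra_const mem)
    show "k * \<beta> w \<ge> 0" for w using k pos by simp
    show "cmod w \<le> 2 * e" if "k * \<beta> w \<noteq> 0" for w using supp2 that by simp
    have "(\<integral>\<^sup>+w. ennreal (k * \<beta> w) \<partial>lborel) = ennreal k * I"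
      using k pos unfolding I_def by (simp add: ennreal_mult nn_integral_cmult)
    also have "\<dots> = ennreal (k * enn2real I)" using k Ip by (subst Ie) (simp add: ennreal_mult)
    also have "\<dots> = 1" using Ip by (simp add: k_def)
    finally show "(\<integral>\<^sup>+w. ennreal (k * \<beta> w) \<partial>lborel) = 1" .
  qed
qed

section \<open>Hardy inequality and mollification\<close>

text \<open>If \<open>f\<close> is not integrable, its integral has the default value 0 and the
  bound is trivial.\<close>

lemma ennreal_norm_integral_le:
  fixes f :: "'a \<Rightarrow> 'b::{banach, second_countable_topology}"
  shows "ennreal (norm (LINT x|M. f x)) \<le> (\<integral>\<^sup>+x. ennreal (norm (f x)) \<partial>M)"
  by (cases "integrable M f") (simp_all add: integral_norm_bound_ennreal not_integrable_integral_eq)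

lemma nn_integral_complex_reflect:
  fixes F :: "complex \<Rightarrow> ennreal"
  assumes [measurable]: "F \<in> borel_measurable borel"
  shows "(\<integral>\<^sup>+z. F (w - z) \<partial>lborel) = (\<integral>\<^sup>+z. F z \<partial>lborel)"
proof -
  have "(\<integral>\<^sup>+z. F z \<partial>lborel) = (\<integral>\<^sup>+z. F z \<partial>density (distr lborel borel (\<lambda>x. w + (-1) *\<^sub>R x)) (\<lambda>_. ennreal (\<bar>-1\<bar> ^ DIM(complex))))"
    using lborel_affine[of "-1" w] by simp
  then show ?thesis by (simp add: nn_integral_density nn_integral_distr)
qed

lemma nn_integral_complex_translate:
  fixes F :: "complex \<Rightarrow> ennreal"
  assumes [measurable]: "F \<in> borel_measurable borel"
  shows "(\<integral>\<^sup>+w. F (w - z) \<partial>lborel) = (\<integral>\<^sup>+z. F z \<partial>lborel)"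
proof -
  have "(\<integral>\<^sup>+z. F z \<partial>lborel) = (\<integral>\<^sup>+z. F z \<partial>density (distr lborel borel (\<lambda>x. - z + 1 *\<^sub>R x)) (\<lambda>_. ennreal (\<bar>1\<bar> ^ DIM(complex))))"
    using lborel_affine[of 1 "-z"] by simp
  then show ?thesis by (simp add: nn_integral_density nn_integral_distr)
qed

text \<open>This integral enters Hardy's inequality twice, once from Cauchy-Schwarz and once after
  the scaling, and so produces the constant 4 = 2 * 2.\<close>

lemma nn_integral_inverse_sqrt:
  "nnint {0<..<1} (\<lambda>x. ennreal (x powr (-1/2))) = 2"
proof -
  have "((\<lambda>x::real. x powr (-1/2)) has_integral (1 powr (-1/2+1) / (-1/2+1))) {0..1}"
    by (rule has_integral_powr_from_0) auto
  then have "((\<lambda>x::real. x powr (-1/2)) has_integral 2) {0..1}" by simp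
  from nn_integral_has_integral_lebesgue[OF _ this]
  have "(\<integral>\<^sup>+x. ennreal (indicator {0..1} x * x powr (-1/2)) \<partial>lborel) = 2" by simp
  moreover have "nnint {0<..<1} (\<lambda>x. ennreal (x powr (-1/2)))
      = (\<integral>\<^sup>+x. ennreal (indicator {0..1} x * x powr (-1/2)) \<partial>lborel)"
  proof (rule nn_integral_cong_AE)
    have "AE x in lborel. x \<noteq> (0::real)" "AE x in lborel. x \<noteq> (1::real)" by (rule AE_lborel_singleton)+
    then show "AE x in lborel. indicator {0<..<1} x * ennreal (x powr (-1/2)) = ennreal (indicator {0..1} x * x powr (-1/2))"
      by eventually_elim (auto simp: indicator_def)
  qed
  ultimately show ?thesis by simp
qed

text \<open>Cauchy--Schwarz with the weight \<open>x powr (-1/2)\<close>, then scaling in \<open>t\<close> for fixed \<open>x\<close>.\<close>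

lemma hardy_inequality:
  fixes G :: "real \<Rightarrow> ennreal"
  assumes [measurable]: "G \<in> borel_measurable borel"
  shows "nnint {0<..<a} (\<lambda>t. (nnint {0<..<1} (\<lambda>x. G (t * x)))\<^sup>2)
    \<le> 4 * (nnint {0<..<a} (\<lambda>y. (G y)\<^sup>2))"
proof -
  define Q where "Q = nnint {0<..<a} (\<lambda>y. (G y)\<^sup>2)"
  have sq: "(indicator A x)\<^sup>2 = (indicator A x :: ennreal)" for A :: "real set" and x
    by (simp add: indicator_def)
  have w: "indicator {0<..<1} x * G y = (indicator {0<..<1} x * ennreal (x powr (-1/4))) * (indicator {0<..<1} x * (ennreal (x powr (1/4)) * G y))" for x y :: real
  proof (cases "x \<in> {0<..<1}")
    case True
    then have "x powr (-1/4) * x powr (1/4) = 1" by (simp add: powr_add[symmetric])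
    then have "ennreal (x powr (-1/4)) * ennreal (x powr (1/4)) = 1" by (simp add: ennreal_mult[symmetric])
    then show ?thesis using True by (simp add: mult.assoc[symmetric])
  qed simp
  have p2: "(x powr (-1/4))\<^sup>2 = x powr (-1/2)" "(x powr (1/4))\<^sup>2 = x powr (1/2)" for x :: real
    by (simp_all add: power2_eq_square powr_add[symmetric])
  have cs: "(nnint {0<..<1} (\<lambda>x. G (t * x)))\<^sup>2
     \<le> 2 * (nnint {0<..<1} (\<lambda>x. ennreal (x powr (1/2)) * (G (t * x))\<^sup>2))" for t
  proof -
    have "(nnint {0<..<1} (\<lambda>x. G (t * x)))\<^sup>2 \<le>
      (\<integral>\<^sup>+x. (indicator {0<..<1} x * ennreal (x powr (-1/4)))\<^sup>2 \<partial>lborel) *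
      (\<integral>\<^sup>+x. (indicator {0<..<1} x * (ennreal (x powr (1/4)) * G (t * x)))\<^sup>2 \<partial>lborel)"
      unfolding w by (rule Cauchy_Schwarz_nn_integral) measurable
    also have "\<dots> = 2 * (nnint {0<..<1} (\<lambda>x. ennreal (x powr (1/2)) * (G (t * x))\<^sup>2))"
      by (simp only: sq power_mult_distrib ennreal_power powr_ge_zero p2 nn_integral_inverse_sqrt)
    finally show ?thesis .
  qed
  have "nnint {0<..<a} (\<lambda>t. (nnint {0<..<1} (\<lambda>x. G (t * x)))\<^sup>2)
    \<le> nnint {0<..<a} (\<lambda>t. 2 * (nnint {0<..<1} (\<lambda>x. ennreal (x powr (1/2)) * (G (t * x))\<^sup>2)))"
    by (intro nn_integral_mono mult_left_mono cs) auto
  also have "\<dots> = (\<integral>\<^sup>+t. \<integral>\<^sup>+x. 2 * (indicator {0<..<1} x * (ennreal (x powr (1/2)) * (indicator {0<..<a} t * (G (t * x))\<^sup>2))) \<partial>lborel \<partial>lborel)"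
    by (simp add: nn_integral_cmult[symmetric] mult_ac)
  also have "\<dots> = (\<integral>\<^sup>+x. \<integral>\<^sup>+t. 2 * (indicator {0<..<1} x * (ennreal (x powr (1/2)) * (indicator {0<..<a} t * (G (t * x))\<^sup>2))) \<partial>lborel \<partial>lborel)"
    by (rule lborel_pair.Fubini') measurable
  also have "\<dots> = (\<integral>\<^sup>+x. 2 * (indicator {0<..<1} x * (ennreal (x powr (1/2)) * (nnint {0<..<a} (\<lambda>t. (G (t * x))\<^sup>2)))) \<partial>lborel)"
    by (simp add: nn_integral_cmult)
  also have "\<dots> \<le> (\<integral>\<^sup>+x. 2 * (indicator {0<..<1} x * (ennreal (x powr (-1/2)) * Q)) \<partial>lborel)"
  proof (rule nn_integral_mono, rule mult_left_mono)
    fix x :: real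
    show "indicator {0<..<1} x * (ennreal (x powr (1/2)) * (nnint {0<..<a} (\<lambda>t. (G (t * x))\<^sup>2)))
      \<le> indicator {0<..<1} x * (ennreal (x powr (-1/2)) * Q)"
    proof (cases "x \<in> {0<..<1}")
      case True
      then have x: "0 < x" "x < 1" by auto
      define I where "I = nnint {0<..<a} (\<lambda>t. (G (t * x))\<^sup>2)"
      \<comment> \<open>The substitution y = t x costs a factor 1 / x, which turns the weight
        x^(1/2) into x^(-1/2), still integrable on (0, 1). As x < 1, the range of y stays inside (0,
        a).\<close>
      have "ennreal x * I = nnint {0<..<a*x} (\<lambda>y. (G y)\<^sup>2)"
        unfolding I_def
        by (subst nn_integral_real_affine[of "\<lambda>y. indicator {0<..<a*x} y * (G y)\<^sup>2" x 0])
           (use x in \<open>auto simp: indicator_def mult.commute zero_less_mult_iff intro!: arg_cong[where f="\<lambda>y. _ * y"] nn_integral_cong\<close>)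
      also have "\<dots> \<le> Q" unfolding Q_def
      proof (intro nn_integral_mono mult_right_mono)
        fix y
        have "y < a" if "0 < y" "y < a * x"
        proof -
          have "0 < a * x" using that by linarith
          then have "a > 0" using x by (simp add: zero_less_mult_iff)
          then have "a * x \<le> a" using x by simp
          then show ?thesis using that by linarith
        qed
        then show "indicator {0<..<a*x} y \<le> (indicator {0<..<a} y :: ennreal)" by (auto simp: indicator_def)
      qed auto
      finally have *: "ennreal x * I \<le> Q" .
      have "x powr (1/2) = x powr (-1/2) * x"
        using x powr_add[of x "-1/2" 1] by simp
      then have "ennreal (x powr (1/2)) * I = ennreal (x powr (-1/2)) * (ennreal x * I)"
        using x by (simp add: ennreal_mult mult.assoc)
      also have "\<dots> \<le> ennreal (x powr (-1/2)) * Q" by (intro mult_left_mono *) auto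
      finally show ?thesis using True unfolding I_def by simp
    qed simp
  qed auto
  also have "\<dots> = (\<integral>\<^sup>+x. (2 * Q) * (indicator {0<..<1} x * ennreal (x powr (-1/2))) \<partial>lborel)"
    by (simp add: mult_ac)
  also have "\<dots> = (2 * Q) * 2"
    by (subst nn_integral_cmult) (simp_all add: nn_integral_inverse_sqrt[simplified])
  finally show ?thesis unfolding Q_def by (simp add: mult_ac mult.left_commute[of 2])
qed

text \<open>The kernel is a probability density in \<open>w\<close>, so the square of the average is
  at most the average of the squares; this is Cauchy-Schwarz after splitting \<eta> into two square
  roots. By reflection its mass in \<open>z\<close> is 1 as well, so Fubini gives the claim.\<close>

lemma nn_integral_mollify_square_le:
  fixes \<eta> :: "complex \<Rightarrow> real" and G :: "complex \<Rightarrow> ennreal"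
  assumes [measurable]: "\<eta> \<in> borel_measurable borel" "G \<in> borel_measurable borel"
    and pos: "\<And>w. \<eta> w \<ge> 0" and one: "(\<integral>\<^sup>+w. ennreal (\<eta> w) \<partial>lborel) = 1"
  shows "(\<integral>\<^sup>+z. (\<integral>\<^sup>+w. ennreal (\<eta> (w - z)) * G w \<partial>lborel)\<^sup>2 \<partial>lborel) \<le> (\<integral>\<^sup>+w. (G w)\<^sup>2 \<partial>lborel)"
proof -
  have "(\<integral>\<^sup>+z. (\<integral>\<^sup>+w. ennreal (\<eta> (w - z)) * G w \<partial>lborel)\<^sup>2 \<partial>lborel)
     \<le> (\<integral>\<^sup>+z. \<integral>\<^sup>+w. ennreal (\<eta> (w - z)) * (G w)\<^sup>2 \<partial>lborel \<partial>lborel)"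
  proof (rule nn_integral_mono)
    fix z
    have s: "(ennreal (sqrt (\<eta> w)))\<^sup>2 = ennreal (\<eta> w)" for w using pos by (simp add: ennreal_power)
    have "(\<integral>\<^sup>+w. ennreal (\<eta> (w - z)) * G w \<partial>lborel)\<^sup>2
       = (\<integral>\<^sup>+w. ennreal (sqrt (\<eta> (w - z))) * (ennreal (sqrt (\<eta> (w - z))) * G w) \<partial>lborel)\<^sup>2"
      by (simp add: s[symmetric] power2_eq_square mult.assoc)
    also have "\<dots> \<le> (\<integral>\<^sup>+w. (ennreal (sqrt (\<eta> (w - z))))\<^sup>2 \<partial>lborel) * (\<integral>\<^sup>+w. (ennreal (sqrt (\<eta> (w - z))) * G w)\<^sup>2 \<partial>lborel)"
      by (rule Cauchy_Schwarz_nn_integral) measurable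
    also have "\<dots> = (\<integral>\<^sup>+w. ennreal (\<eta> (w - z)) \<partial>lborel) * (\<integral>\<^sup>+w. ennreal (\<eta> (w - z)) * (G w)\<^sup>2 \<partial>lborel)"
      by (simp only: power_mult_distrib s)
    also have "(\<integral>\<^sup>+w. ennreal (\<eta> (w - z)) \<partial>lborel) = 1"
      using nn_integral_complex_translate[of "\<lambda>w. ennreal (\<eta> w)" z] one by simp
    finally show "(\<integral>\<^sup>+w. ennreal (\<eta> (w - z)) * G w \<partial>lborel)\<^sup>2 \<le> (\<integral>\<^sup>+w. ennreal (\<eta> (w - z)) * (G w)\<^sup>2 \<partial>lborel)"
      by simp
  qed
  also have "\<dots> = (\<integral>\<^sup>+w. \<integral>\<^sup>+z. ennreal (\<eta> (w - z)) * (G w)\<^sup>2 \<partial>lborel \<partial>lborel)"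
    by (rule lborel_pair.Fubini') measurable
  also have "\<dots> = (\<integral>\<^sup>+w. (\<integral>\<^sup>+z. ennreal (\<eta> (w - z)) \<partial>lborel) * (G w)\<^sup>2 \<partial>lborel)"
    by (intro nn_integral_cong nn_integral_multc) measurable
  also have "\<dots> = (\<integral>\<^sup>+w. (G w)\<^sup>2 \<partial>lborel)"
    using nn_integral_complex_reflect[of "\<lambda>w. ennreal (\<eta> w)"] one by simp
  finally show ?thesis .
qed

text \<open>Hardy's inequality in y = t x comes at the price of 4. The twist c y then depends only
  on the radius and is removed by rotating \<open>s\<close>. For y < 1/4 one has R - y > 1/4, so
  inserting the polar weight R - y costs another 4.\<close>

lemma nn_integral_spiral_le:
  fixes K :: "complex \<Rightarrow> ennreal"
  assumes [measurable]: "K \<in> borel_measurable borel" and R: "1/2 \<le> R" 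
  shows "nnint {0..2*pi} (\<lambda>s. nnint {0<..<1/4} (\<lambda>t. (nnint {0<..<1} (\<lambda>x. K (of_real (R - t * x) * cis (s + c * (t * x)))))\<^sup>2))
    \<le> 16 * (\<integral>\<^sup>+z. (K z)\<^sup>2 \<partial>lborel)"
proof -
  have "nnint {0..2*pi} (\<lambda>s. nnint {0<..<1/4} (\<lambda>t. (nnint {0<..<1} (\<lambda>x. K (of_real (R - t * x) * cis (s + c * (t * x)))))\<^sup>2))
    \<le> nnint {0..2*pi} (\<lambda>s. 4 * (nnint {0<..<1/4} (\<lambda>y. (K (of_real (R - y) * cis (s + c * y)))\<^sup>2)))"
    by (intro nn_integral_mono mult_left_mono hardy_inequality[of "\<lambda>y. K (of_real (R - y) * cis (_ + c * y))"]) auto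
  also have "\<dots> = (\<integral>\<^sup>+s. \<integral>\<^sup>+y. 4 * (indicator {0<..<1/4} y * (indicator {0..2*pi} s * (K (of_real (R - y) * cis (s + c * y)))\<^sup>2)) \<partial>lborel \<partial>lborel)"
    by (simp add: nn_integral_cmult[symmetric] mult_ac)
  also have "\<dots> = (\<integral>\<^sup>+y. \<integral>\<^sup>+s. 4 * (indicator {0<..<1/4} y * (indicator {0..2*pi} s * (K (of_real (R - y) * cis (s + c * y)))\<^sup>2)) \<partial>lborel \<partial>lborel)"
    by (rule lborel_pair.Fubini') measurable
  also have "\<dots> = (\<integral>\<^sup>+y. 4 * (indicator {0<..<1/4} y * (nnint {0..2*pi} (\<lambda>s. (K (of_real (R - y) * cis (s + c * y)))\<^sup>2))) \<partial>lborel)"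
    by (simp add: nn_integral_cmult)
  also have "\<dots> = (\<integral>\<^sup>+y. 4 * (indicator {0<..<1/4} y * (nnint {0..2*pi} (\<lambda>s. (K (of_real (R - y) * cis s))\<^sup>2))) \<partial>lborel)"
  proof -
    have "nnint {0..2*pi} (\<lambda>s. (K (of_real (R - y) * cis (s + c * y)))\<^sup>2) =
       (nnint {0..2*pi} (\<lambda>s. (K (of_real (R - y) * cis s))\<^sup>2))" for y
      by (rule nn_integral_period_shift[of "\<lambda>s. (K (of_real (R - y) * cis s))\<^sup>2"]) (simp_all add: cis_mult[symmetric])
    then show ?thesis by (simp only:)
  qed
  also have "\<dots> \<le> (\<integral>\<^sup>+y. 16 * (indicator {0<..} (R - y) * (ennreal (R - y) * (nnint {0..2*pi} (\<lambda>s. (K (of_real (R - y) * cis s))\<^sup>2)))) \<partial>lborel)"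
  proof (rule nn_integral_mono)
    fix y :: real
    define X where "X = nnint {0..2*pi} (\<lambda>s. (K (of_real (R - y) * cis s))\<^sup>2)"
    have "4 * X \<le> 16 * (ennreal (R - y) * X)" if "y < 1/4"
    proof -
      have "4 * X = (16 * ennreal (1/4)) * X" by (simp add: ennreal_mult[symmetric] ennreal_numeral[symmetric] del: ennreal_numeral)
      also have "\<dots> \<le> (16 * ennreal (R - y)) * X"
        using that R by (intro mult_right_mono mult_left_mono ennreal_leI) auto
      finally show ?thesis by (simp add: mult.assoc)
    qed
    then show "4 * (indicator {0<..<1/4} y * (nnint {0..2*pi} (\<lambda>s. (K (of_real (R - y) * cis s))\<^sup>2)))
      \<le> 16 * (indicator {0<..} (R - y) * (ennreal (R - y) * (nnint {0..2*pi} (\<lambda>s. (K (of_real (R - y) * cis s))\<^sup>2))))"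
      using R unfolding X_def[symmetric] by (auto simp: indicator_def)
  qed
  also have "\<dots> = (\<integral>\<^sup>+r. 16 * (indicator {0<..} r * (ennreal r * (nnint {0..2*pi} (\<lambda>s. (K (of_real r * cis s))\<^sup>2)))) \<partial>lborel)"
    by (subst nn_integral_real_affine[of "\<lambda>r. 16 * (indicator {0<..} r * (ennreal r * (nnint {0..2*pi} (\<lambda>s. (K (of_real r * cis s))\<^sup>2))))" "-1" R]) simp_all
  also have "\<dots> = 16 * (\<integral>\<^sup>+r. (nnint {0..2*pi} (\<lambda>s. indicator {0<..} r * (ennreal r * (K (of_real r * cis s))\<^sup>2))) \<partial>lborel)"
    by (simp add: nn_integral_cmult[symmetric] mult_ac)
  also have "(\<integral>\<^sup>+r. (nnint {0..2*pi} (\<lambda>s. indicator {0<..} r * (ennreal r * (K (of_real r * cis s))\<^sup>2))) \<partial>lborel)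
     = (\<integral>\<^sup>+s. (\<integral>\<^sup>+r. indicator {0..2*pi} s * (indicator {0<..} r * (ennreal r * (K (of_real r * cis s))\<^sup>2)) \<partial>lborel) \<partial>lborel)"
    by (rule lborel_pair.Fubini') measurable
  also have "\<dots> = (\<integral>\<^sup>+z. (K z)\<^sup>2 \<partial>lborel)"
    by (subst nn_integral_polar) (simp_all add: nn_integral_cmult)
  finally show ?thesis .
qed

section \<open>Mollification of weakly differentiable functions on the disk\<close>

lemma locally_integrable_measurable:
  assumes "locally_integrable_on (ball 0 1) g"
  shows "(\<lambda>w. indicator (ball 0 1) w *\<^sub>R g w) \<in> borel_measurable borel"
proof (rule borel_measurable_LIMSEQ_metric)
  \<comment> \<open>Local integrability speaks about compact sets only, so the open disk is
    exhausted by closed disks and \<open>g\<close> is obtained as a pointwise limit.\<close>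
  define C where "C n = cball (0::complex) (1 - 1 / real (Suc n))" for n
  have sub: "C n \<subseteq> ball 0 1" for n
  proof
    fix x assume "x \<in> C n"
    moreover have "1 / real (Suc n) > 0" by simp
    ultimately show "x \<in> ball 0 1" unfolding C_def mem_cball_0 mem_ball_0 by linarith
  qed
  have "compact (C n)" for n by (simp add: C_def)
  then have "integrable lborel (\<lambda>w. indicator (C n) w *\<^sub>R g w)" for n
    using assms sub unfolding locally_integrable_on_def set_integrable_def by simp
  from borel_measurable_integrable[OF this]
  show "(\<lambda>w. indicator (C n) w *\<^sub>R g w) \<in> borel_measurable borel" for n by simp
  fix w :: complex
  show "(\<lambda>n. indicator (C n) w *\<^sub>R g w) \<longlonglongrightarrow> indicator (ball 0 1) w *\<^sub>R g w"
  proof (cases "w \<in> ball 0 1")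
    case True
    then obtain N where N: "1 / real (Suc N) < 1 - cmod w"
      using nat_approx_posE[of "1 - cmod w"] by auto
    have "w \<in> C n" if "n \<ge> N" for n
    proof -
      have "1 / real (Suc n) \<le> 1 / real (Suc N)" using that by (simp add: frac_le)
      then show ?thesis using N by (simp add: C_def)
    qed
    then have "\<forall>\<^sub>F n in sequentially. indicator (C n) w *\<^sub>R g w = indicator (ball 0 1) w *\<^sub>R g w"
      using True by (auto simp: eventually_sequentially indicator_def)
    then show ?thesis by (rule tendsto_eventually)
  next
    case False
    then have "w \<notin> C n" for n using sub by blast
    then show ?thesis using False by simp
  qed
qed

lemma gradient_norm_measurable:
  assumes "weak_partials h (ball 0 1) g1 g2"
  shows "(\<lambda>w. indicator (ball 0 1) w * ennreal (norm (g1 w) + norm (g2 w))) \<in> borel_measurable borel"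
proof -
  have "(\<lambda>w. indicator (ball 0 1) w *\<^sub>R g1 w) \<in> borel_measurable borel"
    "(\<lambda>w. indicator (ball 0 1) w *\<^sub>R g2 w) \<in> borel_measurable borel"
    using assms by (auto simp: weak_partials_def intro: locally_integrable_measurable)
  then have "(\<lambda>w. ennreal (norm (indicator (ball 0 1) w *\<^sub>R g1 w) + norm (indicator (ball 0 1) w *\<^sub>R g2 w))) \<in> borel_measurable borel"
    by measurable
  also have "(\<lambda>w. ennreal (norm (indicator (ball 0 1) w *\<^sub>R g1 w) + norm (indicator (ball 0 1) w *\<^sub>R g2 w)))
    = (\<lambda>w. indicator (ball 0 1) w * ennreal (norm (g1 w) + norm (g2 w)))"
    by (auto simp: indicator_def)
  finally show ?thesis .
qed

text \<open>Only the smooth kernel is differentiated along the path; Fubini exchanges the path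
  parameter with \<open>w\<close>, and the weak formulation then moves the derivative onto
  \<open>h\<close>. The condition \<open>cmod (\<gamma> x) + d < 1\<close> keeps every translate of
  the kernel supported in the open disk and thus an admissible test function. The extension
  \<open>hb\<close> of \<open>h\<close> by 0 lets all integrals run over the plane.\<close>

lemma mollified_path_bound:
  fixes h g1 g2 :: "complex \<Rightarrow> complex" and \<eta> :: "complex \<Rightarrow> real"
  defines "hb \<equiv> \<lambda>w. indicator (ball 0 1) w *\<^sub>R h w"
  defines "u \<equiv> \<lambda>z. LINT w|lborel. \<eta> (w - z) *\<^sub>R hb w"
  defines "G \<equiv> \<lambda>w. indicator (ball 0 1) w * ennreal (norm (g1 w) + norm (g2 w))"
  assumes hc: "continuous_on (cball 0 1) h"
    and weak: "weak_partials h (ball 0 1) g1 g2"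
    and eta: "\<eta> \<in> flat_algebra" "\<And>w. \<eta> w \<ge> 0" "\<And>w. \<eta> w \<noteq> 0 \<Longrightarrow> cmod w \<le> d"
    and path: "\<And>x. (\<gamma> has_vector_derivative \<gamma>' x) (at x)" "continuous_on UNIV \<gamma>'"
    and inside: "\<And>x. x \<in> {0..1} \<Longrightarrow> cmod (\<gamma> x) + d < 1"
    and L: "\<And>x. x \<in> {0..1} \<Longrightarrow> cmod (\<gamma>' x) \<le> L"
  shows "ennreal (norm (u (\<gamma> 1) - u (\<gamma> 0))) \<le>
    ennreal L * (nnint {0<..<1} (\<lambda>x. (\<integral>\<^sup>+w. ennreal (\<eta> (w - \<gamma> x)) * G w \<partial>lborel)))"
proof -
  have g1m: "(\<lambda>w. indicator (ball 0 1) w *\<^sub>R g1 w) \<in> borel_measurable borel"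
    and g2m: "(\<lambda>w. indicator (ball 0 1) w *\<^sub>R g2 w) \<in> borel_measurable borel"
    using weak by (auto simp: weak_partials_def intro: locally_integrable_measurable)
  have Geq: "G = (\<lambda>w. ennreal (norm (indicator (ball 0 1) w *\<^sub>R g1 w) + norm (indicator (ball 0 1) w *\<^sub>R g2 w)))"
    by (auto simp: G_def indicator_def)
  have Gm[measurable]: "G \<in> borel_measurable borel" unfolding Geq using g1m g2m by measurable
  have hbm[measurable]: "hb \<in> borel_measurable borel"
    unfolding hb_def
    by (rule borel_measurable_continuous_on_indicator) (auto intro: continuous_on_subset[OF hc])
  obtain M where M: "\<And>w. w \<in> cball 0 1 \<Longrightarrow> norm (h w) \<le> M"
    by (rule continuous_on_compact_bound[OF compact_cball hc], rule that)
  have M0: "M \<ge> 0" using M[of 0] norm_ge_zero[of "h 0"] by (simp, linarith)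
  have hbM: "norm (hb w) \<le> M" for w using M[of w] M0 by (auto simp: hb_def indicator_def)
  obtain \<eta>x \<eta>y where ex: "\<eta>x \<in> flat_algebra" "\<eta>y \<in> flat_algebra"
     and der: "\<And>z. (\<eta> has_derivative (\<lambda>v. Re v * \<eta>x z + Im v * \<eta>y z)) (at z)"
    using flat_algebra_has_derivative[OF eta(1)] by blast
  have cont: "continuous_on UNIV \<eta>" "continuous_on UNIV \<eta>x" "continuous_on UNIV \<eta>y"
    using ex eta(1) by (auto intro: flat_algebra_continuous)
  have [measurable]: "\<eta> \<in> borel_measurable borel" "\<eta>x \<in> borel_measurable borel" "\<eta>y \<in> borel_measurable borel"
    using cont by (auto intro: borel_measurable_continuous_onI)
  have contg: "continuous_on UNIV \<gamma>"
    using path(1) has_vector_derivative_continuous continuous_at_imp_continuous_on by blast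
  have [measurable]: "\<gamma> \<in> borel_measurable borel" "\<gamma>' \<in> borel_measurable borel"
    using contg path(2) by (auto intro: borel_measurable_continuous_onI)
  \<comment> \<open>Beyond distance \<open>d\<close> the kernel vanishes on an open set, so its
    derivative vanishes there too.\<close>
  have zero: "\<eta>x w = 0 \<and> \<eta>y w = 0" if "cmod w > d" for w
  proof -
    have "((\<lambda>_. 0) has_derivative (\<lambda>_. 0)) (at w)" by simp
    then have "(\<eta> has_derivative (\<lambda>_. 0)) (at w)"
      by (rule has_derivative_transform_within_open[where s="- cball 0 d"]) (use that eta(3) in force)+
    from has_derivative_unique[OF this der]
    have *: "0 = Re v * \<eta>x w + Im v * \<eta>y w" for v by (rule fun_cong)
    show ?thesis using *[of 1] *[of \<i>] by simp
  qed
  have wk: "(LINT w|lborel. \<eta>x (w - z) *\<^sub>R hb w) = - (LINT w|lborel. \<eta> (w - z) *\<^sub>R g1 w) \<and>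
            (LINT w|lborel. \<eta>y (w - z) *\<^sub>R hb w) = - (LINT w|lborel. \<eta> (w - z) *\<^sub>R g2 w)"
    if z: "cmod z + d < 1" for z
  proof -
    have sub: "w \<in> ball 0 1" if "cmod (w - z) \<le> d" for w
      using that z norm_triangle_ineq[of "w - z" z] by simp
    have cl: "closure {w. \<eta> (w - z) \<noteq> 0} \<subseteq> cball z d"
      by (rule closure_minimal) (use eta(3) in \<open>auto simp: dist_norm norm_minus_commute\<close>)
    have "test_function (ball 0 1) (\<lambda>w. \<eta> (w - z))"
      unfolding test_function_def
    proof (intro conjI)
      show "smooth_fun (\<lambda>w. \<eta> (w - z))"
        by (intro flat_algebra_smooth flat_algebra_translate eta)
      show "compact (closure {w. \<eta> (w - z) \<noteq> 0})"
        using cl bounded_subset[OF bounded_cball cl] by (simp add: compact_eq_bounded_closed)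
      show "closure {w. \<eta> (w - z) \<noteq> 0} \<subseteq> ball 0 1"
        using cl sub by (force simp: dist_norm norm_minus_commute)
    qed
    then have 1: "(LINT w|lborel. of_real (dx (\<lambda>w. \<eta> (w - z)) w) * h w) = - (LINT w|lborel. of_real (\<eta> (w - z)) * g1 w)"
      "(LINT w|lborel. of_real (dy (\<lambda>w. \<eta> (w - z)) w) * h w) = - (LINT w|lborel. of_real (\<eta> (w - z)) * g2 w)"
      using weak unfolding weak_partials_def by blast+
    have "((\<lambda>w. \<eta> (w - z)) has_derivative (\<lambda>v. Re v * \<eta>x (w - z) + Im v * \<eta>y (w - z))) (at w)" for w
      by (rule has_derivative_compose[of "\<lambda>w. w - z" "\<lambda>v. v" w UNIV, OF _ der]) (auto intro!: derivative_eq_intros)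
    note P = has_derivative_imp_partials[OF this, THEN DERIV_imp_deriv]
    have 2: "dx (\<lambda>w. \<eta> (w - z)) w = \<eta>x (w - z)" "dy (\<lambda>w. \<eta> (w - z)) w = \<eta>y (w - z)" for w
      unfolding dx_def dy_def by (rule P)+
    have 3: "of_real (\<eta>x (w - z)) * h w = \<eta>x (w - z) *\<^sub>R hb w" "of_real (\<eta>y (w - z)) * h w = \<eta>y (w - z) *\<^sub>R hb w" for w
      using zero[of "w - z"] sub[of w] by (cases "cmod (w - z) \<le> d"; simp add: hb_def scaleR_conv_of_real)+
    show ?thesis using 1 unfolding 2 3 by (simp add: scaleR_conv_of_real)
  qed
  \<comment> \<open>This is the derivative of \<open>\<eta> (w - \<gamma> x)\<close> in
    \<open>x\<close>. Its sign comes from the inner function w - \<gamma> x and later cancels the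
    minus sign of the weak formulation.\<close>
  define \<kappa> where "\<kappa> x w = - (Re (\<gamma>' x) * \<eta>x (w - \<gamma> x) + Im (\<gamma>' x) * \<eta>y (w - \<gamma> x))" for x w
  have contk: "continuous_on UNIV (\<lambda>p. \<kappa> (fst p) (snd p))"
    unfolding \<kappa>_def
    by (intro continuous_intros continuous_on_compose2[OF cont(2)] continuous_on_compose2[OF cont(3)]
        continuous_on_compose2[OF contg] continuous_on_compose2[OF path(2)]) auto
  have [measurable]: "(\<lambda>(x, w). \<kappa> x w) \<in> borel_measurable (borel \<Otimes>\<^sub>M borel)"
    unfolding \<kappa>_def by measurable
  have ftc: "(LINT x|lborel. indicator {0..1} x *\<^sub>R \<kappa> x w) = \<eta> (w - \<gamma> 1) - \<eta> (w - \<gamma> 0)" for w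
  proof (rule integral_FTC_Icc)
    show "(0::real) \<le> 1" by simp
    show "continuous_on {0..1} (\<lambda>x. \<kappa> x w)"
      using continuous_on_compose2[OF contk, of "{0..1}" "\<lambda>x. (x, w)"] by (simp add: continuous_on_Pair continuous_on_const continuous_on_id)
    fix x :: real
    have "(\<gamma> has_derivative (\<lambda>t. t *\<^sub>R \<gamma>' x)) (at x within {0..1})"
      using path(1)[of x] unfolding has_vector_derivative_def by (rule has_derivative_at_withinI)
    from has_derivative_diff[OF has_derivative_const this]
    have "((\<lambda>x. w - \<gamma> x) has_derivative (\<lambda>t. - (t *\<^sub>R \<gamma>' x))) (at x within {0..1})"
      by simp
    from has_derivative_compose[OF this der]
    show "((\<lambda>x. \<eta> (w - \<gamma> x)) has_vector_derivative \<kappa> x w) (at x within {0..1})"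
      unfolding has_vector_derivative_def \<kappa>_def
      by (rule has_derivative_eq_rhs) (auto simp: algebra_simps)
  qed
  have intk: "integrable lborel (\<lambda>w. c w *\<^sub>R hb w)" if c: "continuous_on UNIV c" for c :: "complex \<Rightarrow> real"
  proof -
    have [measurable]: "c \<in> borel_measurable borel" using c by (rule borel_measurable_continuous_onI)
    obtain B where B: "\<And>w. w \<in> cball 0 1 \<Longrightarrow> norm (c w) \<le> B"
      by (rule continuous_on_compact_bound[OF compact_cball continuous_on_subset[OF c]]) (simp, rule that)
    show ?thesis
    proof (rule integrableI_bounded_set[where A="ball 0 1" and B="B * M"])
      show "(\<lambda>w. c w *\<^sub>R hb w) \<in> borel_measurable lborel" by simp
      show "emeasure lborel (ball (0::complex) 1) < \<infinity>" by (rule emeasure_bounded_finite) simp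
      show "AE w in lborel. w \<in> ball 0 1 \<longrightarrow> norm (c w *\<^sub>R hb w) \<le> B * M"
      proof (intro AE_I2 impI)
        fix w :: complex assume "w \<in> ball 0 1"
        then have "\<bar>c w\<bar> \<le> B" using B[of w] by simp
        then show "norm (c w *\<^sub>R hb w) \<le> B * M"
          using hbM[of w] by (simp, intro mult_mono) auto
      qed
    qed (auto simp: hb_def)
  qed
  have inte: "integrable lborel (\<lambda>w. \<eta> (w - z) *\<^sub>R hb w)" "integrable lborel (\<lambda>w. \<eta>x (w - z) *\<^sub>R hb w)"
     "integrable lborel (\<lambda>w. \<eta>y (w - z) *\<^sub>R hb w)" for z
    by (intro intk continuous_on_compose2[OF cont(1)] continuous_on_compose2[OF cont(2)]
        continuous_on_compose2[OF cont(3)] continuous_intros; simp)+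
  define f where "f x w = (indicator {0..1} x * \<kappa> x w) *\<^sub>R hb w" for x :: real and w
  \<comment> \<open>The integrand is bounded and lives on the product of [0, 1] and the disk, a set
    of finite measure; this licenses Fubini.\<close>
  have intf: "integrable (lborel \<Otimes>\<^sub>M lborel) (\<lambda>(x, w). f x w)"
  proof -
    obtain B where B': "\<And>p. p \<in> {0..1} \<times> cball 0 1 \<Longrightarrow> norm (\<kappa> (fst p) (snd p)) \<le> B"
      by (rule continuous_on_compact_bound[OF compact_Times continuous_on_subset[OF contk], of "{0..1}" "cball 0 1"]) (simp_all, rule that, simp)
    have B: "norm (\<kappa> x w) \<le> B" if "x \<in> {0..1}" "w \<in> cball 0 1" for x w
      using B'[of "(x, w)"] that by simp
    show ?thesis
    proof (rule integrableI_bounded_set[where A="{0..1} \<times> ball 0 1" and B="B * M"])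
      show "{0..1::real} \<times> ball (0::complex) 1 \<in> sets (lborel \<Otimes>\<^sub>M lborel)" by (intro pair_measureI) simp_all
      show "(\<lambda>(x, w). f x w) \<in> borel_measurable (lborel \<Otimes>\<^sub>M lborel)" unfolding f_def by measurable
      have "emeasure lborel (ball (0::complex) 1) < \<infinity>" by (rule emeasure_bounded_finite) simp
      then show "emeasure (lborel \<Otimes>\<^sub>M lborel) ({0..1::real} \<times> ball (0::complex) 1) < \<infinity>"
        by (simp add: lborel.emeasure_pair_measure_Times)
      show "AE p in lborel \<Otimes>\<^sub>M lborel. p \<in> {0..1} \<times> ball 0 1 \<longrightarrow> norm (case p of (x, w) \<Rightarrow> f x w) \<le> B * M"
      proof (intro AE_I2 impI)
        fix p :: "real \<times> complex" assume p: "p \<in> {0..1} \<times> ball 0 1"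
        obtain x w where pe: "p = (x, w)" by (cases p)
        have "\<bar>\<kappa> x w\<bar> \<le> B" using B[of x w] p pe by simp
        then have "\<bar>\<kappa> x w\<bar> * norm (hb w) \<le> B * M" using hbM[of w] by (intro mult_mono) auto
        then show "norm (case p of (x, w) \<Rightarrow> f x w) \<le> B * M" using p pe by (simp add: f_def)
      qed
    qed (auto simp: f_def hb_def indicator_def)
  qed
  have "u (\<gamma> 1) - u (\<gamma> 0) = (LINT w|lborel. (\<eta> (w - \<gamma> 1) - \<eta> (w - \<gamma> 0)) *\<^sub>R hb w)"
    unfolding u_def by (simp add: scaleR_diff_left inte)
  also have "\<dots> = (LINT w|lborel. LINT x|lborel. f x w)"
  proof (intro Bochner_Integration.integral_cong refl)
    fix w
    have "integrable lborel (\<lambda>x. indicator {0..1} x *\<^sub>R \<kappa> x w)"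
      using continuous_on_compose2[OF contk, of "{0..1}" "\<lambda>x. (x, w)"]
      by (intro borel_integrable_compact) (simp_all add: continuous_on_Pair continuous_on_const continuous_on_id)
    then have "(LINT x|lborel. (indicator {0..1} x *\<^sub>R \<kappa> x w) *\<^sub>R hb w) = (LINT x|lborel. indicator {0..1} x *\<^sub>R \<kappa> x w) *\<^sub>R hb w"
      by (intro integral_scaleR_left)
    then show "(\<eta> (w - \<gamma> 1) - \<eta> (w - \<gamma> 0)) *\<^sub>R hb w = (LINT x|lborel. f x w)"
      unfolding ftc f_def by simp
  qed
  also have "\<dots> = (LINT x|lborel. LINT w|lborel. f x w)"
    by (rule lborel_pair.Fubini_integral[OF intf])
  finally have eq: "u (\<gamma> 1) - u (\<gamma> 0) = (LINT x|lborel. LINT w|lborel. f x w)" .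
  have bound: "ennreal (norm (LINT w|lborel. f x w)) \<le>
      indicator {0..1} x * (ennreal L * (\<integral>\<^sup>+w. ennreal (\<eta> (w - \<gamma> x)) * G w \<partial>lborel))" for x
  proof (cases "x \<in> {0..1}")
    case True
    define z where "z = \<gamma> x"
    have z: "cmod z + d < 1" using inside[OF True] by (simp add: z_def)
    have L0: "L \<ge> 0" "\<bar>Re (\<gamma>' x)\<bar> \<le> L" "\<bar>Im (\<gamma>' x)\<bar> \<le> L"
      using L[OF True] abs_Re_le_cmod[of "\<gamma>' x"] abs_Im_le_cmod[of "\<gamma>' x"] norm_ge_zero[of "\<gamma>' x"] by linarith+
    have nb: "ennreal (norm (LINT w|lborel. \<eta> (w - z) *\<^sub>R g w)) \<le> (\<integral>\<^sup>+w. ennreal (\<eta> (w - z)) * ennreal (norm (indicator (ball 0 1) w *\<^sub>R g w)) \<partial>lborel)" for g :: "complex \<Rightarrow> complex"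
    proof -
      have "ennreal (norm (LINT w|lborel. \<eta> (w - z) *\<^sub>R g w)) \<le> (\<integral>\<^sup>+w. ennreal (norm (\<eta> (w - z) *\<^sub>R g w)) \<partial>lborel)"
        by (rule ennreal_norm_integral_le)
      also have "\<dots> = (\<integral>\<^sup>+w. ennreal (\<eta> (w - z)) * ennreal (norm (indicator (ball 0 1) w *\<^sub>R g w)) \<partial>lborel)"
      proof (rule nn_integral_cong)
        fix w
        show "ennreal (norm (\<eta> (w - z) *\<^sub>R g w)) = ennreal (\<eta> (w - z)) * ennreal (norm (indicator (ball 0 1) w *\<^sub>R g w))"
        proof (cases "\<eta> (w - z) = 0")
          case False
          then have "w \<in> ball 0 1"
            using eta(3)[of "w - z"] z norm_triangle_ineq[of "w - z" z] by simp
          then show ?thesis using eta(2)[of "w - z"] by (simp add: ennreal_mult)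
        qed simp
      qed
      finally show ?thesis .
    qed
    have "(LINT w|lborel. f x w) = (LINT w|lborel. - Re (\<gamma>' x) *\<^sub>R (\<eta>x (w - z) *\<^sub>R hb w) - Im (\<gamma>' x) *\<^sub>R (\<eta>y (w - z) *\<^sub>R hb w))"
      using True by (simp add: f_def \<kappa>_def z_def scaleR_diff_left minus_diff_commute)
    also have "\<dots> = - Re (\<gamma>' x) *\<^sub>R (LINT w|lborel. \<eta>x (w - z) *\<^sub>R hb w) - Im (\<gamma>' x) *\<^sub>R (LINT w|lborel. \<eta>y (w - z) *\<^sub>R hb w)"
      using inte(2,3)[of z] by (simp add: integrable_scaleR_right del: scaleR_scaleR)
    also have "\<dots> = Re (\<gamma>' x) *\<^sub>R (LINT w|lborel. \<eta> (w - z) *\<^sub>R g1 w) + Im (\<gamma>' x) *\<^sub>R (LINT w|lborel. \<eta> (w - z) *\<^sub>R g2 w)"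
      using wk[OF z] by simp
    finally have "norm (LINT w|lborel. f x w) \<le> \<bar>Re (\<gamma>' x)\<bar> * norm (LINT w|lborel. \<eta> (w - z) *\<^sub>R g1 w)
       + \<bar>Im (\<gamma>' x)\<bar> * norm (LINT w|lborel. \<eta> (w - z) *\<^sub>R g2 w)"
      using norm_triangle_ineq by (metis norm_scaleR)
    also have "\<dots> \<le> L * (norm (LINT w|lborel. \<eta> (w - z) *\<^sub>R g1 w) + norm (LINT w|lborel. \<eta> (w - z) *\<^sub>R g2 w))"
      unfolding distrib_left by (intro add_mono mult_right_mono L0) auto
    finally have "ennreal (norm (LINT w|lborel. f x w)) \<le> ennreal L * (ennreal (norm (LINT w|lborel. \<eta> (w - z) *\<^sub>R g1 w)) + ennreal (norm (LINT w|lborel. \<eta> (w - z) *\<^sub>R g2 w)))"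
      using L0 by (simp add: ennreal_mult[symmetric] ennreal_plus[symmetric] ennreal_leI del: ennreal_plus)
    also have "\<dots> \<le> ennreal L * ((\<integral>\<^sup>+w. ennreal (\<eta> (w - z)) * ennreal (norm (indicator (ball 0 1) w *\<^sub>R g1 w)) \<partial>lborel)
         + (\<integral>\<^sup>+w. ennreal (\<eta> (w - z)) * ennreal (norm (indicator (ball 0 1) w *\<^sub>R g2 w)) \<partial>lborel))"
      by (intro mult_left_mono add_mono nb) auto
    also have "\<dots> = ennreal L * (\<integral>\<^sup>+w. ennreal (\<eta> (w - z)) * G w \<partial>lborel)"
    proof -
      have [measurable]: "(\<lambda>w. ennreal (norm (indicator (ball 0 1) w *\<^sub>R g1 w))) \<in> borel_measurable borel"
        "(\<lambda>w. ennreal (norm (indicator (ball 0 1) w *\<^sub>R g2 w))) \<in> borel_measurable borel"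
        using g1m g2m by measurable
      have "(\<integral>\<^sup>+w. ennreal (\<eta> (w - z)) * ennreal (norm (indicator (ball 0 1) w *\<^sub>R g1 w)) \<partial>lborel)
         + (\<integral>\<^sup>+w. ennreal (\<eta> (w - z)) * ennreal (norm (indicator (ball 0 1) w *\<^sub>R g2 w)) \<partial>lborel)
         = (\<integral>\<^sup>+w. ennreal (\<eta> (w - z)) * ennreal (norm (indicator (ball 0 1) w *\<^sub>R g1 w))
           + ennreal (\<eta> (w - z)) * ennreal (norm (indicator (ball 0 1) w *\<^sub>R g2 w)) \<partial>lborel)"
        by (rule nn_integral_add[symmetric]) measurable
      also have "\<dots> = (\<integral>\<^sup>+w. ennreal (\<eta> (w - z)) * G w \<partial>lborel)"
        unfolding Geq by (simp add: distrib_left)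
      finally show ?thesis by simp
    qed
    finally show ?thesis using True by (simp add: z_def)
  qed (simp add: f_def)
  have "ennreal (norm (u (\<gamma> 1) - u (\<gamma> 0))) \<le> (\<integral>\<^sup>+x. ennreal (norm (LINT w|lborel. f x w)) \<partial>lborel)"
    unfolding eq by (rule ennreal_norm_integral_le)
  also have "\<dots> \<le> nnint {0..1} (\<lambda>x. ennreal L * (\<integral>\<^sup>+w. ennreal (\<eta> (w - \<gamma> x)) * G w \<partial>lborel))"
    by (intro nn_integral_mono bound)
  also have "\<dots> = (\<integral>\<^sup>+x. ennreal L * (indicator {0<..<1} x * (\<integral>\<^sup>+w. ennreal (\<eta> (w - \<gamma> x)) * G w \<partial>lborel)) \<partial>lborel)"
  proof (rule nn_integral_cong_AE)
    have "AE x in lborel. x \<noteq> (0::real)" "AE x in lborel. x \<noteq> (1::real)" by (rule AE_lborel_singleton)+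
    then show "AE x in lborel. indicator {0..1} x * (ennreal L * (\<integral>\<^sup>+w. ennreal (\<eta> (w - \<gamma> x)) * G w \<partial>lborel))
       = ennreal L * (indicator {0<..<1} x * (\<integral>\<^sup>+w. ennreal (\<eta> (w - \<gamma> x)) * G w \<partial>lborel))"
      by eventually_elim (auto simp: indicator_def)
  qed
  also have "\<dots> = ennreal L * (nnint {0<..<1} (\<lambda>x. (\<integral>\<^sup>+w. ennreal (\<eta> (w - \<gamma> x)) * G w \<partial>lborel)))"
    by (rule nn_integral_cmult) measurable
  finally show ?thesis .
qed

section \<open>The Douglas energy\<close>

lemma cmod_cis_diff: "cmod (cis a - cis b) = 2 * \<bar>sin ((a - b) / 2)\<bar>"
proof -
  have "cis a - cis b = cis b * (cis (a - b) - 1)" by (simp add: algebra_simps cis_mult)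
  then have "cmod (cis a - cis b) = cmod (cis (a - b) - 1)" by (simp add: norm_mult)
  then show ?thesis using dist_exp_i_1[of "a - b"] by (simp add: cis_conv_exp)
qed

text \<open>Since 1 < pi / 3, the cosine is at least cos (pi / 3) = 1/2 on [0, 1].\<close>

lemma sin_ge_half:
  assumes "0 \<le> x" "x \<le> 1"
  shows "x / 2 \<le> sin (x::real)"
proof -
  have "sin 0 - 0 / 2 \<le> sin x - x / 2"
  proof (rule DERIV_nonneg_imp_nondecreasing[OF assms(1)])
    fix y assume y: "0 \<le> y" "y \<le> x"
    have "cos (pi / 3) \<le> cos y"
      using y assms pi_gt3 by (intro cos_monotone_0_pi_le) auto
    then show "\<exists>d. ((\<lambda>x. sin x - x / 2) has_real_derivative d) (at y) \<and> 0 \<le> d"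
      by (intro exI[of _ "cos y - 1/2"]) (auto intro!: derivative_eq_intros simp: cos_60)
  qed
  then show ?thesis by simp
qed

lemma cmod_cis_diff_ge:
  assumes "\<bar>a - b\<bar> \<le> 2"
  shows "\<bar>a - b\<bar> / 2 \<le> cmod (cis a - cis b)"
proof -
  have "\<bar>(a - b) / 2\<bar> / 2 \<le> sin \<bar>(a - b) / 2\<bar>" using assms by (intro sin_ge_half) auto
  also have "\<dots> \<le> \<bar>sin ((a - b) / 2)\<bar>" by (cases "a \<ge> b") (auto simp: abs_if)
  finally show ?thesis unfolding cmod_cis_diff by simp
qed

lemma cmod_cis_diff_le: "cmod (cis a - cis b) \<le> \<bar>a - b\<bar>"
  unfolding cmod_cis_diff using abs_sin_x_le_abs_x[of "(a - b) / 2"] by simp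

lemma cis_shift_period [simp]: "cis (x + 2*pi) = cis x"
  by (simp add: cis_mult[symmetric])

lemma nn_integral_lborel_swap_cmult:
  fixes f :: "real \<Rightarrow> real \<Rightarrow> ennreal"
  assumes [measurable]: "case_prod f \<in> borel_measurable (borel \<Otimes>\<^sub>M borel)" "A \<in> sets borel" "B \<in> sets borel"
  shows "(\<integral>\<^sup>+s. indicator A s * (\<integral>\<^sup>+t. indicator B t * f s t \<partial>lborel) \<partial>lborel)
       = (\<integral>\<^sup>+t. indicator B t * (\<integral>\<^sup>+s. indicator A s * f s t \<partial>lborel) \<partial>lborel)"
proof -
  have "(\<integral>\<^sup>+s. indicator A s * (\<integral>\<^sup>+t. indicator B t * f s t \<partial>lborel) \<partial>lborel)
     = (\<integral>\<^sup>+s. \<integral>\<^sup>+t. indicator A s * (indicator B t * f s t) \<partial>lborel \<partial>lborel)"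
    by (intro nn_integral_cong nn_integral_cmult[symmetric]) measurable
  also have "\<dots> = (\<integral>\<^sup>+t. \<integral>\<^sup>+s. indicator A s * (indicator B t * f s t) \<partial>lborel \<partial>lborel)"
    by (rule lborel_pair.Fubini') measurable
  also have "\<dots> = (\<integral>\<^sup>+t. \<integral>\<^sup>+s. indicator B t * (indicator A s * f s t) \<partial>lborel \<partial>lborel)"
    by (simp only: mult.left_commute)
  also have "\<dots> = (\<integral>\<^sup>+t. indicator B t * (\<integral>\<^sup>+s. indicator A s * f s t \<partial>lborel) \<partial>lborel)"
    by (intro nn_integral_cong nn_integral_cmult) measurable
  finally show ?thesis .
qed

text \<open>The function on the circle is replaced by its pullback \<open>p\<close> to angles. Where
  \<open>cis s = cis t\<close>, division by 0 gives the kernel the value 0.\<close>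

definition douglas_kernel :: "(real \<Rightarrow> complex) \<Rightarrow> real \<Rightarrow> real \<Rightarrow> ennreal" where
  "douglas_kernel p s t = ennreal ((cmod ((p s - p t) / (cis s - cis t)))\<^sup>2)"

lemma borel_measurable_douglas_kernel [measurable (raw)]:
  assumes [measurable]: "p \<in> borel_measurable borel" "f \<in> borel_measurable M" "g \<in> borel_measurable M"
  shows "(\<lambda>x. douglas_kernel p (f x) (g x)) \<in> borel_measurable M"
  unfolding douglas_kernel_def by measurable

definition douglas_energy :: "(real \<Rightarrow> complex) \<Rightarrow> ennreal" where
  "douglas_energy p = nnint {0..2*pi} (\<lambda>s. nnint {0..2*pi} (\<lambda>t. douglas_kernel p s t))"

lemma douglas_kernel_commute: "douglas_kernel p s t = douglas_kernel p t s"
  unfolding douglas_kernel_def by (simp add: norm_divide norm_minus_commute)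

lemma douglas_energy_shift:
  assumes [measurable]: "p \<in> borel_measurable borel" and per: "\<And>x. p (x + 2*pi) = p x"
  shows "douglas_energy p = nnint {0..2*pi} (\<lambda>s. nnint {0..2*pi} (\<lambda>t. douglas_kernel p s (s + t)))"
proof -
  have "nnint {0..2*pi} (\<lambda>t. douglas_kernel p s (t + s)) =
      (nnint {0..2*pi} (\<lambda>t. douglas_kernel p s t))" for s
    by (rule nn_integral_period_shift) (auto simp: douglas_kernel_def per)
  then show ?thesis unfolding douglas_energy_def by (simp add: add.commute)
qed

text \<open>The symmetric pair x - d, x + d is the one that occurs in \<open>mean_slope\<close>.
  Rotating by d turns it into x, x + 2 d, and t = 2 d ranges over (0, 2), a part of one period; the
  Jacobian 2 only helps.\<close>

lemma nn_integral_douglas_kernel_centered_le: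
  assumes [measurable]: "p \<in> borel_measurable borel" and per: "\<And>x. p (x + 2*pi) = p x"
  shows "nnint {0..2*pi} (\<lambda>x. nnint {0<..<1} (\<lambda>d. douglas_kernel p (x - d) (x + d)))
    \<le> douglas_energy p"
proof -
  have "nnint {0..2*pi} (\<lambda>x. nnint {0<..<1} (\<lambda>d. douglas_kernel p (x - d) (x + d)))
    = nnint {0<..<1} (\<lambda>d. nnint {0..2*pi} (\<lambda>x. douglas_kernel p (x - d) (x + d)))"
    by (rule nn_integral_lborel_swap_cmult) measurable
  also have "\<dots> = nnint {0<..<1} (\<lambda>d. nnint {0..2*pi} (\<lambda>x. douglas_kernel p x (x + 2 * d)))"
  proof -
    have "nnint {0..2*pi} (\<lambda>x. douglas_kernel p (x + (-d)) (x + (-d) + 2 * d)) =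
      (nnint {0..2*pi} (\<lambda>x. douglas_kernel p x (x + 2 * d)))" for d
    proof (rule nn_integral_period_shift[of "\<lambda>x. douglas_kernel p x (x + 2 * d)" "-d"])
      show "douglas_kernel p (x + 2*pi) (x + 2*pi + 2*d) = douglas_kernel p x (x + 2*d)" for x
        using per[of x] per[of "x + 2*d"] cis_shift_period[of "x + 2*d"]
        by (simp add: douglas_kernel_def add_ac)
    qed measurable
    then show ?thesis by (simp add: add_ac)
  qed
  also have "\<dots> = nnint {0..2*pi} (\<lambda>x. nnint {0<..<1} (\<lambda>d. douglas_kernel p x (x + 2 * d)))"
    by (rule nn_integral_lborel_swap_cmult[symmetric]) measurable
  also have "\<dots> \<le> nnint {0..2*pi} (\<lambda>x. nnint {0..2*pi} (\<lambda>t. douglas_kernel p x (x + t)))"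
  proof (rule nn_integral_mono, rule mult_left_mono)
    fix x :: real
    have "(nnint {0<..<1} (\<lambda>d. douglas_kernel p x (x + 2 * d)))
       \<le> ennreal 2 * (nnint {0<..<1} (\<lambda>d. douglas_kernel p x (x + 2 * d)))"
      using mult_right_mono[of 1 "ennreal 2"] by simp
    also have "\<dots> = nnint {0<..<2} (\<lambda>t. douglas_kernel p x (x + t))"
      by (subst nn_integral_real_affine[of "\<lambda>t. indicator {0<..<2} t * douglas_kernel p x (x + t)" 2 0])
         (auto simp: indicator_def intro!: arg_cong[where f="\<lambda>y. _ * y"] nn_integral_cong)
    also have "\<dots> \<le> nnint {0..2*pi} (\<lambda>t. douglas_kernel p x (x + t))"
    proof (rule nn_integral_mono)
      fix t :: real
      show "indicator {0<..<2} t * douglas_kernel p x (x + t) \<le> indicator {0..2*pi} t * douglas_kernel p x (x + t)"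
        using pi_gt3 by (cases "t \<in> {0<..<2}") auto
    qed
    finally show "(nnint {0<..<1} (\<lambda>d. douglas_kernel p x (x + 2 * d)))
      \<le> nnint {0..2*pi} (\<lambda>t. douglas_kernel p x (x + t))" .
  qed auto
  also have "\<dots> = douglas_energy p" by (rule douglas_energy_shift[OF assms, symmetric])
  finally show ?thesis .
qed

text \<open>At angular distance between 1/2 and 2 pi - 1/2 the chord is at least 2 sin (1/4), and
  bounded \<open>p\<close> gives a bounded kernel. Only a strip at the diagonal remains, where the
  chord between \<open>s\<close> and \<open>s + 2 * t\<close> is at least t; the distances 2 t with
  t < 1/4 fill it.\<close>

lemma douglas_energy_finite:
  assumes [measurable]: "p \<in> borel_measurable borel" and per: "\<And>x. p (x + 2*pi) = p x"
    and M: "\<And>x. cmod (p x) \<le> M"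
    and fin: "nnint {0..2*pi} (\<lambda>s. nnint {0<..<1/4} (\<lambda>t. ennreal ((cmod (p s - p (s + 2 * t)) / t)\<^sup>2))) < \<infinity>"
  shows "douglas_energy p < \<infinity>"
proof -
  let ?k = "\<lambda>s t. douglas_kernel p s (s + t)"
  define C where "C = ennreal ((2 * M / (2 * sin (1/4)))\<^sup>2)"
  have M0: "M \<ge> 0" using M[of 0] norm_ge_zero order_trans by blast
  have s4: "sin (1/4::real) > 0" using pi_gt3 by (intro sin_gt_zero) auto
  have sinb: "sin (1/4) \<le> sin y" if "1/4 \<le> y" "y \<le> pi - 1/4" for y :: real
  proof (cases "y \<le> pi / 2")
    case True
    then show ?thesis using that pi_gt3 by (intro sin_monotone_2pi_le) auto
  next
    case False
    then have "sin (1/4) \<le> sin (pi - y)" using that pi_gt3 by (intro sin_monotone_2pi_le) auto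
    then show ?thesis by simp
  qed
  have kmid: "?k s t \<le> C" if "1/2 \<le> t" "t \<le> 2*pi - 1/2" for s t
  proof -
    have "sin (1/4) \<le> sin (t / 2)" using that by (intro sinb) auto
    moreover have "cmod (cis s - cis (s + t)) = 2 * \<bar>sin (t / 2)\<bar>" by (simp add: cmod_cis_diff)
    ultimately have d: "2 * sin (1/4) \<le> cmod (cis s - cis (s + t))" by linarith
    have "cmod (p s - p (s + t)) \<le> 2 * M" using M[of s] M[of "s + t"] norm_triangle_ineq4[of "p s" "p (s + t)"] by linarith
    then have "cmod ((p s - p (s + t)) / (cis s - cis (s + t))) \<le> 2 * M / (2 * sin (1/4))"
      unfolding norm_divide using d s4 M0 by (intro frac_le) auto
    then show ?thesis unfolding douglas_kernel_def C_def by (intro ennreal_leI power_mono) auto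
  qed
  \<comment> \<open>At t = 0 and t = 2 pi the kernel is 0 by the convention for division; every
    other t falls into the bounded middle range or one of the two strips.\<close>
  have split: "indicator {0..2*pi} t * ?k s t \<le> indicator {0..2*pi} t * C + (indicator {0<..<1/2} t * ?k s t + indicator {0<..<1/2} (2*pi - t) * ?k s t)" for s t
  proof (cases "t \<in> {0..2*pi}")
    case True
    then consider "t = 0" | "t = 2*pi" | "1/2 \<le> t" "t \<le> 2*pi - 1/2" | "0 < t" "t < 1/2" | "2*pi - 1/2 < t" "t < 2*pi"
      by (auto, linarith)
    then show ?thesis
    proof cases
      case 3
      have "?k s t \<le> C + x" for x using kmid[OF 3, of s] by (meson add_increasing2 zero_le)
      then show ?thesis using True by simp
    next
      case 4
      have "?k s t \<le> C + (?k s t + x)" for x by (rule add_increasing, simp, rule add_increasing2) auto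
      then show ?thesis using True 4 by simp
    next
      case 5
      have "?k s t \<le> C + (x + ?k s t)" for x by (rule add_increasing, simp, rule add_increasing) auto
      then show ?thesis using True 5 by simp
    qed (auto simp: douglas_kernel_def)
  qed simp
  have near: "nnint {0..2*pi} (\<lambda>s. nnint {0<..<1/2} (\<lambda>t. ?k s t)) < \<infinity>" (is "?N < \<infinity>")
  proof -
    have "?N \<le> nnint {0..2*pi} (\<lambda>s. 2 * (nnint {0<..<1/4} (\<lambda>t. ennreal ((cmod (p s - p (s + 2 * t)) / t)\<^sup>2))))"
    proof (rule nn_integral_mono, rule mult_left_mono)
      fix s :: real
      have "nnint {0<..<1/2} (\<lambda>t. ?k s t) = ennreal \<bar>2\<bar> * (\<integral>\<^sup>+t. indicator {0<..<1/2} (0 + 2 * t) * ?k s (0 + 2 * t) \<partial>lborel)"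
        by (rule nn_integral_real_affine) simp_all
      also have "\<dots> \<le> ennreal \<bar>2\<bar> * (nnint {0<..<1/4} (\<lambda>t. ennreal ((cmod (p s - p (s + 2 * t)) / t)\<^sup>2)))"
      proof (rule mult_left_mono, rule nn_integral_mono)
        fix t :: real
        show "indicator {0<..<1/2} (0 + 2 * t) * ?k s (0 + 2 * t) \<le> indicator {0<..<1/4} t * ennreal ((cmod (p s - p (s + 2 * t)) / t)\<^sup>2)"
        proof (cases "t \<in> {0<..<1/4}")
          case True
          have "t \<le> cmod (cis s - cis (s + 2 * t))" using cmod_cis_diff_ge[of s "s + 2 * t"] True by auto
          then have "cmod ((p s - p (s + 2 * t)) / (cis s - cis (s + 2 * t))) \<le> cmod (p s - p (s + 2 * t)) / t"
            unfolding norm_divide using True by (intro divide_left_mono mult_pos_pos) auto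
          then show ?thesis using True by (simp add: douglas_kernel_def)
        next
          case False
          then show ?thesis by (auto simp: indicator_def)
        qed
      qed auto
      finally show "nnint {0<..<1/2} (\<lambda>t. ?k s t) \<le> 2 * (nnint {0<..<1/4} (\<lambda>t. ennreal ((cmod (p s - p (s + 2 * t)) / t)\<^sup>2)))"
        by simp
    qed auto
    also have "\<dots> = 2 * (nnint {0..2*pi} (\<lambda>s. nnint {0<..<1/4} (\<lambda>t. ennreal ((cmod (p s - p (s + 2 * t)) / t)\<^sup>2))))"
      by (subst nn_integral_cmult[symmetric]) (auto simp: mult.left_commute)
    also have "\<dots> < \<infinity>" using fin by (simp add: ennreal_mult_less_top)
    finally show ?thesis .
  qed
  have far: "nnint {0..2*pi} (\<lambda>s. (\<integral>\<^sup>+t. indicator {0<..<1/2} (2*pi - t) * ?k s t \<partial>lborel)) = ?N"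
  proof -
    have "(\<integral>\<^sup>+t. indicator {0<..<1/2} (2*pi - t) * ?k s t \<partial>lborel) = nnint {0<..<1/2} (\<lambda>t. ?k (s - t) t)" for s
    proof -
      \<comment> \<open>A distance just below 2 pi is a small distance in the opposite direction, so
        periodicity and the symmetry of the kernel fold the far strip onto the near one.\<close>
      have "?k s (2*pi - t) = ?k (s - t) t" for t
        using per[of "s - t"] cis_shift_period[of "s - t"] douglas_kernel_commute[of p s "s - t"]
        by (simp add: douglas_kernel_def algebra_simps)
      then show ?thesis
        by (subst nn_integral_real_affine[of "\<lambda>t. indicator {0<..<1/2} (2*pi - t) * ?k s t" "-1" "2*pi"]) simp_all
    qed
    then have "nnint {0..2*pi} (\<lambda>s. (\<integral>\<^sup>+t. indicator {0<..<1/2} (2*pi - t) * ?k s t \<partial>lborel))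
      = nnint {0..2*pi} (\<lambda>s. nnint {0<..<1/2} (\<lambda>t. ?k (s - t) t))" by simp
    also have "\<dots> = nnint {0<..<1/2} (\<lambda>t. nnint {0..2*pi} (\<lambda>s. ?k (s - t) t))"
      by (rule nn_integral_lborel_swap_cmult) measurable
    also have "\<dots> = nnint {0<..<1/2} (\<lambda>t. nnint {0..2*pi} (\<lambda>s. ?k s t))"
    proof -
      have "nnint {0..2*pi} (\<lambda>s. ?k (s + (-t)) t) = nnint {0..2*pi} (\<lambda>s. ?k s t)" for t
      proof (rule nn_integral_period_shift[of "\<lambda>s. ?k s t" "-t"])
        show "?k (x + 2*pi) t = ?k x t" for x
          using per[of x] per[of "x + t"] cis_shift_period[of "x + t"] by (simp add: douglas_kernel_def add_ac)
      qed measurable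
      then show ?thesis by simp
    qed
    also have "\<dots> = ?N"
      by (rule nn_integral_lborel_swap_cmult[symmetric]) measurable
    finally show ?thesis .
  qed
  have "douglas_energy p \<le> nnint {0..2*pi} (\<lambda>s. (\<integral>\<^sup>+t. indicator {0..2*pi} t * C + (indicator {0<..<1/2} t * ?k s t + indicator {0<..<1/2} (2*pi - t) * ?k s t) \<partial>lborel))"
    unfolding douglas_energy_shift[OF assms(1) per]
    by (intro nn_integral_mono mult_left_mono split) auto
  also have "\<dots> = (\<integral>\<^sup>+s. indicator {0..2*pi} s * (\<integral>\<^sup>+t. indicator {0..2*pi} t * C \<partial>(lborel::real measure)) +
     (indicator {0..2*pi} s * (nnint {0<..<1/2} (\<lambda>t. ?k s t)) +
      indicator {0..2*pi} s * (\<integral>\<^sup>+t. indicator {0<..<1/2} (2*pi - t) * ?k s t \<partial>lborel)) \<partial>lborel)"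
    by (simp add: nn_integral_add distrib_left)
  also have "\<dots> = (\<integral>\<^sup>+s. indicator {0..2*pi} s * (\<integral>\<^sup>+t. indicator {0..2*pi} t * C \<partial>(lborel::real measure)) \<partial>(lborel::real measure)) + (?N + ?N)"
    by (subst nn_integral_add, measurable, subst nn_integral_add, measurable, simp add: far)
  also have "\<dots> < \<infinity>"
    using near by (auto simp: C_def nn_integral_multc nn_integral_cmult ennreal_mult_less_top ennreal_mult'[symmetric])
  finally show ?thesis .
qed

section \<open>Finite Dirichlet energy forces finite Douglas energy\<close>

lemma ennreal_square_add_le: "(a + b)\<^sup>2 \<le> 4 * (a\<^sup>2 + b\<^sup>2)" for a b :: ennreal
proof -
  have "(a + b)\<^sup>2 \<le> (2 * max a b)\<^sup>2"
    by (intro power_mono) (auto simp: mult_2 intro!: add_mono)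
  also have "\<dots> = 4 * (max a b)\<^sup>2" by (simp add: power_mult_distrib)
  also have "\<dots> \<le> 4 * (a\<^sup>2 + b\<^sup>2)"
    by (intro mult_left_mono) (auto simp: max_def intro: add_increasing add_increasing2)
  finally show ?thesis .
qed

lemma has_vector_derivative_spiral:
  "((\<lambda>x. of_real (R - t * x) * cis (s + c * (t * x))) has_vector_derivative
     (of_real (-t) + \<i> * of_real (c * t * (R - t * x))) * cis (s + c * (t * x))) (at x)"
proof -
  let ?F = "\<lambda>z. (of_real R - of_real t * z) * exp (\<i> * (of_real s + of_real c * (of_real t * z)))"
  have "(?F has_field_derivative (of_real (-t) + \<i> * of_real (c * t * (R - t * x))) * exp (\<i> * (of_real s + of_real c * (of_real t * of_real x)))) (at (of_real x))"
    by (auto intro!: derivative_eq_intros simp: algebra_simps)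
  from has_vector_derivative_real_field[OF this]
  show ?thesis by (simp add: cis_conv_exp)
qed

text \<open>The points at angles \<open>s\<close> and \<open>s + 2 t\<close> on the circle of radius \<open>R\<close> are joined by two inward spirals
  of opposite sense meeting at angle \<open>s + t\<close> and radius \<open>R - t\<close>.\<close>

lemma mollified_circle_bound:
  fixes h g1 g2 :: "complex \<Rightarrow> complex" and \<eta> :: "complex \<Rightarrow> real"
  defines "hb \<equiv> \<lambda>w. indicator (ball 0 1) w *\<^sub>R h w"
  defines "u \<equiv> \<lambda>z. LINT w|lborel. \<eta> (w - z) *\<^sub>R hb w"
  defines "G \<equiv> \<lambda>w. indicator (ball 0 1) w * ennreal (norm (g1 w) + norm (g2 w))"
  assumes hc: "continuous_on (cball 0 1) h"
    and weak: "weak_partials h (ball 0 1) g1 g2"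
    and eta: "\<eta> \<in> flat_algebra" "\<And>w. \<eta> w \<ge> 0" "\<And>w. \<eta> w \<noteq> 0 \<Longrightarrow> cmod w \<le> d"
      "(\<integral>\<^sup>+w. ennreal (\<eta> w) \<partial>lborel) = 1"
    and R: "1/2 \<le> R" "R + d < 1" "d \<ge> 0"
  shows "nnint {0..2*pi} (\<lambda>s. nnint {0<..<1/4} (\<lambda>t. ennreal ((cmod (u (of_real R * cis s) - u (of_real R * cis (s + 2 * t))) / t)\<^sup>2)))
    \<le> 512 * (\<integral>\<^sup>+w. (G w)\<^sup>2 \<partial>lborel)"
proof -
  have Gm[measurable]: "G \<in> borel_measurable borel"
    unfolding G_def by (rule gradient_norm_measurable[OF weak])
  have [measurable]: "\<eta> \<in> borel_measurable borel"
    using flat_algebra_continuous[OF eta(1)] by (rule borel_measurable_continuous_onI)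
  define K where "K z = (\<integral>\<^sup>+w. ennreal (\<eta> (w - z)) * G w \<partial>lborel)" for z
  have [measurable]: "K \<in> borel_measurable borel" unfolding K_def by measurable
  have K2: "(\<integral>\<^sup>+z. (K z)\<^sup>2 \<partial>lborel) \<le> (\<integral>\<^sup>+w. (G w)\<^sup>2 \<partial>lborel)"
    unfolding K_def by (rule nn_integral_mollify_square_le) (use eta in auto)
  define J where "J c s t = nnint {0<..<1} (\<lambda>x. K (of_real (R - t * x) * cis (s + c * (t * x))))" for c s t
  have [measurable]: "(\<lambda>x. J c (f x) (g x)) \<in> borel_measurable M"
    if [measurable]: "f \<in> borel_measurable M" "g \<in> borel_measurable M" for c f g and M :: "'x measure"
    unfolding J_def by measurable
  have Jint: "(nnint {0..2*pi} (\<lambda>s. nnint {0<..<1/4} (\<lambda>t. (J c s t)\<^sup>2)))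
      \<le> 16 * (\<integral>\<^sup>+w. (G w)\<^sup>2 \<partial>lborel)" for c
  proof -
    have "(nnint {0..2*pi} (\<lambda>s. nnint {0<..<1/4} (\<lambda>t. (J c s t)\<^sup>2)))
      \<le> 16 * (\<integral>\<^sup>+z. (K z)\<^sup>2 \<partial>lborel)"
      unfolding J_def by (rule nn_integral_spiral_le) (use R in auto)
    also have "\<dots> \<le> 16 * (\<integral>\<^sup>+w. (G w)\<^sup>2 \<partial>lborel)" by (intro mult_left_mono K2) auto
    finally show ?thesis .
  qed
  \<comment> \<open>The radial speed is t and the angular speed is t times a radius below 1, hence
    the bound 2 t. The sign of \<open>c\<close> selects the sense of the spiral.\<close>
  have leg: "ennreal (norm (u (of_real (R - t) * cis (s + c * t)) - u (of_real R * cis s))) \<le> ennreal (2 * t) * J c s t"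
    if t: "0 < t" "t < 1/4" and c: "\<bar>c\<bar> = 1" for s t c
  proof -
    let ?\<gamma> = "\<lambda>x. of_real (R - t * x) * cis (s + c * (t * x))"
    let ?\<gamma>' = "\<lambda>x. (of_real (-t) + \<i> * of_real (c * t * (R - t * x))) * cis (s + c * (t * x))"
    have b: "0 \<le> R - t * x" "R - t * x \<le> R" if "x \<in> {0..1}" for x
    proof -
      have "t * x \<le> t * 1" using that t by (intro mult_left_mono) auto
      moreover have "0 \<le> t * x" using that t by simp
      ultimately show "0 \<le> R - t * x" "R - t * x \<le> R" using t R by linarith+
    qed
    have "ennreal (norm (u (?\<gamma> 1) - u (?\<gamma> 0))) \<le> ennreal (2 * t) * (nnint {0<..<1} (\<lambda>x. (\<integral>\<^sup>+w. ennreal (\<eta> (w - ?\<gamma> x)) * G w \<partial>lborel)))"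
      unfolding u_def hb_def G_def
    proof (rule mollified_path_bound[OF hc weak eta(1-3)])
      show "(?\<gamma> has_vector_derivative ?\<gamma>' x) (at x)" for x by (rule has_vector_derivative_spiral)
      show "continuous_on UNIV ?\<gamma>'" by (intro continuous_intros)
      show "cmod (?\<gamma> x) + d < 1" if "x \<in> {0..1}" for x
        using b[OF that] R by (simp add: norm_mult del: of_real_diff of_real_mult)
      show "cmod (?\<gamma>' x) \<le> 2 * t" if "x \<in> {0..1}" for x
      proof -
        have "cmod (?\<gamma>' x) \<le> cmod (of_real (-t)) + cmod (\<i> * of_real (c * t * (R - t * x)))"
          unfolding norm_mult[of _ "cis _"] norm_cis mult_1_right by (rule norm_triangle_ineq)
        also have "\<dots> = t + t * (R - t * x)"
          unfolding norm_mult norm_of_real using t c b[OF that] by (simp add: abs_mult)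
        also have "\<dots> \<le> t + t * 1" using b[OF that] R t by (intro add_left_mono mult_left_mono) auto
        finally show ?thesis by simp
      qed
    qed
    then show ?thesis by (simp add: J_def K_def)
  qed
  \<comment> \<open>The length bound 2 t cancels the division by t and leaves a factor 2. Its square
    4 and the factor 4 for the square of a sum of two legs make 16.\<close>
  have pt: "ennreal ((cmod (u (of_real R * cis s) - u (of_real R * cis (s + 2 * t))) / t)\<^sup>2) \<le> 16 * ((J 1 s t)\<^sup>2 + (J (-1) (s + 2 * t) t)\<^sup>2)"
    if t: "0 < t" "t < 1/4" for s t
  proof -
    define X Y Z where "X = u (of_real (R - t) * cis (s + t))" and "Y = u (of_real R * cis s)" and "Z = u (of_real R * cis (s + 2 * t))"
    have "ennreal (norm (X - Y)) \<le> ennreal (2 * t) * J 1 s t" using leg[OF t, of 1 s] by (simp add: X_def Y_def)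
    moreover have "ennreal (norm (X - Z)) \<le> ennreal (2 * t) * J (-1) (s + 2 * t) t"
      using leg[OF t, of "-1" "s + 2 * t"] by (simp add: X_def Z_def add.commute)
    moreover have "ennreal (norm (Y - Z)) \<le> ennreal (norm (X - Y)) + ennreal (norm (X - Z))"
      using norm_triangle_ineq4[of "X - Z" "X - Y"] by (simp add: ennreal_plus[symmetric] ennreal_leI del: ennreal_plus)
    ultimately have "ennreal (norm (Y - Z)) \<le> ennreal (2 * t) * (J 1 s t + J (-1) (s + 2 * t) t)"
      unfolding distrib_left by (meson add_mono order_trans)
    then have "ennreal (1 / t) * ennreal (norm (Y - Z)) \<le> ennreal (1 / t) * (ennreal (2 * t) * (J 1 s t + J (-1) (s + 2 * t) t))"
      by (intro mult_left_mono) auto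
    also have "\<dots> = 2 * (J 1 s t + J (-1) (s + 2 * t) t)"
    proof -
      have "ennreal (1 / t) * ennreal (2 * t) = 2" using t by (simp add: ennreal_mult[symmetric])
      then show ?thesis by (simp add: mult.assoc[symmetric])
    qed
    finally have "ennreal (norm (Y - Z) / t) \<le> 2 * (J 1 s t + J (-1) (s + 2 * t) t)"
      using t by (simp add: ennreal_mult[symmetric])
    then have "(ennreal (norm (Y - Z) / t))\<^sup>2 \<le> (2 * (J 1 s t + J (-1) (s + 2 * t) t))\<^sup>2" by (rule power_mono) simp
    also have "\<dots> = 4 * (J 1 s t + J (-1) (s + 2 * t) t)\<^sup>2" by (subst power_mult_distrib) simp
    also have "\<dots> \<le> 4 * (4 * ((J 1 s t)\<^sup>2 + (J (-1) (s + 2 * t) t)\<^sup>2))" by (intro mult_left_mono ennreal_square_add_le) auto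
    finally show ?thesis using t by (simp add: Y_def Z_def ennreal_power mult.assoc[symmetric])
  qed
  have Jper: "J c (s + 2*pi) t = J c s t" for c s t
  proof -
    have "cis (s + 2*pi + y) = cis (s + y)" for y using cis_shift_period[of "s + y"] by (simp add: add_ac)
    then show ?thesis unfolding J_def by simp
  qed
  \<comment> \<open>The second spiral starts at the angle s + 2 t, which varies with t. With t held
    fixed this is a rotation in \<open>s\<close>, so the order of integration is exchanged before
    and after.\<close>
  have shift: "nnint {0..2*pi} (\<lambda>s. nnint {0<..<1/4} (\<lambda>t. (J c (s + 2 * t) t)\<^sup>2))
      = nnint {0..2*pi} (\<lambda>s. nnint {0<..<1/4} (\<lambda>t. (J c s t)\<^sup>2))" for c
  proof -
    have "nnint {0..2*pi} (\<lambda>s. nnint {0<..<1/4} (\<lambda>t. (J c (s + 2 * t) t)\<^sup>2))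
      = nnint {0<..<1/4} (\<lambda>t. nnint {0..2*pi} (\<lambda>s. (J c (s + 2 * t) t)\<^sup>2))"
      by (rule nn_integral_lborel_swap_cmult) measurable
    also have "\<dots> = nnint {0<..<1/4} (\<lambda>t. nnint {0..2*pi} (\<lambda>s. (J c s t)\<^sup>2))"
    proof -
      have "nnint {0..2*pi} (\<lambda>s. (J c (s + 2 * t) t)\<^sup>2) = nnint {0..2*pi} (\<lambda>s. (J c s t)\<^sup>2)" for t
        by (rule nn_integral_period_shift[of "\<lambda>s. (J c s t)\<^sup>2" "2 * t"]) (simp_all add: Jper)
      then show ?thesis by (simp only:)
    qed
    also have "\<dots> = nnint {0..2*pi} (\<lambda>s. nnint {0<..<1/4} (\<lambda>t. (J c s t)\<^sup>2))"
      by (rule nn_integral_lborel_swap_cmult[symmetric]) measurable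
    finally show ?thesis .
  qed
  have "nnint {0..2*pi} (\<lambda>s. nnint {0<..<1/4} (\<lambda>t. ennreal ((cmod (u (of_real R * cis s) - u (of_real R * cis (s + 2 * t))) / t)\<^sup>2)))
    \<le> nnint {0..2*pi} (\<lambda>s. nnint {0<..<1/4} (\<lambda>t. 16 * ((J 1 s t)\<^sup>2 + (J (-1) (s + 2 * t) t)\<^sup>2)))"
  proof (rule nn_integral_mono, rule mult_left_mono, rule nn_integral_mono)
    fix s t :: real
    show "indicator {0<..<1/4} t * ennreal ((cmod (u (of_real R * cis s) - u (of_real R * cis (s + 2 * t))) / t)\<^sup>2)
      \<le> indicator {0<..<1/4} t * (16 * ((J 1 s t)\<^sup>2 + (J (-1) (s + 2 * t) t)\<^sup>2))"
      using pt[of t s] by (cases "t \<in> {0<..<1/4}") auto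
  qed auto
  also have "\<dots> = nnint {0..2*pi} (\<lambda>s. 16 * ((nnint {0<..<1/4} (\<lambda>t. (J 1 s t)\<^sup>2))
      + (nnint {0<..<1/4} (\<lambda>t. (J (-1) (s + 2 * t) t)\<^sup>2))))"
  proof -
    have "nnint {0<..<1/4} (\<lambda>t. 16 * ((J 1 s t)\<^sup>2 + (J (-1) (s + 2 * t) t)\<^sup>2))
      = (\<integral>\<^sup>+t. 16 * (indicator {0<..<1/4} t * (J 1 s t)\<^sup>2 + indicator {0<..<1/4} t * (J (-1) (s + 2 * t) t)\<^sup>2) \<partial>lborel)" for s
      by (simp only: mult.left_commute[of "indicator _ _"] distrib_left)
    moreover have "(\<integral>\<^sup>+t. 16 * (indicator {0<..<1/4} t * (J 1 s t)\<^sup>2 + indicator {0<..<1/4} t * (J (-1) (s + 2 * t) t)\<^sup>2) \<partial>lborel) = 16 * (\<integral>\<^sup>+t. indicator {0<..<1/4} t * (J 1 s t)\<^sup>2 + indicator {0<..<1/4} t * (J (-1) (s + 2 * t) t)\<^sup>2 \<partial>lborel)" for s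
      by (rule nn_integral_cmult) measurable
    moreover have "16 * (\<integral>\<^sup>+t. indicator {0<..<1/4} t * (J 1 s t)\<^sup>2 + indicator {0<..<1/4} t * (J (-1) (s + 2 * t) t)\<^sup>2 \<partial>lborel) = 16 * ((nnint {0<..<1/4} (\<lambda>t. (J 1 s t)\<^sup>2))
      + (nnint {0<..<1/4} (\<lambda>t. (J (-1) (s + 2 * t) t)\<^sup>2)))" for s
      by (rule arg_cong[where f="\<lambda>y. 16 * y"], rule nn_integral_add) measurable
    ultimately show ?thesis by (simp only:)
  qed
  also have "\<dots> = (\<integral>\<^sup>+s. 16 * (indicator {0..2*pi} s * (nnint {0<..<1/4} (\<lambda>t. (J 1 s t)\<^sup>2))
      + indicator {0..2*pi} s * (nnint {0<..<1/4} (\<lambda>t. (J (-1) (s + 2 * t) t)\<^sup>2))) \<partial>lborel)"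
    by (simp only: mult.left_commute[of "indicator _ _"] distrib_left)
  also have "\<dots> = 16 * (\<integral>\<^sup>+s. (indicator {0..2*pi} s * (nnint {0<..<1/4} (\<lambda>t. (J 1 s t)\<^sup>2))
      + indicator {0..2*pi} s * (nnint {0<..<1/4} (\<lambda>t. (J (-1) (s + 2 * t) t)\<^sup>2))) \<partial>lborel)"
    by (rule nn_integral_cmult) measurable
  also have "\<dots> = 16 * ((nnint {0..2*pi} (\<lambda>s. nnint {0<..<1/4} (\<lambda>t. (J 1 s t)\<^sup>2)))
      + (nnint {0..2*pi} (\<lambda>s. nnint {0<..<1/4} (\<lambda>t. (J (-1) (s + 2 * t) t)\<^sup>2))))"
    by (rule arg_cong[where f="\<lambda>y. 16 * y"], rule nn_integral_add) measurable
  also have "\<dots> \<le> 16 * (16 * (\<integral>\<^sup>+w. (G w)\<^sup>2 \<partial>lborel) + 16 * (\<integral>\<^sup>+w. (G w)\<^sup>2 \<partial>lborel))"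
    unfolding shift by (intro mult_left_mono add_mono Jint) auto
  \<comment> \<open>512 = 16 * (16 + 16): the outer 16 comes from \<open>pt\<close>, the inner ones
    from the two spirals.\<close>
  also have "\<dots> = 512 * (\<integral>\<^sup>+w. (G w)\<^sup>2 \<partial>lborel)"
    by (simp add: distrib_left[symmetric] mult_2[symmetric] mult.assoc[symmetric])
  finally show ?thesis .
qed

text \<open>The centres may approach the boundary: since the support of the kernel stays inside the
  disk, the extension by 0 is never averaged in, and uniform closeness of \<open>h\<close> to its
  value at the limit point suffices.\<close>

lemma mollified_tendsto:
  fixes h :: "complex \<Rightarrow> complex" and \<eta> :: "nat \<Rightarrow> complex \<Rightarrow> real"
  defines "hb \<equiv> \<lambda>w. indicator (ball 0 1) w *\<^sub>R h w"
  assumes hc: "continuous_on (cball 0 1) h"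
    and eta: "\<And>n. continuous_on UNIV (\<eta> n)" "\<And>n w. \<eta> n w \<ge> 0" "\<And>n w. \<eta> n w \<noteq> 0 \<Longrightarrow> cmod w \<le> d n"
      "\<And>n. (\<integral>\<^sup>+w. ennreal (\<eta> n w) \<partial>lborel) = 1"
    and d: "\<And>n. cmod (z n) + d n < 1" "d \<longlonglongrightarrow> 0" and z: "z \<longlonglongrightarrow> \<xi>" "\<xi> \<in> cball 0 1"
  shows "(\<lambda>n. LINT w|lborel. \<eta> n (w - z n) *\<^sub>R hb w) \<longlonglongrightarrow> h \<xi>"
proof (rule tendstoI)
  fix e :: real assume e: "e > 0"
  have hbm[measurable]: "hb \<in> borel_measurable borel"
    unfolding hb_def
    by (rule borel_measurable_continuous_on_indicator) (auto intro: continuous_on_subset[OF hc])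
  obtain r where r: "r > 0" "\<And>w. w \<in> cball 0 1 \<Longrightarrow> dist w \<xi> < r \<Longrightarrow> dist (h w) (h \<xi>) < e / 2"
    using hc z(2) e unfolding continuous_on_iff by (metis half_gt_zero)
  have "\<forall>\<^sub>F n in sequentially. dist (z n) \<xi> < r / 2" using z(1) r(1) by (intro tendstoD) auto
  moreover have "\<forall>\<^sub>F n in sequentially. dist (d n) 0 < r / 2" using d(2) r(1) by (intro tendstoD) auto
  ultimately show "\<forall>\<^sub>F n in sequentially. dist (LINT w|lborel. \<eta> n (w - z n) *\<^sub>R hb w) (h \<xi>) < e"
  proof eventually_elim
    case (elim n)
    have [measurable]: "\<eta> n \<in> borel_measurable borel" using eta(1) by (rule borel_measurable_continuous_onI)
    have one: "(\<integral>\<^sup>+w. ennreal (\<eta> n (w - z n)) \<partial>lborel) = 1"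
      using nn_integral_complex_translate[of "\<lambda>w. ennreal (\<eta> n w)" "z n"] eta(4) by simp
    have i1: "integrable lborel (\<lambda>w. \<eta> n (w - z n))"
      by (rule integrableI_nonneg) (use one eta(2) in auto)
    have v1: "(LINT w|lborel. \<eta> n (w - z n)) = 1"
      using one eta(2) by (subst integral_eq_nn_integral) auto
    have bd: "norm (\<eta> n (w - z n) *\<^sub>R (hb w - h \<xi>)) \<le> \<eta> n (w - z n) * (e / 2)" for w
    proof (cases "\<eta> n (w - z n) = 0")
      case False
      then have w: "cmod (w - z n) \<le> d n" by (rule eta(3))
      then have "w \<in> ball 0 1" using d(1)[of n] norm_triangle_ineq[of "w - z n" "z n"] by simp
      moreover have "dist w \<xi> < r"
      proof -
        have "dist w \<xi> \<le> dist w (z n) + dist (z n) \<xi>" by (rule dist_triangle)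
        also have "dist w (z n) \<le> d n" using w by (simp add: dist_norm)
        also have "d n < r / 2" using elim(2) by (simp add: dist_real_def)
        finally show ?thesis using elim(1) by simp
      qed
      ultimately have "dist (h w) (h \<xi>) < e / 2" by (intro r(2)) auto
      then have "norm (hb w - h \<xi>) \<le> e / 2" using \<open>w \<in> ball 0 1\<close> by (simp add: hb_def dist_norm)
      from mult_left_mono[OF this eta(2)[of n "w - z n"]]
      show ?thesis using eta(2)[of n "w - z n"] by simp
    qed simp
    have i2: "integrable lborel (\<lambda>w. \<eta> n (w - z n) *\<^sub>R (hb w - h \<xi>))"
      by (rule Bochner_Integration.integrable_bound[of _ "\<lambda>w. \<eta> n (w - z n) * (e / 2)"])
         (use i1 bd eta(2) e in \<open>auto simp: abs_mult\<close>)
    have i3: "integrable lborel (\<lambda>w. \<eta> n (w - z n) *\<^sub>R h \<xi>)" using i1 by simp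
    have "(LINT w|lborel. \<eta> n (w - z n) *\<^sub>R hb w) = (LINT w|lborel. \<eta> n (w - z n) *\<^sub>R (hb w - h \<xi>) + \<eta> n (w - z n) *\<^sub>R h \<xi>)"
      by (simp add: scaleR_diff_right)
    also have "\<dots> = (LINT w|lborel. \<eta> n (w - z n) *\<^sub>R (hb w - h \<xi>)) + h \<xi>"
      using i1 by (subst Bochner_Integration.integral_add[OF i2 i3]) (simp add: v1)
    finally have "dist (LINT w|lborel. \<eta> n (w - z n) *\<^sub>R hb w) (h \<xi>) = norm (LINT w|lborel. \<eta> n (w - z n) *\<^sub>R (hb w - h \<xi>))"
      by (simp add: dist_norm)
    also have "\<dots> \<le> (LINT w|lborel. norm (\<eta> n (w - z n) *\<^sub>R (hb w - h \<xi>)))" by (rule integral_norm_bound)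
    also have "\<dots> \<le> (LINT w|lborel. \<eta> n (w - z n) * (e / 2))"
      by (intro integral_mono integrable_norm i2 bd) (use i1 in simp)
    also have "\<dots> = e / 2" using v1 by simp
    finally show ?case using e by simp
  qed
qed

theorem finite_sobolev_energy_imp_douglas_energy:
  assumes hc: "continuous_on (cball 0 1) h" and en: "finite_sobolev_energy h"
  shows "douglas_energy (\<lambda>s. h (cis s)) < \<infinity>"
proof -
  obtain g1 g2 where weak: "weak_partials h (ball 0 1) g1 g2"
    and fin: "(\<integral>\<^sup>+ z. indicator (ball 0 1) z * ennreal ((onorm (\<lambda>v. Re v *\<^sub>R g1 z + Im v *\<^sub>R g2 z))\<^sup>2) \<partial>lborel) < \<infinity>"
    using en unfolding finite_sobolev_energy_def by blast
  define G where "G w = indicator (ball 0 1) w * ennreal (norm (g1 w) + norm (g2 w))" for w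
  define E where "E = (\<integral>\<^sup>+w. (G w)\<^sup>2 \<partial>lborel)"
  have Gm[measurable]: "G \<in> borel_measurable borel"
    unfolding G_def[abs_def] by (rule gradient_norm_measurable[OF weak])
  \<comment> \<open>Each partial derivative is the differential at a unit vector, hence at most the
    operator norm; the sum of the two is at most twice that norm, and squaring gives the factor
    1/4.\<close>
  have Gle: "ennreal (1/4) * (G w)\<^sup>2 \<le> indicator (ball 0 1) w * ennreal ((onorm (\<lambda>v. Re v *\<^sub>R g1 w + Im v *\<^sub>R g2 w))\<^sup>2)" for w
  proof (cases "w \<in> ball 0 1")
    case True
    let ?A = "\<lambda>v. Re v *\<^sub>R g1 w + Im v *\<^sub>R g2 w"
    have bl: "bounded_linear ?A"
      by (intro bounded_linear_add bounded_linear_compose[OF bounded_linear_scaleR_left] bounded_linear_Re bounded_linear_Im)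
    have "norm (g1 w) \<le> onorm ?A" "norm (g2 w) \<le> onorm ?A"
      using onorm[OF bl, of 1] onorm[OF bl, of \<i>] by simp_all
    then have "(norm (g1 w) + norm (g2 w))\<^sup>2 \<le> (2 * onorm ?A)\<^sup>2" by (intro power_mono) auto
    then have "ennreal (1/4 * (norm (g1 w) + norm (g2 w))\<^sup>2) \<le> ennreal ((onorm ?A)\<^sup>2)"
      by (intro ennreal_leI) (simp add: power_mult_distrib)
    moreover have "ennreal (1/4 * (norm (g1 w) + norm (g2 w))\<^sup>2) = ennreal (1/4) * (G w)\<^sup>2"
      using True by (subst ennreal_mult) (simp_all add: G_def ennreal_power del: ennreal_plus)
    ultimately have "ennreal (1/4) * (G w)\<^sup>2 \<le> ennreal ((onorm ?A)\<^sup>2)" by (simp only:)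
    then show ?thesis using True by simp
  qed (simp add: G_def)
  have "ennreal (1/4) * E = (\<integral>\<^sup>+w. ennreal (1/4) * (G w)\<^sup>2 \<partial>lborel)"
    unfolding E_def by (rule nn_integral_cmult[symmetric]) measurable
  also have "\<dots> \<le> (\<integral>\<^sup>+ z. indicator (ball 0 1) z * ennreal ((onorm (\<lambda>v. Re v *\<^sub>R g1 z + Im v *\<^sub>R g2 z))\<^sup>2) \<partial>lborel)"
    by (intro nn_integral_mono Gle)
  also note fin
  finally have Efin: "E < \<infinity>" by (auto simp: ennreal_mult_less_top)
  \<comment> \<open>With e n <= 1/8 the radius 1 - 3 e n is at least 5/8, as the bound R >= 1/2
    demands, and adding the kernel radius 2 e n leaves 1 - e n < 1.\<close>
  define e where "e n = 1 / (real n + 8)" for n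
  have e0: "e n > 0" "e n \<le> 1/8" for n by (auto simp: e_def field_simps)
  have "\<forall>n. \<exists>\<eta>. \<eta> \<in> flat_algebra \<and> (\<forall>w. \<eta> w \<ge> 0) \<and> (\<forall>w. \<eta> w \<noteq> 0 \<longrightarrow> cmod w \<le> 2 * e n) \<and>
      (\<integral>\<^sup>+w. ennreal (\<eta> w) \<partial>lborel) = 1"
    using mollifier_exists[OF e0(1)] by metis
  then obtain \<eta> where eta: "\<And>n. \<eta> n \<in> flat_algebra" "\<And>n w. \<eta> n w \<ge> 0" "\<And>n w. \<eta> n w \<noteq> 0 \<Longrightarrow> cmod w \<le> 2 * e n"
      "\<And>n. (\<integral>\<^sup>+w. ennreal (\<eta> n w) \<partial>lborel) = 1" by metis
  have [measurable]: "\<eta> n \<in> borel_measurable borel" for n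
    using flat_algebra_continuous[OF eta(1)] by (rule borel_measurable_continuous_onI)
  define hb where "hb w = indicator (ball 0 1) w *\<^sub>R h w" for w
  have [measurable]: "hb \<in> borel_measurable borel"
    unfolding hb_def
    by (rule borel_measurable_continuous_on_indicator) (auto intro: continuous_on_subset[OF hc])
  define u where "u n z = (LINT w|lborel. \<eta> n (w - z) *\<^sub>R hb w)" for n z
  have [measurable]: "u n \<in> borel_measurable borel" for n unfolding u_def by measurable
  define R where "R n = 1 - 3 * e n" for n
  define p where "p s = h (cis s)" for s
  have elim: "e \<longlonglongrightarrow> 0" unfolding e_def by real_asymp
  have conv: "(\<lambda>n. u n (of_real (R n) * cis s)) \<longlonglongrightarrow> p s" for s
    unfolding u_def hb_def p_def
  proof (rule mollified_tendsto[OF hc _ eta(2-4)])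
    show "continuous_on UNIV (\<eta> n)" for n by (rule flat_algebra_continuous[OF eta(1)])
    show "cmod (of_real (R n) * cis s) + 2 * e n < 1" for n
      using e0[of n] by (simp add: norm_mult R_def del: of_real_diff of_real_mult)
    show "(\<lambda>n. 2 * e n) \<longlonglongrightarrow> 0" using tendsto_mult[OF tendsto_const[of 2] elim] by simp
    have "R \<longlonglongrightarrow> 1 - 3 * 0" unfolding R_def by (intro tendsto_intros elim)
    then have "(\<lambda>n. of_real (R n) * cis s) \<longlonglongrightarrow> of_real 1 * cis s" by (intro tendsto_intros) simp
    then show "(\<lambda>n. of_real (R n) * cis s) \<longlonglongrightarrow> cis s" by simp
    show "cis s \<in> cball 0 1" by (simp add: norm_cis)
  qed
  define q where "q n s t = ennreal ((cmod (u n (of_real (R n) * cis s) - u n (of_real (R n) * cis (s + 2 * t))) / t)\<^sup>2)" for n s t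
  have qb: "nnint {0..2*pi} (\<lambda>s. nnint {0<..<1/4} (\<lambda>t. q n s t)) \<le> 512 * E" for n
    unfolding q_def E_def u_def hb_def G_def
    by (rule mollified_circle_bound[OF hc weak eta]) (use e0[of n] in \<open>auto simp: R_def\<close>)
  have qlim: "(\<lambda>n. q n s t) \<longlonglongrightarrow> ennreal ((cmod (p s - p (s + 2 * t)) / t)\<^sup>2)" if "t \<noteq> 0" for s t
    unfolding q_def using that by (intro tendsto_intros conv)
  have [measurable]: "(\<lambda>(s, t). q n s t) \<in> borel_measurable (borel \<Otimes>\<^sub>M borel)" for n unfolding q_def by measurable
  have pc: "continuous_on UNIV p" unfolding p_def
    by (intro continuous_on_compose2[OF hc] continuous_intros) auto
  have pm[measurable]: "p \<in> borel_measurable borel" using pc by (rule borel_measurable_continuous_onI)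
  \<comment> \<open>Fatou's lemma is used once for the inner and once for the outer integral; the
    bound 512 E does not depend on n.\<close>
  have "nnint {0..2*pi} (\<lambda>s. nnint {0<..<1/4} (\<lambda>t. ennreal ((cmod (p s - p (s + 2 * t)) / t)\<^sup>2)))
     \<le> (\<integral>\<^sup>+s. liminf (\<lambda>n. indicator {0..2*pi} s * (nnint {0<..<1/4} (\<lambda>t. q n s t))) \<partial>lborel)"
  proof (rule nn_integral_mono)
    fix s :: real
    have "nnint {0<..<1/4} (\<lambda>t. ennreal ((cmod (p s - p (s + 2 * t)) / t)\<^sup>2))
       = (\<integral>\<^sup>+t. liminf (\<lambda>n. indicator {0<..<1/4} t * q n s t) \<partial>lborel)"
    proof (rule nn_integral_cong)
      fix t :: real
      show "indicator {0<..<1/4} t * ennreal ((cmod (p s - p (s + 2 * t)) / t)\<^sup>2) = liminf (\<lambda>n. indicator {0<..<1/4} t * q n s t)"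
        using lim_imp_Liminf[OF _ qlim[of t s]] by (cases "t \<in> {0<..<1/4}") (simp_all add: Liminf_const)
    qed
    also have "\<dots> \<le> liminf (\<lambda>n. \<integral>\<^sup>+t. indicator {0<..<1/4} t * q n s t \<partial>lborel)"
      by (rule nn_integral_liminf) measurable
    finally show "indicator {0..2*pi} s * (nnint {0<..<1/4} (\<lambda>t. ennreal ((cmod (p s - p (s + 2 * t)) / t)\<^sup>2)))
      \<le> liminf (\<lambda>n. indicator {0..2*pi} s * (nnint {0<..<1/4} (\<lambda>t. q n s t)))"
      by (cases "s \<in> {0..2*pi}") simp_all
  qed
  also have "\<dots> \<le> liminf (\<lambda>n. \<integral>\<^sup>+s. indicator {0..2*pi} s * (nnint {0<..<1/4} (\<lambda>t. q n s t)) \<partial>lborel)"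
    by (rule nn_integral_liminf) measurable
  also have "\<dots> \<le> liminf (\<lambda>n::nat. 512 * E)" by (intro Liminf_mono always_eventually allI qb)
  also have "\<dots> = 512 * E" by (simp add: Liminf_const)
  also have "\<dots> < \<infinity>" using Efin by (simp add: ennreal_mult_less_top)
  finally have F: "nnint {0..2*pi} (\<lambda>s. nnint {0<..<1/4} (\<lambda>t. ennreal ((cmod (p s - p (s + 2 * t)) / t)\<^sup>2))) < \<infinity>" .
  obtain M where M: "\<And>w. w \<in> cball 0 1 \<Longrightarrow> norm (h w) \<le> M"
    by (rule continuous_on_compact_bound[OF compact_cball hc], rule that)
  have "douglas_energy p < \<infinity>"
    by (rule douglas_energy_finite[OF pm _ _ F, of M]) (auto simp: p_def M)
  then show ?thesis unfolding p_def .
qed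

section \<open>Shears defined by means of circle lifts\<close>

text \<open>These are the lifts to the line of the orientation-preserving homeomorphisms of the
  circle.\<close>

definition lift_map :: "(real \<Rightarrow> real) \<Rightarrow> bool" where
  "lift_map \<Phi> \<longleftrightarrow> continuous_on UNIV \<Phi> \<and> strict_mono \<Phi> \<and> (\<forall>x. \<Phi> (x + 2*pi) = \<Phi> x + 2*pi)"

text \<open>The mean of the lift over \<open>[x - (1 - r), x + (1 - r)]\<close>; its derivative in \<open>r\<close> is dominated by its
  derivative in \<open>x\<close>, because the mean lies between the values at the two end points.\<close>

definition primitive :: "(real \<Rightarrow> real) \<Rightarrow> real \<Rightarrow> real" where
  "primitive \<Phi> = (SOME F. \<forall>x. (F has_real_derivative \<Phi> x) (at x))"

definition mean_lift :: "(real \<Rightarrow> real) \<Rightarrow> real \<Rightarrow> real \<Rightarrow> real" where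
  "mean_lift \<Phi> x r = (if r < 1 then (primitive \<Phi> (x + (1 - r)) - primitive \<Phi> (x - (1 - r))) / (2 * (1 - r)) else \<Phi> x)"

definition mean_slope :: "(real \<Rightarrow> real) \<Rightarrow> real \<Rightarrow> real \<Rightarrow> real" where
  "mean_slope \<Phi> x r = (\<Phi> (x + (1 - r)) - \<Phi> (x - (1 - r))) / (2 * (1 - r))"

context
  fixes \<Phi> :: "real \<Rightarrow> real"
  assumes lift: "lift_map \<Phi>"
begin

lemma lift_cont: "continuous_on UNIV \<Phi>" and lift_less_iff: "\<Phi> x < \<Phi> y \<longleftrightarrow> x < y"
  and lift_le_iff: "\<Phi> x \<le> \<Phi> y \<longleftrightarrow> x \<le> y"
  and lift_per: "\<Phi> (x + 2*pi) = \<Phi> x + 2*pi"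
  using lift by (auto simp: lift_map_def strict_mono_less strict_mono_less_eq)

lemma lift_isCont: "isCont \<Phi> x"
  using lift_cont by (simp add: continuous_on_eq_continuous_at)

lemma DERIV_primitive: "(primitive \<Phi> has_real_derivative \<Phi> x) (at x)"
proof -
  have "\<exists>F. \<forall>x::real. - \<infinity> < ereal x \<longrightarrow> ereal x < \<infinity> \<longrightarrow> (F has_vector_derivative \<Phi> x) (at x)"
    by (rule einterval_antiderivative) (auto simp: lift_isCont)
  then have "\<exists>F. \<forall>x. (F has_real_derivative \<Phi> x) (at x)"
    by (simp add: has_real_derivative_iff_has_vector_derivative)
  then have "\<forall>x. (primitive \<Phi> has_real_derivative \<Phi> x) (at x)"
    unfolding primitive_def by (rule someI_ex)
  then show ?thesis ..
qed

text \<open>By the mean value theorem for the primitive, the mean is a value of \<Phi> at an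
  interior point of the interval.\<close>

lemma mean_lift_bounds:
  assumes "r \<le> 1"
  shows "\<Phi> (x - (1 - r)) \<le> mean_lift \<Phi> x r" "mean_lift \<Phi> x r \<le> \<Phi> (x + (1 - r))"
proof -
  have "\<Phi> (x - (1 - r)) \<le> mean_lift \<Phi> x r \<and> mean_lift \<Phi> x r \<le> \<Phi> (x + (1 - r))"
  proof (cases "r < 1")
    case True
    obtain z where z: "x - (1 - r) < z" "z < x + (1 - r)"
      "primitive \<Phi> (x + (1 - r)) - primitive \<Phi> (x - (1 - r)) = (x + (1 - r) - (x - (1 - r))) * \<Phi> z"
      using MVT2[of "x - (1 - r)" "x + (1 - r)" "primitive \<Phi>" \<Phi>] DERIV_primitive True by auto
    then have "mean_lift \<Phi> x r = \<Phi> z" using True by (simp add: mean_lift_def field_simps)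
    then show ?thesis using z by (auto simp: lift_le_iff)
  qed (use assms in \<open>auto simp: mean_lift_def\<close>)
  then show "\<Phi> (x - (1 - r)) \<le> mean_lift \<Phi> x r" "mean_lift \<Phi> x r \<le> \<Phi> (x + (1 - r))" by auto
qed

lemma mean_lift_period: "mean_lift \<Phi> (x + 2*pi) r = mean_lift \<Phi> x r + 2*pi"
proof (cases "r < 1")
  case True
  \<comment> \<open>The increment of the primitive over one period has derivative \<Phi> (x + 2 pi)
    - \<Phi> x + 2 pi x' - 2 pi x' up to the linear term removed here, that is, derivative \<Phi> x
    + 2 pi - \<Phi> x - 2 pi = 0 for \<open>G\<close>.\<close>
  define G where "G x = primitive \<Phi> (x + 2*pi) - primitive \<Phi> x - 2*pi*x" for x
  have D: "((\<lambda>x. primitive \<Phi> (x + 2*pi)) has_real_derivative \<Phi> (x + 2*pi) * 1) (at x)" for x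
    by (rule DERIV_chain'[OF _ DERIV_primitive]) (auto intro!: derivative_eq_intros)
  have "(G has_real_derivative 0) (at x)" for x
    unfolding G_def using lift_per[of x]
    by (auto intro!: derivative_eq_intros D DERIV_primitive)
  then have "G (x + (1 - r)) = G (x - (1 - r))"
    by (rule DERIV_isconst_all[rule_format])
  then have "primitive \<Phi> (x + 2*pi + (1 - r)) - primitive \<Phi> (x + 2*pi - (1 - r)) =
     primitive \<Phi> (x + (1 - r)) - primitive \<Phi> (x - (1 - r)) + 2*pi * (2 * (1 - r))"
    by (simp add: G_def algebra_simps)
  then show ?thesis using True by (simp add: mean_lift_def add_divide_distrib)
qed (simp add: mean_lift_def lift_per)

lemma mean_slope_nonneg: "r < 1 \<Longrightarrow> 0 \<le> mean_slope \<Phi> x r"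
  unfolding mean_slope_def by (intro divide_nonneg_pos) (auto simp: lift_le_iff)

lemma mean_slope_period: "mean_slope \<Phi> (x + 2*pi) r = mean_slope \<Phi> x r"
  using lift_per[of "x + (1 - r)"] lift_per[of "x - (1 - r)"] by (simp add: mean_slope_def algebra_simps)

text \<open>The coefficient \<open>b\<close> is the derivative in \<open>r\<close>. If m is the mean
  and p <= m <= q are the values at the end points, then b = (2 m - p - q) / (2 d) with d = 1 - r,
  and |2 m - p - q| <= q - p.\<close>

lemma mean_lift_has_derivative:
  assumes r: "r < 1"
  obtains b where "((\<lambda>p. mean_lift \<Phi> (fst p) (snd p)) has_derivative (\<lambda>v. fst v * mean_slope \<Phi> x r + snd v * b)) (at (x, r))"
    "\<bar>b\<bar> \<le> mean_slope \<Phi> x r"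
proof -
  define d where "d = 1 - r"
  have d: "d > 0" using r by (simp add: d_def)
  let ?F = "primitive \<Phi>"
  let ?N = "?F (x + d) - ?F (x - d)"
  have DF: "(?F has_derivative (\<lambda>v. \<Phi> y * v)) (at y)" for y
    using DERIV_primitive[of y] by (simp add: has_field_derivative_def)
  have i: "((\<lambda>p. fst p + (1 - snd p)) has_derivative (\<lambda>v. fst v - snd v)) (at (x, r))"
    "((\<lambda>p. fst p - (1 - snd p)) has_derivative (\<lambda>v. fst v + snd v)) (at (x, r))"
    by (auto intro!: derivative_eq_intros)
  have "(?F has_derivative (\<lambda>v. \<Phi> (x + d) * v)) (at (fst (x, r) + (1 - snd (x, r))))"
    "(?F has_derivative (\<lambda>v. \<Phi> (x - d) * v)) (at (fst (x, r) - (1 - snd (x, r))))"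
    using DF[of "x + d"] DF[of "x - d"] by (simp_all add: d_def)
  note p1 = has_derivative_compose[OF i(1) this(1)] and p2 = has_derivative_compose[OF i(2) this(2)]
  define b where "b = - (\<Phi> (x + d) + \<Phi> (x - d)) / (2 * d) + ?N / (2 * d * d)"
  have "((\<lambda>p. 2 * (1 - snd p)) has_derivative (\<lambda>v. - 2 * snd v)) (at (x, r))"
    by (auto intro!: derivative_eq_intros)
  from Deriv.has_derivative_inverse[OF _ this]
  have q: "((\<lambda>p. inverse (2 * (1 - snd p))) has_derivative (\<lambda>v. inverse (2 * d) * (2 * snd v) * inverse (2 * d))) (at (x, r))"
    using d by (simp add: d_def)
  have "((\<lambda>p. (?F (fst p + (1 - snd p)) - ?F (fst p - (1 - snd p))) * inverse (2 * (1 - snd p))) has_derivative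
      (\<lambda>v. ?N * (inverse (2 * d) * (2 * snd v) * inverse (2 * d)) + (\<Phi> (x + d) * (fst v - snd v) - \<Phi> (x - d) * (fst v + snd v)) * inverse (2 * d))) (at (x, r))"
    using has_derivative_mult[OF has_derivative_diff[OF p1 p2] q] by (simp add: d_def)
  also have "(\<lambda>v. ?N * (inverse (2 * d) * (2 * snd v) * inverse (2 * d)) + (\<Phi> (x + d) * (fst v - snd v) - \<Phi> (x - d) * (fst v + snd v)) * inverse (2 * d))
     = (\<lambda>v. fst v * mean_slope \<Phi> x r + snd v * b)"
  proof
    fix v :: "real \<times> real"
    show "?N * (inverse (2 * d) * (2 * snd v) * inverse (2 * d)) + (\<Phi> (x + d) * (fst v - snd v) - \<Phi> (x - d) * (fst v + snd v)) * inverse (2 * d)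
      = fst v * mean_slope \<Phi> x r + snd v * b"
      using d unfolding mean_slope_def d_def[symmetric] b_def by (simp add: field_simps)
  qed
  finally have "((\<lambda>p. mean_lift \<Phi> (fst p) (snd p)) has_derivative (\<lambda>v. fst v * mean_slope \<Phi> x r + snd v * b)) (at (x, r))"
  proof (rule has_derivative_transform_within_open[where s="{p. snd p < 1}"])
    show "open {p :: real \<times> real. snd p < 1}" by (intro open_Collect_less continuous_intros)
  qed (use r in \<open>auto simp: mean_lift_def divide_inverse\<close>)
  moreover have "\<bar>b\<bar> \<le> mean_slope \<Phi> x r"
  proof -
    define m where "m = mean_lift \<Phi> x r"
    have m: "\<Phi> (x - d) \<le> m" "m \<le> \<Phi> (x + d)" using mean_lift_bounds[of r x] r by (auto simp: m_def d_def)
    have N: "?N = m * (2 * d)" using r d by (simp add: m_def mean_lift_def d_def)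
    have "b = (2 * m - (\<Phi> (x + d) + \<Phi> (x - d))) / (2 * d)" unfolding b_def N using d by (simp add: field_simps)
    moreover have "\<bar>2 * m - (\<Phi> (x + d) + \<Phi> (x - d))\<bar> \<le> \<Phi> (x + d) - \<Phi> (x - d)" using m by linarith
    ultimately show ?thesis using d by (simp add: mean_slope_def d_def[symmetric] abs_divide divide_right_mono)
  qed
  ultimately show ?thesis by (rule that)
qed

lemma mean_lift_mono:
  assumes "r \<le> 1" "x \<le> y"
  shows "mean_lift \<Phi> x r \<le> mean_lift \<Phi> y r"
proof (cases "r < 1")
  case True
  show ?thesis
  proof (rule DERIV_nonneg_imp_nondecreasing[OF assms(2), of "\<lambda>x. mean_lift \<Phi> x r"])
    fix x
    obtain b where "((\<lambda>p. mean_lift \<Phi> (fst p) (snd p)) has_derivative (\<lambda>v. fst v * mean_slope \<Phi> x r + snd v * b)) (at (x, r))"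
      using mean_lift_has_derivative[OF True] by blast
    moreover have "((\<lambda>x. (x, r)) has_derivative (\<lambda>v. (v, 0))) (at x)"
      by (intro has_derivative_Pair has_derivative_ident has_derivative_const)
    ultimately have "((\<lambda>x. mean_lift \<Phi> (fst (x, r)) (snd (x, r))) has_derivative
        (\<lambda>v. fst (v, 0::real) * mean_slope \<Phi> x r + snd (v, 0) * b)) (at x)"
      by (rule has_derivative_compose[rotated])
    then have "((\<lambda>x. mean_lift \<Phi> x r) has_derivative (\<lambda>v. v * mean_slope \<Phi> x r)) (at x)"
      by simp
    then have "((\<lambda>x. mean_lift \<Phi> x r) has_real_derivative mean_slope \<Phi> x r) (at x)"
      by (simp add: has_field_derivative_def mult_commute_abs)
    then show "\<exists>y. ((\<lambda>x. mean_lift \<Phi> x r) has_real_derivative y) (at x) \<and> 0 \<le> y"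
      using mean_slope_nonneg[OF True] by blast
  qed
qed (use assms in \<open>auto simp: mean_lift_def lift_le_iff\<close>)

text \<open>For r < 1 differentiability is at hand. At r = 1 the mean is squeezed between the values
  of \<Phi> at the end points of an interval shrinking to a point, so the two branches of the
  definition fit together.\<close>

lemma mean_lift_continuous: "continuous_on (UNIV \<times> {..1}) (\<lambda>p. mean_lift \<Phi> (fst p) (snd p))"
  unfolding continuous_on_eq_continuous_within
proof
  fix p :: "real \<times> real" assume "p \<in> UNIV \<times> {..1}"
  then obtain x r where p: "p = (x, r)" "r \<le> 1" by auto
  show "continuous (at p within UNIV \<times> {..1}) (\<lambda>p. mean_lift \<Phi> (fst p) (snd p))"
  proof (cases "r < 1")
    case True
    then obtain b where "((\<lambda>p. mean_lift \<Phi> (fst p) (snd p)) has_derivative (\<lambda>v. fst v * mean_slope \<Phi> x r + snd v * b)) (at (x, r))"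
      using mean_lift_has_derivative by blast
    from has_derivative_continuous[OF this] show ?thesis
      unfolding p(1) by (rule continuous_at_imp_continuous_at_within)
  next
    case False
    then have r: "r = 1" using p by simp
    have "((\<lambda>p. \<Phi> (fst p - (1 - snd p))) \<longlongrightarrow> \<Phi> (fst p - (1 - snd p))) (at p within UNIV \<times> {..1})"
         "((\<lambda>p. \<Phi> (fst p + (1 - snd p))) \<longlongrightarrow> \<Phi> (fst p + (1 - snd p))) (at p within UNIV \<times> {..1})"
      by (rule isCont_tendsto_compose[OF lift_isCont], intro tendsto_intros)+
    then have lim: "((\<lambda>p. \<Phi> (fst p - (1 - snd p))) \<longlongrightarrow> \<Phi> x) (at p within UNIV \<times> {..1})"
         "((\<lambda>p. \<Phi> (fst p + (1 - snd p))) \<longlongrightarrow> \<Phi> x) (at p within UNIV \<times> {..1})"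
      by (simp_all add: p r)
    have ev: "eventually (\<lambda>q. q \<in> UNIV \<times> {..1}) (at p within UNIV \<times> {..1})"
      by (simp add: eventually_at_filter)
    have "((\<lambda>p. mean_lift \<Phi> (fst p) (snd p)) \<longlongrightarrow> \<Phi> x) (at p within UNIV \<times> {..1})"
    proof (rule tendsto_sandwich[OF _ _ lim])
      show "\<forall>\<^sub>F q in at p within UNIV \<times> {..1}. \<Phi> (fst q - (1 - snd q)) \<le> mean_lift \<Phi> (fst q) (snd q)"
        using ev by eventually_elim (auto intro!: mean_lift_bounds)
      show "\<forall>\<^sub>F q in at p within UNIV \<times> {..1}. mean_lift \<Phi> (fst q) (snd q) \<le> \<Phi> (fst q + (1 - snd q))"
        using ev by eventually_elim (auto intro!: mean_lift_bounds)
    qed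
    then show ?thesis by (simp add: continuous_within p r mean_lift_def)
  qed
qed

end

section \<open>The increasing map x + U(x, r) and its inverse in x\<close>

definition shear :: "(real \<Rightarrow> real) \<Rightarrow> real \<Rightarrow> real \<Rightarrow> real" where
  "shear \<Phi> x r = x + mean_lift \<Phi> x r"

definition unshear :: "(real \<Rightarrow> real) \<Rightarrow> real \<Rightarrow> real \<Rightarrow> real" where
  "unshear \<Phi> y r = (THE x. shear \<Phi> x r = y)"

context
  fixes \<Phi> :: "real \<Rightarrow> real"
  assumes lift: "lift_map \<Phi>"
begin

text \<open>Since the mean is monotone, the summand \<open>x\<close> alone guarantees slope at least
  1. The shear is therefore a bijection of the line with a 1-Lipschitz inverse, whatever the modulus
  of continuity of the lift.\<close>

lemma shear_expand: "r \<le> 1 \<Longrightarrow> x \<le> y \<Longrightarrow> y - x \<le> shear \<Phi> y r - shear \<Phi> x r"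
  using mean_lift_mono[OF lift, of r x y] by (simp add: shear_def)

lemma shear_expand_abs: "r \<le> 1 \<Longrightarrow> \<bar>y - x\<bar> \<le> \<bar>shear \<Phi> y r - shear \<Phi> x r\<bar>"
  using shear_expand[of r x y] shear_expand[of r y x] by (cases "x \<le> y") auto

lemma shear_continuous: "continuous_on (UNIV \<times> {..1}) (\<lambda>p. shear \<Phi> (fst p) (snd p))"
  unfolding shear_def by (intro continuous_intros mean_lift_continuous lift)

lemma shear_continuous_compose:
  assumes "continuous_on A f" "continuous_on A g" "\<And>x. x \<in> A \<Longrightarrow> g x \<le> 1"
  shows "continuous_on A (\<lambda>x. shear \<Phi> (f x) (g x))"
  using continuous_on_compose2[OF shear_continuous continuous_on_Pair[OF assms(1,2)]] assms(3) by auto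

lemma shear_unshear: "r \<le> 1 \<Longrightarrow> shear \<Phi> (unshear \<Phi> y r) r = y"
  and unshear_shear: "r \<le> 1 \<Longrightarrow> unshear \<Phi> (shear \<Phi> x r) r = x"
proof -
  assume r: "r \<le> 1"
  have uniq: "a = b" if "shear \<Phi> a r = shear \<Phi> b r" for a b
    using shear_expand_abs[OF r, of a b] that by simp
  show "unshear \<Phi> (shear \<Phi> x r) r = x" unfolding unshear_def using uniq by blast
  \<comment> \<open>Because the shear expands distances, moving from 0 by the distance between y and
    the value at 0 brackets y on both sides.\<close>
  define c where "c = \<bar>y - shear \<Phi> 0 r\<bar>"
  have "c \<ge> 0" by (simp add: c_def)
  have "shear \<Phi> (-c) r \<le> y" "y \<le> shear \<Phi> c r"
    using shear_expand[OF r, of "-c" 0] shear_expand[OF r, of 0 c] \<open>c \<ge> 0\<close> by (auto simp: c_def)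
  then have "\<exists>x. -c \<le> x \<and> x \<le> c \<and> shear \<Phi> x r = y"
    by (intro IVT' shear_continuous_compose continuous_intros) (use \<open>c \<ge> 0\<close> r in auto)
  then have "\<exists>!x. shear \<Phi> x r = y" using uniq by blast
  then show "shear \<Phi> (unshear \<Phi> y r) r = y" unfolding unshear_def by (rule theI')
qed

text \<open>Both \<open>x\<close> and the mean advance by 2 pi, hence 4 pi; the inverse shear undoes
  the doubling, and the composite map again advances by 2 pi.\<close>

lemma shear_period: "shear \<Phi> (x + 2*pi) r = shear \<Phi> x r + 4*pi"
  using mean_lift_period[OF lift, of x r] by (simp add: shear_def)

lemma unshear_period:
  assumes "r \<le> 1" shows "unshear \<Phi> (y + 4*pi) r = unshear \<Phi> y r + 2*pi"
  using unshear_shear[OF assms, of "unshear \<Phi> y r + 2*pi"]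
  by (simp add: shear_period shear_unshear[OF assms])

text \<open>Expansion bounds the distance of the preimage from x0 by |y - shear(x0, r)|. There x0 is
  fixed, so only continuity of the shear itself is involved.\<close>

lemma unshear_continuous: "continuous_on (UNIV \<times> {..1}) (\<lambda>p. unshear \<Phi> (fst p) (snd p))"
  unfolding continuous_on_def
proof
  fix p0 :: "real \<times> real" assume "p0 \<in> UNIV \<times> {..1}"
  then obtain y0 r0 where p0: "p0 = (y0, r0)" "r0 \<le> 1" by auto
  define x0 where "x0 = unshear \<Phi> y0 r0"
  have e: "shear \<Phi> x0 r0 = y0" unfolding x0_def by (rule shear_unshear[OF p0(2)])
  have "continuous_on (UNIV \<times> {..1}) (\<lambda>p. \<bar>fst p - shear \<Phi> x0 (snd p)\<bar>)"
    by (intro continuous_intros shear_continuous_compose) auto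
  then have "((\<lambda>p. \<bar>fst p - shear \<Phi> x0 (snd p)\<bar>) \<longlongrightarrow> \<bar>fst p0 - shear \<Phi> x0 (snd p0)\<bar>) (at p0 within UNIV \<times> {..1})"
    unfolding continuous_on_def using \<open>p0 \<in> _\<close> by (rule bspec)
  then have lim: "((\<lambda>p. \<bar>fst p - shear \<Phi> x0 (snd p)\<bar>) \<longlongrightarrow> 0) (at p0 within UNIV \<times> {..1})" by (simp add: e p0)
  have ev: "eventually (\<lambda>q. q \<in> UNIV \<times> {..1}) (at p0 within UNIV \<times> {..1})"
    by (simp add: eventually_at_filter)
  have "((\<lambda>p. unshear \<Phi> (fst p) (snd p) - x0) \<longlongrightarrow> 0) (at p0 within UNIV \<times> {..1})"
  proof (rule Lim_null_comparison[OF _ lim])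
    show "\<forall>\<^sub>F p in at p0 within UNIV \<times> {..1}. norm (unshear \<Phi> (fst p) (snd p) - x0) \<le> \<bar>fst p - shear \<Phi> x0 (snd p)\<bar>"
      using ev
    proof eventually_elim
      case (elim p)
      then have r: "snd p \<le> 1" by auto
      show ?case using shear_expand_abs[OF r, of "unshear \<Phi> (fst p) (snd p)" x0] shear_unshear[OF r] by simp
    qed
  qed
  then show "((\<lambda>p. unshear \<Phi> (fst p) (snd p)) \<longlongrightarrow> unshear \<Phi> (fst p0) (snd p0)) (at p0 within UNIV \<times> {..1})"
    unfolding p0 fst_conv snd_conv x0_def by (rule LIM_zero_cancel)
qed

lemma shear_has_derivative:
  assumes r: "r < 1"
  obtains b where "((\<lambda>p. shear \<Phi> (fst p) (snd p)) has_derivative (\<lambda>v. fst v * (1 + mean_slope \<Phi> x r) + snd v * b)) (at (x, r))"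
    "\<bar>b\<bar> \<le> mean_slope \<Phi> x r"
proof -
  obtain b where b: "((\<lambda>p. mean_lift \<Phi> (fst p) (snd p)) has_derivative (\<lambda>v. fst v * mean_slope \<Phi> x r + snd v * b)) (at (x, r))"
    "\<bar>b\<bar> \<le> mean_slope \<Phi> x r" using mean_lift_has_derivative[OF lift r] by blast
  have "((\<lambda>p. shear \<Phi> (fst p) (snd p)) has_derivative (\<lambda>v. fst v * (1 + mean_slope \<Phi> x r) + snd v * b)) (at (x, r))"
    unfolding shear_def
    by (rule has_derivative_eq_rhs[OF has_derivative_add[OF has_derivative_fst[OF has_derivative_ident] b(1)]]) (auto simp: algebra_simps)
  then show ?thesis using b(2) that by blast
qed

text \<open>The map (x, r) to (shear(x, r), r) has a triangular differential with diagonal entries 1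
  + m and 1, so it is invertible; the derivative of the inverse is read off in its first
  component.\<close>

lemma unshear_has_derivative:
  assumes r: "r < 1"
  obtains b m where "((\<lambda>p. unshear \<Phi> (fst p) (snd p)) has_derivative (\<lambda>v. (fst v - snd v * b) / (1 + m))) (at (y, r))"
    "\<bar>b\<bar> \<le> m"
proof -
  define x where "x = unshear \<Phi> y r"
  define m where "m = mean_slope \<Phi> x r"
  have m: "m \<ge> 0" unfolding m_def by (rule mean_slope_nonneg[OF lift r])
  obtain b where b: "((\<lambda>p. shear \<Phi> (fst p) (snd p)) has_derivative (\<lambda>v. fst v * (1 + m) + snd v * b)) (at (x, r))"
    "\<bar>b\<bar> \<le> m" using shear_has_derivative[OF r] unfolding m_def by blast
  let ?f = "\<lambda>p. (shear \<Phi> (fst p) (snd p), snd p)"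
  let ?g = "\<lambda>p. (unshear \<Phi> (fst p) (snd p), snd p)"
  let ?g' = "\<lambda>v. ((fst v - snd v * b) / (1 + m), snd v)"
  have op: "open (UNIV \<times> {..<1} :: (real \<times> real) set)" by (intro open_Times) auto
  have "(?g has_derivative ?g') (at (y, r))"
  proof (rule has_derivative_inverse_basic[where f="?f" and f'="\<lambda>v. (fst v * (1 + m) + snd v * b, snd v)" and T="UNIV \<times> {..<1}"])
    show "(?f has_derivative (\<lambda>v. (fst v * (1 + m) + snd v * b, snd v))) (at (?g (y, r)))"
      using b(1) by (auto intro!: has_derivative_Pair has_derivative_snd has_derivative_ident simp: x_def)
    show "bounded_linear ?g'"
      by (intro bounded_linear_Pair bounded_linear_divide[THEN bounded_linear_compose] bounded_linear_sub
          bounded_linear_mult_left[THEN bounded_linear_compose] bounded_linear_fst bounded_linear_snd)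
    show "?g' \<circ> (\<lambda>v. (fst v * (1 + m) + snd v * b, snd v)) = id" using m by (auto simp: fun_eq_iff)
    have "continuous_on (UNIV \<times> {..<1}) ?g"
      by (intro continuous_intros continuous_on_subset[OF unshear_continuous]) auto
    then show "continuous (at (y, r)) ?g"
      using op r by (auto simp: continuous_on_eq_continuous_at)
    show "?f (?g z) = z" if "z \<in> UNIV \<times> {..<1}" for z
      using that shear_unshear by (auto simp: less_imp_le)
  qed (use r op in auto)
  from has_derivative_fst[OF this] have "((\<lambda>p. unshear \<Phi> (fst p) (snd p)) has_derivative (\<lambda>v. (fst v - snd v * b) / (1 + m))) (at (y, r))"
    by simp
  then show ?thesis using b(2) by (rule that)
qed

end

text \<open>Writing \<open>U\<close> and \<open>V\<close> for the means of \<open>\<Phi>\<close> and \<open>\<Psi>\<close>, the value \<open>w\<close> of this map at \<open>(x, r)\<close> solves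
  \<open>w + V(w, r) = x + U(x, r)\<close>, an equation that is symmetric under exchanging the two lifts.\<close>

definition shear_map :: "(real \<Rightarrow> real) \<Rightarrow> (real \<Rightarrow> real) \<Rightarrow> real \<Rightarrow> real \<Rightarrow> real" where
  "shear_map \<Phi> \<Psi> x r = unshear \<Psi> (shear \<Phi> x r) r"

context
  fixes \<Phi> \<Psi> :: "real \<Rightarrow> real"
  assumes lifts: "lift_map \<Phi>" "lift_map \<Psi>"
begin

lemma shear_map_period: "r \<le> 1 \<Longrightarrow> shear_map \<Phi> \<Psi> (x + 2*pi) r = shear_map \<Phi> \<Psi> x r + 2*pi"
  by (simp add: shear_map_def shear_period[OF lifts(1)] unshear_period[OF lifts(2)])

lemma shear_map_inverse: "r \<le> 1 \<Longrightarrow> shear_map \<Psi> \<Phi> (shear_map \<Phi> \<Psi> x r) r = x"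
  by (simp add: shear_map_def shear_unshear[OF lifts(2)] unshear_shear[OF lifts(1)])

lemma shear_map_continuous: "continuous_on (UNIV \<times> {..1}) (\<lambda>p. shear_map \<Phi> \<Psi> (fst p) (snd p))"
proof -
  have "continuous_on (UNIV \<times> {..1}) (\<lambda>p. unshear \<Psi> (fst (shear \<Phi> (fst p) (snd p), snd p)) (snd (shear \<Phi> (fst p) (snd p), snd p)))"
    by (rule continuous_on_compose2[OF unshear_continuous[OF lifts(2)]])
       (auto intro!: continuous_intros shear_continuous[OF lifts(1)])
  then show ?thesis by (simp add: shear_map_def)
qed

text \<open>The shear of \<Psi> at \<open>w\<close> equals the shear of \<Phi> at \<open>x\<close>,
  and both are strictly increasing.\<close>

lemma shear_map_less:
  assumes r: "r \<le> 1" and "x < y"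
  shows "shear_map \<Phi> \<Psi> x r < shear_map \<Phi> \<Psi> y r"
proof (rule ccontr)
  assume "\<not> ?thesis"
  then have le: "shear_map \<Phi> \<Psi> y r \<le> shear_map \<Phi> \<Psi> x r" by simp
  from shear_expand[OF lifts(2) r le] shear_expand[OF lifts(1) r, of x y]
  show False using assms le by (simp add: shear_map_def shear_unshear[OF lifts(2)])
qed

lemma shear_map_boundary:
  assumes "\<And>x. \<Psi> (\<Phi> x) = x"
  shows "shear_map \<Phi> \<Psi> x 1 = \<Phi> x"
proof -
  have "shear \<Phi> x 1 = shear \<Psi> (\<Phi> x) 1" by (simp add: shear_def mean_lift_def assms)
  then show ?thesis by (simp add: shear_map_def unshear_shear[OF lifts(2)])
qed

text \<open>With k = U_x and m = V_x the derivatives of w are (1 + k) / (1 + m) and (c - b) / (1 +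
  m), where |c| <= k and |b| <= m. As k + m <= (1 + k) (1 + m), the denominator absorbs everything
  coming from \<Psi>: the energy of the map is governed by \<Phi> alone, and that of its inverse by
  \<Psi> alone.\<close>

lemma shear_map_has_derivative:
  assumes r: "r < 1"
  obtains A B where "((\<lambda>p. shear_map \<Phi> \<Psi> (fst p) (snd p)) has_derivative (\<lambda>v. fst v * A + snd v * B)) (at (x, r))"
    "\<bar>A\<bar> \<le> 1 + mean_slope \<Phi> x r" "\<bar>B\<bar> \<le> 1 + mean_slope \<Phi> x r"
proof -
  define k where "k = mean_slope \<Phi> x r"
  have k: "k \<ge> 0" unfolding k_def by (rule mean_slope_nonneg[OF lifts(1) r])
  obtain c where c: "((\<lambda>p. shear \<Phi> (fst p) (snd p)) has_derivative (\<lambda>v. fst v * (1 + k) + snd v * c)) (at (x, r))"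
    "\<bar>c\<bar> \<le> k" using shear_has_derivative[OF lifts(1) r] unfolding k_def by blast
  obtain b m where b: "((\<lambda>p. unshear \<Psi> (fst p) (snd p)) has_derivative (\<lambda>v. (fst v - snd v * b) / (1 + m))) (at (shear \<Phi> x r, r))"
    "\<bar>b\<bar> \<le> m" using unshear_has_derivative[OF lifts(2) r] by blast
  have m: "m \<ge> 0" using b(2) by linarith
  have "((\<lambda>p. (shear \<Phi> (fst p) (snd p), snd p)) has_derivative (\<lambda>v. (fst v * (1 + k) + snd v * c, snd v))) (at (x, r))"
    by (intro has_derivative_Pair c has_derivative_snd has_derivative_ident)
  from has_derivative_compose[OF this, of "\<lambda>p. unshear \<Psi> (fst p) (snd p)" "\<lambda>v. (fst v - snd v * b) / (1 + m)"] b(1)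
  have "((\<lambda>p. shear_map \<Phi> \<Psi> (fst p) (snd p)) has_derivative (\<lambda>v. (fst v * (1 + k) + snd v * c - snd v * b) / (1 + m))) (at (x, r))"
    by (simp add: shear_map_def)
  also have "(\<lambda>v. (fst v * (1 + k) + snd v * c - snd v * b) / (1 + m)) = (\<lambda>v. fst v * ((1 + k) / (1 + m)) + snd v * ((c - b) / (1 + m)))"
    by (simp add: fun_eq_iff add_divide_distrib diff_divide_distrib algebra_simps)
  finally have D: "((\<lambda>p. shear_map \<Phi> \<Psi> (fst p) (snd p)) has_derivative (\<lambda>v. fst v * ((1 + k) / (1 + m)) + snd v * ((c - b) / (1 + m)))) (at (x, r))" .
  have A: "\<bar>(1 + k) / (1 + m)\<bar> \<le> 1 + k"
  proof -
    have "(1 + k) * 1 \<le> (1 + k) * (1 + m)" using k m by (intro mult_left_mono) auto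
    then show ?thesis using k m by (simp add: abs_divide divide_le_eq)
  qed
  have B: "\<bar>(c - b) / (1 + m)\<bar> \<le> 1 + k"
  proof -
    have "\<bar>c - b\<bar> \<le> k + m" using c(2) b(2) by linarith
    also have "\<dots> \<le> (1 + k) * (1 + m)" using k m by (simp add: algebra_simps)
    finally show ?thesis using m by (simp add: abs_divide divide_le_eq)
  qed
  show ?thesis using D A B unfolding k_def by (rule that)
qed

end

section \<open>Angular maps of the disk\<close>

lemma cis_eq_cisE:
  assumes "cis a = cis b"
  obtains k :: int where "a = b + 2*pi * of_int k"
proof -
  have "sin a = sin b \<and> cos a = cos b" using assms by (auto simp: complex_eq_iff)
  then show ?thesis using that by (auto simp: sin_cos_eq_iff)
qed

text \<open>A periodic function of the argument does not see which branch is chosen, so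
  \<open>Arg\<close> may be traded for any other argument of \<open>z\<close>.\<close>

lemma periodic_polar_eq:
  assumes "z \<noteq> 0" "z = of_real (cmod z) * cis t" and per: "\<And>x. F (x + 2*pi) = F x"
  shows "F (Arg z) = F t"
proof -
  have "of_real (cmod z) * cis (Arg z) = of_real (cmod z) * cis t"
    using assms(2) rcis_cmod_Arg[of z] by (simp add: rcis_def)
  then have "cis (Arg z) = cis t" using assms(1) by simp
  then obtain k :: int where "Arg z = t + 2*pi * of_int k" by (rule cis_eq_cisE)
  then show ?thesis using periodic_2pi_int[of F, OF per] by simp
qed

text \<open>Dividing by z0 carries a neighbourhood of z0 to one of 1, where the principal logarithm
  is smooth. This gives a smooth branch of the argument near every z0 \<noteq> 0, even on the cut of
  \<open>Arg\<close>.\<close>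

lemma local_arg:
  assumes "z \<noteq> 0" "z0 \<noteq> 0"
  shows "z = of_real (cmod z) * cis (Arg z0 + Im (Ln (z / z0)))"
proof -
  define a where "a = Im (Ln (z / z0))"
  have q: "z / z0 = of_real (cmod z / cmod z0) * cis a"
    using assms exp_Ln[of "z / z0"] exp_eq_polar[of "Ln (z / z0)"] by (simp add: a_def norm_divide)
  have z0: "z0 = of_real (cmod z0) * cis (Arg z0)" using rcis_cmod_Arg[of z0] by (simp add: rcis_def)
  have "z = (z / z0) * z0" using assms by simp
  also have "\<dots> = (of_real (cmod z / cmod z0) * cis a) * (of_real (cmod z0) * cis (Arg z0))"
    by (rule arg_cong2[where f="(*)", OF q z0])
  also have "\<dots> = of_real (cmod z / cmod z0 * cmod z0) * (cis (Arg z0) * cis a)" by simp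
  also have "\<dots> = of_real (cmod z) * cis (Arg z0 + a)" using assms by (simp add: cis_mult)
  finally show ?thesis unfolding a_def .
qed

lemma quotient_not_nonpos:
  assumes "cmod (z - z0) < cmod z0"
  shows "z / z0 \<notin> \<real>\<^sub>\<le>\<^sub>0"
proof
  assume "z / z0 \<in> \<real>\<^sub>\<le>\<^sub>0"
  then have "Re (z / z0) \<le> 0" by (auto simp: complex_nonpos_Reals_iff)
  moreover have z0: "z0 \<noteq> 0" using assms by auto
  have "z / z0 - 1 = (z - z0) / z0" using z0 by (simp add: field_simps)
  then have "cmod (z / z0 - 1) < 1" using assms z0 by (simp add: norm_divide)
  then have "\<bar>Re (z / z0 - 1)\<bar> < 1" using abs_Re_le_cmod order.strict_trans1 by blast
  ultimately show False by simp
qed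

text \<open>Near z0 the discontinuous \<open>Arg\<close> is replaced by the smooth local branch;
  periodicity makes the two expressions agree.\<close>

lemma periodic_polar_continuous_on:
  fixes P :: "real \<Rightarrow> real \<Rightarrow> 'a::topological_space"
  assumes per: "\<And>x r. r \<in> S \<Longrightarrow> P (x + 2*pi) r = P x r"
    and cont: "continuous_on (UNIV \<times> S) (\<lambda>p. P (fst p) (snd p))"
  shows "continuous_on {z. z \<noteq> 0 \<and> cmod z \<in> S} (\<lambda>z. P (Arg z) (cmod z))"
  unfolding continuous_on_eq_continuous_within
proof
  let ?A = "{z. z \<noteq> 0 \<and> cmod z \<in> S}"
  fix z0 assume "z0 \<in> ?A"
  then have z0: "z0 \<noteq> 0" "cmod z0 \<in> S" by auto
  let ?B = "ball z0 (cmod z0)"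
  have "continuous_on (?A \<inter> ?B) (\<lambda>z. P (fst (Arg z0 + Im (Ln (z / z0)), cmod z)) (snd (Arg z0 + Im (Ln (z / z0)), cmod z)))"
  proof (rule continuous_on_compose2[OF cont])
    show "continuous_on (?A \<inter> ?B) (\<lambda>z. (Arg z0 + Im (Ln (z / z0)), cmod z))"
      using z0 quotient_not_nonpos by (intro continuous_intros) (auto simp: dist_norm norm_minus_commute)
  qed auto
  moreover have "P (fst (Arg z0 + Im (Ln (z / z0)), cmod z)) (snd (Arg z0 + Im (Ln (z / z0)), cmod z)) = P (Arg z) (cmod z)"
    if "z \<in> ?A \<inter> ?B" for z
    using that periodic_polar_eq[of z "Arg z0 + Im (Ln (z / z0))" "\<lambda>x. P x (cmod z)"] local_arg[of z z0] z0 per by simp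
  ultimately have "continuous_on (?A \<inter> ?B) (\<lambda>z. P (Arg z) (cmod z))"
    by (rule continuous_on_eq)
  then have "continuous (at z0 within ?A \<inter> ?B) (\<lambda>z. P (Arg z) (cmod z))"
    using z0 by (simp add: continuous_on_eq_continuous_within)
  moreover have "at z0 within ?A \<inter> ?B = at z0 within ?A"
    by (rule at_within_nhd[of _ ?B]) (use z0 in auto)
  ultimately show "continuous (at z0 within ?A) (\<lambda>z. P (Arg z) (cmod z))" by simp
qed

definition polar_map :: "(real \<Rightarrow> real \<Rightarrow> real) \<Rightarrow> complex \<Rightarrow> complex" where
  "polar_map P z = of_real (cmod z) * cis (P (Arg z) (cmod z))"

lemma cmod_polar_map [simp]: "cmod (polar_map P z) = cmod z"
  by (simp add: polar_map_def norm_mult)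

context
  fixes P :: "real \<Rightarrow> real \<Rightarrow> real"
  assumes per: "\<And>x r. r \<le> 1 \<Longrightarrow> P (x + 2*pi) r = P x r + 2*pi"
begin

lemma polar_map_eq:
  assumes "cmod z \<le> 1" "z = of_real (cmod z) * cis t"
  shows "polar_map P z = of_real (cmod z) * cis (P t (cmod z))"
proof (cases "z = 0")
  case False
  then have "cis (P (Arg z) (cmod z)) = cis (P t (cmod z))"
    using periodic_polar_eq[OF False assms(2), of "\<lambda>x. cis (P x (cmod z))"] per[OF assms(1)] by simp
  then show ?thesis by (simp add: polar_map_def)
qed (simp add: polar_map_def)

lemma polar_map_continuous:
  assumes cont: "continuous_on (UNIV \<times> {..1}) (\<lambda>p. P (fst p) (snd p))"
  shows "continuous_on (cball 0 1) (polar_map P)"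
  unfolding continuous_on_eq_continuous_within
proof
  fix z :: complex assume z: "z \<in> cball 0 1"
  show "continuous (at z within cball 0 1) (polar_map P)"
  proof (cases "z = 0")
    case True
    \<comment> \<open>The modulus is preserved, so the limit at the origin is 0 whatever the angle
      does.\<close>
    have "((\<lambda>w. cmod w) \<longlongrightarrow> cmod 0) (at 0 within cball 0 1)" by (intro tendsto_intros)
    then have "(polar_map P \<longlongrightarrow> 0) (at 0 within cball 0 1)"
      by - (rule tendsto_norm_zero_cancel, simp)
    then show ?thesis unfolding True continuous_within by (simp add: polar_map_def)
  next
    case False
    have "continuous_on {z. z \<noteq> 0 \<and> cmod z \<in> {..1}} (\<lambda>z. (\<lambda>x r. cis (P x r)) (Arg z) (cmod z))"
      by (rule periodic_polar_continuous_on) (auto simp: per intro!: continuous_intros cont)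
    moreover have "continuous_on {z. z \<noteq> 0 \<and> cmod z \<in> {..1}} (\<lambda>z. complex_of_real (cmod z))"
      by (intro continuous_intros)
    ultimately have "continuous_on {z. z \<noteq> 0 \<and> cmod z \<in> {..1}} (polar_map P)"
      unfolding polar_map_def[abs_def] by (rule continuous_on_mult[rotated])
    then have "continuous (at z within {z. z \<noteq> 0 \<and> cmod z \<in> {..1}}) (polar_map P)"
      using z False by (simp add: continuous_on_eq_continuous_within)
    moreover have "at z within {z. z \<noteq> 0 \<and> cmod z \<in> {..1}} = at z within cball 0 1"
      by (rule at_within_nhd[of _ "- {0}"]) (use False in auto)
    ultimately show ?thesis by simp
  qed
qed

text \<open>The argument changes at the rate Im (v / z0), of size at most cmod v / cmod z0. In the
  differential of the map it is multiplied by cmod z0, so the bound contains no factor that blows up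
  at the origin.\<close>

lemma polar_map_has_derivative:
  assumes z0: "z0 \<noteq> 0" "cmod z0 < 1"
    and der: "((\<lambda>p. P (fst p) (snd p)) has_derivative (\<lambda>v. fst v * A + snd v * B)) (at (Arg z0, cmod z0))"
  obtains D where "(polar_map P has_derivative D) (at z0)" "\<And>v. cmod (D v) \<le> (1 + \<bar>A\<bar> + \<bar>B\<bar>) * cmod v"
proof -
  let ?w = "P (Arg z0) (cmod z0)"
  let ?N = "\<lambda>v. v \<bullet> sgn z0"
  let ?t = "\<lambda>z. Arg z0 + Im (Ln (z / z0))"
  define D where "D v = of_real (cmod z0) * ((Im (v / z0) * A + ?N v * B) *\<^sub>R (\<i> * cis ?w)) + of_real (?N v) * cis ?w" for v
  have "((\<lambda>z. Ln (z / z0)) has_field_derivative 1 / z0) (at z0)"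
    using z0 by (auto intro!: derivative_eq_intros)
  then have "((\<lambda>z. Ln (z / z0)) has_derivative (\<lambda>v. 1 / z0 * v)) (at z0)"
    unfolding has_field_derivative_def .
  then have t: "(?t has_derivative (\<lambda>v. Im (v / z0))) (at z0)"
    by (auto intro!: derivative_eq_intros)
  have n: "(cmod has_derivative ?N) (at z0)" by (rule has_derivative_norm[OF z0(1)])
  have tn: "((\<lambda>z. (?t z, cmod z)) has_derivative (\<lambda>v. (Im (v / z0), ?N v))) (at z0)"
    by (intro has_derivative_Pair t n)
  have "((\<lambda>p. P (fst p) (snd p)) has_derivative (\<lambda>v. fst v * A + snd v * B)) (at (?t z0, cmod z0))"
    using der z0 by simp
  from has_derivative_compose[OF tn this]
  have "((\<lambda>z. P (?t z) (cmod z)) has_derivative (\<lambda>v. Im (v / z0) * A + ?N v * B)) (at z0)" by simp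
  from has_derivative_mult[OF has_derivative_of_real[OF n] has_derivative_cis[OF this]]
  have "((\<lambda>z. of_real (cmod z) * cis (P (?t z) (cmod z))) has_derivative D) (at z0)"
    using z0 unfolding D_def by simp
  then have "(polar_map P has_derivative D) (at z0)"
  proof (rule has_derivative_transform_within_open[where s="ball 0 1 - {0}"])
    show "of_real (cmod z) * cis (P (?t z) (cmod z)) = polar_map P z" if "z \<in> ball 0 1 - {0}" for z
      using that local_arg[of z z0] z0 by (intro polar_map_eq[symmetric]) auto
  qed (use z0 in auto)
  moreover have "cmod (D v) \<le> (1 + \<bar>A\<bar> + \<bar>B\<bar>) * cmod v" for v
  proof -
    have N: "\<bar>?N v\<bar> \<le> cmod v" using Cauchy_Schwarz_ineq2[of v "sgn z0"] z0 by (simp add: norm_sgn)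
    have I: "cmod z0 * \<bar>Im (v / z0)\<bar> \<le> cmod v"
    proof -
      have "cmod z0 * \<bar>Im (v / z0)\<bar> \<le> cmod z0 * cmod (v / z0)" by (intro mult_left_mono abs_Im_le_cmod) auto
      then show ?thesis using z0 by (simp add: norm_divide)
    qed
    have "cmod (D v) \<le> cmod z0 * \<bar>Im (v / z0) * A + ?N v * B\<bar> + \<bar>?N v\<bar>"
      unfolding D_def by (rule order_trans[OF norm_triangle_ineq]) (simp add: norm_mult)
    also have "cmod z0 * \<bar>Im (v / z0) * A + ?N v * B\<bar> \<le> cmod z0 * (\<bar>Im (v / z0)\<bar> * \<bar>A\<bar> + \<bar>?N v\<bar> * \<bar>B\<bar>)"
      by (intro mult_left_mono) (auto simp: abs_mult[symmetric])
    also have "\<dots> = (cmod z0 * \<bar>Im (v / z0)\<bar>) * \<bar>A\<bar> + cmod z0 * (\<bar>?N v\<bar> * \<bar>B\<bar>)" by (simp add: algebra_simps)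
    also have "\<dots> \<le> cmod v * \<bar>A\<bar> + 1 * (cmod v * \<bar>B\<bar>)"
      using I N z0 by (intro add_mono mult_mono mult_right_mono) auto
    finally show ?thesis using N by (simp add: algebra_simps)
  qed
  ultimately show ?thesis by (rule that)
qed

end

text \<open>Equal images have equal moduli and image angles that differ by 2 pi k. Moving one
  argument by 2 pi k makes the image angles equal, and strict monotonicity then identifies the
  arguments.\<close>

lemma polar_map_inj:
  assumes per: "\<And>x r. r \<le> 1 \<Longrightarrow> P (x + 2*pi) r = P x r + 2*pi"
    and less: "\<And>x y r. r \<le> 1 \<Longrightarrow> x < y \<Longrightarrow> P x r < P y r"
    and "cmod z \<le> 1" "cmod w \<le> 1" "polar_map P z = polar_map P w"
  shows "z = w"
proof (cases "z = 0")
  case True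
  then show ?thesis using assms(5) cmod_polar_map[of P w] by (simp add: polar_map_def)
next
  case False
  have n: "cmod w = cmod z" using assms(5) by (metis cmod_polar_map)
  then have "cis (P (Arg z) (cmod z)) = cis (P (Arg w) (cmod z))"
    using assms(5) False by (simp add: polar_map_def)
  then obtain k :: int where k: "P (Arg z) (cmod z) = P (Arg w) (cmod z) + 2*pi * of_int k" by (rule cis_eq_cisE)
  have "P (x + 2*pi * of_int k) (cmod z) - (x + 2*pi * of_int k) = P x (cmod z) - x" for x
    by (rule periodic_2pi_int[of "\<lambda>x. P x (cmod z) - x"]) (simp add: per[OF assms(3)])
  from this[of "Arg w"] have "P (Arg z) (cmod z) = P (Arg w + 2*pi * of_int k) (cmod z)" using k by simp
  then have "Arg z = Arg w + 2*pi * of_int k"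
    using less[OF assms(3), of "Arg z" "Arg w + 2*pi * of_int k"] less[OF assms(3), of "Arg w + 2*pi * of_int k" "Arg z"]
    by (cases "Arg z" "Arg w + 2*pi * of_int k" rule: linorder_cases) auto
  then have "cis (Arg z) = cis (Arg w)" using periodic_2pi_int[of cis "Arg w" k] by simp
  then show ?thesis using rcis_cmod_Arg[of z] rcis_cmod_Arg[of w] n by (simp add: rcis_def)
qed

text \<open>The straight-line homotopy of the angular parts is a homotopy through injective maps from the
  identity, so it transports the winding number.\<close>

lemma polar_map_orient_pres:
  assumes per: "\<And>x r. r \<le> 1 \<Longrightarrow> P (x + 2*pi) r = P x r + 2*pi"
    and cont: "continuous_on (UNIV \<times> {..1}) (\<lambda>p. P (fst p) (snd p))"
    and less: "\<And>x y r. r \<le> 1 \<Longrightarrow> x < y \<Longrightarrow> P x r < P y r"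
  shows "disk_orient_pres (polar_map P)"
  unfolding disk_orient_pres_def
proof (intro allI impI)
  fix z :: complex and r :: real
  assume "r > 0 \<and> cball z r \<subseteq> ball 0 1"
  then have r: "r > 0" and sub: "cball z r \<subseteq> ball 0 1" by auto
  \<comment> \<open>The displacement of the angle is 2 pi-periodic, hence continuous across the cut
    of \<open>Arg\<close>, although neither of its two terms is.\<close>
  define q where "q w = P (Arg w) (cmod w) - Arg w" for w
  define k where "k t w = w * cis (t * q w)" for t :: real and w
  \<comment> \<open>A convex combination of the identity and \<open>P\<close>, so it inherits strict
    monotonicity in \<open>x\<close> for t in [0, 1].\<close>
  define Pt where "Pt t x s = x + t * (P x s - x)" for t x s :: real
  have k_polar: "k t w = polar_map (Pt t) w" for t w
  proof -
    have "w * cis (t * q w) = (of_real (cmod w) * cis (Arg w)) * cis (t * q w)"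
      using rcis_cmod_Arg[of w] by (simp add: rcis_def)
    then show ?thesis by (simp add: k_def polar_map_def Pt_def q_def cis_mult mult.assoc)
  qed
  have k_inj: "k t w = k t w' \<Longrightarrow> w = w'" if "t \<in> {0..1}" "cmod w \<le> 1" "cmod w' \<le> 1" for t w w'
    unfolding k_polar
  proof (rule polar_map_inj[of "Pt t"])
    show "Pt t (x + 2*pi) s = Pt t x s + 2*pi" if "s \<le> 1" for x s using per[OF that] by (simp add: Pt_def)
    show "Pt t x s < Pt t y s" if "s \<le> 1" "x < y" for x y s
    proof -
      have e: "Pt t x s = (1 - t) * x + t * P x s" for x by (simp add: Pt_def algebra_simps)
      have P: "P x s < P y s" by (rule less[OF that])
      show ?thesis
      proof (cases "t = 0")
        case False
        then have "t * P x s < t * P y s" using P \<open>t \<in> {0..1}\<close> by simp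
        moreover have "(1 - t) * x \<le> (1 - t) * y" using that \<open>t \<in> {0..1}\<close> by (intro mult_left_mono) auto
        ultimately show ?thesis unfolding e by linarith
      qed (simp add: Pt_def that)
    qed
  qed (use that in auto)
  have q_cont: "continuous_on {w. w \<noteq> 0 \<and> cmod w \<in> {..1}} q"
    unfolding q_def
    by (rule periodic_polar_continuous_on[of "{..1}" "\<lambda>x s. P x s - x"])
       (auto simp: per intro!: continuous_intros cont)
  have k_cont: "continuous_on ({0..1} \<times> cball 0 1) (\<lambda>p. k (fst p) (snd p))"
    unfolding continuous_on_eq_continuous_within
  proof
    fix p :: "real \<times> complex" assume p: "p \<in> {0..1} \<times> cball 0 1"
    show "continuous (at p within {0..1} \<times> cball 0 1) (\<lambda>p. k (fst p) (snd p))"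
    proof (cases "snd p = 0")
      case True
      have "((\<lambda>w. cmod (snd w)) \<longlongrightarrow> cmod (snd p)) (at p within {0..1} \<times> cball 0 1)" by (intro tendsto_intros)
      then have "((\<lambda>p. k (fst p) (snd p)) \<longlongrightarrow> 0) (at p within {0..1} \<times> cball 0 1)"
        using True by - (rule tendsto_norm_zero_cancel, simp add: k_def norm_mult)
      then show ?thesis using True by (simp add: continuous_within k_def)
    next
      case False
      let ?A = "{0..1} \<times> {w. w \<noteq> 0 \<and> cmod w \<in> {..1}}"
      have "continuous_on ?A (\<lambda>p. k (fst p) (snd p))"
        unfolding k_def by (intro continuous_intros continuous_on_compose2[OF q_cont]) auto
      then have "continuous (at p within ?A) (\<lambda>p. k (fst p) (snd p))"
        using p False by (auto simp: continuous_on_eq_continuous_within)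
      moreover have "at p within ?A = at p within {0..1} \<times> cball 0 1"
        by (rule at_within_nhd[of _ "UNIV \<times> (- {0})"]) (use False in \<open>auto simp: mem_Times_iff intro: open_Times\<close>)
      ultimately show ?thesis by simp
    qed
  qed
  let ?c = "circlepath z r"
  have cc: "?c s \<in> cball z r" for s
    using r by (simp add: circlepath dist_norm norm_mult)
  have cz: "?c s \<noteq> z" for s using r by (simp add: circlepath)
  have in1: "cmod (?c s) \<le> 1" "cmod z \<le> 1" for s
  proof -
    have "?c s \<in> ball 0 1" "z \<in> ball 0 1" using sub[THEN subsetD, OF cc[of s]] sub[THEN subsetD, of z] r by auto
    then show "cmod (?c s) \<le> 1" "cmod z \<le> 1" by auto
  qed
  \<comment> \<open>The base point z moves along with the circle; injectivity of each stage keeps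
    the difference away from 0.\<close>
  define G where "G p = k (fst p) (?c (snd p)) - k (fst p) z" for p
  have "homotopic_loops (- {0}) (\<lambda>s. k 0 (?c s) - k 0 z) (\<lambda>s. k 1 (?c s) - k 1 z)"
    unfolding homotopic_loops
  proof (intro exI[of _ G] conjI)
    have ccont: "continuous_on UNIV ?c" by (simp add: circlepath_def part_circlepath_def linepath_def) (intro continuous_intros)
    have "continuous_on ({0..1} \<times> {0..1}) (\<lambda>p. k (fst (fst p, ?c (snd p))) (snd (fst p, ?c (snd p))))"
      by (rule continuous_on_compose2[OF k_cont])
         (use in1 in \<open>auto intro!: continuous_intros continuous_on_compose2[OF ccont]\<close>)
    moreover have "continuous_on ({0..1} \<times> {0..1::real}) (\<lambda>p. k (fst (fst p, z)) (snd (fst p, z)))"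
      by (rule continuous_on_compose2[OF k_cont]) (use in1 in \<open>auto intro!: continuous_intros\<close>)
    ultimately show "continuous_on ({0..1} \<times> {0..1}) G"
      unfolding G_def by (auto intro!: continuous_intros)
    show "G \<in> {0..1} \<times> {0..1} \<rightarrow> - {0}"
      unfolding G_def using k_inj in1 cz by force
  qed (auto simp: G_def pathfinish_def pathstart_def circlepath)
  then have "winding_number (\<lambda>s. k 0 (?c s) - k 0 z) 0 = winding_number (\<lambda>s. k 1 (?c s) - k 1 z) 0"
    by (rule winding_number_homotopic_loops)
  moreover have "k 0 = (\<lambda>w. w)" by (simp add: k_def fun_eq_iff)
  moreover have "k 1 = polar_map P" by (simp add: k_polar Pt_def fun_eq_iff polar_map_def)
  ultimately have "winding_number (\<lambda>s. polar_map P (?c s) - polar_map P z) 0 = winding_number (\<lambda>s. ?c s - z) 0" by simp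
  also have "\<dots> = winding_number ?c z" by (rule winding_number_offset[symmetric])
  also have "\<dots> = 1" using r by (rule winding_number_circlepath_centre)
  finally show "winding_number (polar_map P \<circ> ?c) (polar_map P z) = 1"
    by (subst winding_number_offset) (simp add: o_def)
qed

section \<open>Weak partial derivatives across a puncture\<close>

text \<open>By Fubini it is enough to treat almost every line. The line through the origin may be
  left out, and integrability along a line is offered as a premise because it holds on almost all of
  them.\<close>

lemma
  fixes f :: "complex \<Rightarrow> complex"
  assumes "integrable lborel f"
  shows integral_complex_zero_horizontal:
      "(\<And>y. y \<noteq> 0 \<Longrightarrow> integrable lborel (\<lambda>x. f (Complex x y)) \<Longrightarrow> (LINT x|lborel. f (Complex x y)) = 0)
        \<Longrightarrow> (LINT z|lborel. f z) = 0"
    and integral_complex_zero_vertical: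
      "(\<And>x. x \<noteq> 0 \<Longrightarrow> integrable lborel (\<lambda>y. f (Complex x y)) \<Longrightarrow> (LINT y|lborel. f (Complex x y)) = 0)
        \<Longrightarrow> (LINT z|lborel. f z) = 0"
proof -
  have [measurable]: "f \<in> borel_measurable borel" using assms by auto
  have int: "integrable (lborel \<Otimes>\<^sub>M lborel) (\<lambda>(x, y). f (Complex x y))"
    using assms by (subst (asm) lborel_complex_eq, subst (asm) integrable_distr_eq) (auto simp: case_prod_beta')
  have eq: "(LINT z|lborel. f z) = integral\<^sup>L (lborel \<Otimes>\<^sub>M lborel) (\<lambda>(x, y). f (Complex x y))"
    by (subst lborel_complex_eq, subst integral_distr) (auto simp: case_prod_beta')
  have ne: "AE y in lborel. y \<noteq> (0::real)" by (rule AE_lborel_singleton)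
  {
    assume z: "\<And>y. y \<noteq> 0 \<Longrightarrow> integrable lborel (\<lambda>x. f (Complex x y)) \<Longrightarrow> (LINT x|lborel. f (Complex x y)) = 0"
    have "AE y in lborel. (LINT x|lborel. f (Complex x y)) = 0"
      using lborel_pair.AE_integrable_snd[OF int] ne by eventually_elim (rule z)
    then have "(LINT y|lborel. LINT x|lborel. f (Complex x y)) = 0" by (rule integral_eq_zero_AE)
    then show "(LINT z|lborel. f z) = 0" unfolding eq lborel_pair.integral_snd[OF int] .
  next
    assume z: "\<And>x. x \<noteq> 0 \<Longrightarrow> integrable lborel (\<lambda>y. f (Complex x y)) \<Longrightarrow> (LINT y|lborel. f (Complex x y)) = 0"
    have "AE x in lborel. (LINT y|lborel. f (Complex x y)) = 0"
      using lborel_pair.AE_integrable_fst[OF int] ne by eventually_elim (rule z)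
    then have "(LINT x|lborel. LINT y|lborel. f (Complex x y)) = 0" by (rule integral_eq_zero_AE)
    then show "(LINT z|lborel. f z) = 0" unfolding eq lborel_pair.integral_fst[OF int] .
  }
qed

text \<open>The derivative is not assumed continuous, so the fundamental theorem is taken for the
  gauge integral, which agrees with the Lebesgue integral of the integrable function
  \<open>f\<close>.\<close>

lemma integral_derivative_eq_0:
  fixes F f :: "real \<Rightarrow> complex"
  assumes der: "\<And>x. (F has_vector_derivative f x) (at x)"
    and out: "\<And>x. \<bar>x\<bar> \<ge> 1 \<Longrightarrow> F x = 0 \<and> f x = 0"
    and int: "integrable lborel f"
  shows "(LINT x|lborel. f x) = 0"
proof -
  have "(f has_integral (F 1 - F (-1))) {-1..1}"
    by (rule fundamental_theorem_of_calculus) (auto intro: has_vector_derivative_at_within der)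
  then have "(f has_integral 0) {-1..1}" using out[of 1] out[of "-1"] by simp
  then have "(f has_integral 0) UNIV"
    by (rule has_integral_on_superset) (use out in \<open>auto simp: abs_le_iff not_le\<close>)
  moreover have "(f has_integral (LINT x|lborel. f x)) UNIV" by (rule has_integral_integral_lborel[OF int])
  ultimately show ?thesis by (rule has_integral_unique[symmetric])
qed

text \<open>A derivative given only pointwise is still measurable, being the limit of difference
  quotients with steps 1 / (n + 1).\<close>

lemma derivative_limit_measurable:
  fixes H g :: "complex \<Rightarrow> complex"
  assumes hm [measurable]: "H \<in> borel_measurable borel" and [measurable]: "A \<in> sets borel"
    and der: "\<And>z. z \<in> A \<Longrightarrow> ((\<lambda>t. H (z + of_real t * c)) has_vector_derivative g z) (at 0)"
    and out: "\<And>z. z \<notin> A \<Longrightarrow> g z = 0"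
  shows "g \<in> borel_measurable borel"
proof (rule borel_measurable_LIMSEQ_metric)
  let ?q = "\<lambda>n z. indicator A z *\<^sub>R (real (Suc n) *\<^sub>R (H (z + of_real (1 / real (Suc n)) * c) - H z))"
  show "?q n \<in> borel_measurable borel" for n by measurable
  fix z
  show "(\<lambda>n. ?q n z) \<longlonglongrightarrow> g z"
  proof (cases "z \<in> A")
    case True
    have a: "(\<lambda>t. norm (H (z + of_real (0 + t) * c) - H (z + of_real 0 * c) - t *\<^sub>R g z) / norm t) \<midarrow>0\<rightarrow> 0"
      using der[OF True] unfolding has_vector_derivative_def has_derivative_at by blast
    have b: "norm (H (z + of_real (0 + t) * c) - H (z + of_real 0 * c) - t *\<^sub>R g z) / norm t
        = norm ((1 / t) *\<^sub>R (H (z + of_real t * c) - H z) - g z)" if "t \<noteq> 0" for t :: real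
    proof -
      have "(1 / t) *\<^sub>R (H (z + of_real t * c) - H z) - g z = (1 / t) *\<^sub>R (H (z + of_real t * c) - H z - t *\<^sub>R g z)"
        using that by (simp add: scaleR_diff_right)
      then show ?thesis by (simp add: divide_inverse mult.commute)
    qed
    have "(\<lambda>t. norm ((1 / t) *\<^sub>R (H (z + of_real t * c) - H z) - g z)) \<midarrow>0\<rightarrow> 0"
      using a by (rule Lim_transform_eventually) (use b in \<open>simp add: eventually_at_filter\<close>)
    then have lim: "(\<lambda>t. (1 / t) *\<^sub>R (H (z + of_real t * c) - H z)) \<midarrow>0\<rightarrow> g z"
      by (simp add: tendsto_norm_zero_iff LIM_zero_iff)
    have "(\<lambda>n. 1 / real (Suc n)) \<longlonglongrightarrow> 0" using LIMSEQ_inverse_real_of_nat by (simp add: inverse_eq_divide)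
    then have "filterlim (\<lambda>n. 1 / real (Suc n)) (at 0) sequentially"
      by (simp add: filterlim_at del: of_nat_Suc)
    from filterlim_compose[OF lim this]
    show ?thesis using True by simp
  qed (simp add: out)
qed

text \<open>The puncture meets only one horizontal and one vertical line, so integration by parts on all other
  lines identifies the weak partial derivatives.\<close>

lemma finite_sobolev_energy_punctured:
  fixes H :: "complex \<Rightarrow> complex" and D :: "complex \<Rightarrow> complex \<Rightarrow> complex" and B :: "complex \<Rightarrow> real"
  defines "A \<equiv> ball 0 1 - {0}"
  assumes Hc: "continuous_on (cball 0 1) H"
    and Hd: "\<And>z. z \<in> A \<Longrightarrow> (H has_derivative D z) (at z)"
    and Bd: "\<And>z v. z \<in> A \<Longrightarrow> cmod (D z v) \<le> B z * cmod v"
    and B1: "\<And>z. z \<in> A \<Longrightarrow> 1 \<le> B z"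
    and Bfin: "(\<integral>\<^sup>+z. indicator A z * ennreal ((B z)\<^sup>2) \<partial>lborel) < \<infinity>"
  shows "finite_sobolev_energy H"
proof -
  have Ao: "open A" unfolding A_def by (intro open_Diff) auto
  have Am[measurable]: "A \<in> sets borel" using Ao by simp
  define g where "g c z = (if z \<in> A then D z c else 0)" for c z
  define hb where "hb z = indicator (cball 0 1) z *\<^sub>R H z" for z
  have hbm[measurable]: "hb \<in> borel_measurable borel"
    unfolding hb_def by (rule borel_measurable_continuous_on_indicator) (auto intro: Hc)
  have dir: "((\<lambda>t. G (z + of_real t * c)) has_vector_derivative D z c) (at 0)"
    if "(G has_derivative D z) (at z)" for G z c
  proof -
    have "(G has_derivative D z) (at (z + of_real 0 * c))" using that by simp
    moreover have "((\<lambda>t. z + of_real t * c) has_derivative (\<lambda>t. of_real t * c)) (at (0::real))"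
      by (auto intro!: derivative_eq_intros)
    ultimately have "((\<lambda>t. G (z + of_real t * c)) has_derivative (\<lambda>t. D z (of_real t * c))) (at 0)"
      by (rule has_derivative_compose[rotated])
    moreover have "D z (of_real t * c) = t *\<^sub>R D z c" for t
      using linear_scale[OF has_derivative_linear[OF that], of t c] by (simp add: scaleR_conv_of_real)
    ultimately show ?thesis by (simp add: has_vector_derivative_def)
  qed
  have gm[measurable]: "g c \<in> borel_measurable borel" for c
  proof (rule derivative_limit_measurable[OF hbm Am, of c])
    fix z assume z: "z \<in> A"
    have "(hb has_derivative D z) (at z)"
      by (rule has_derivative_transform_within_open[OF Hd[OF z], of "ball 0 1"]) (use z in \<open>auto simp: hb_def A_def\<close>)
    from dir[OF this] show "((\<lambda>t. hb (z + of_real t * c)) has_vector_derivative g c z) (at 0)"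
      using z by (simp add: g_def)
  qed (simp add: g_def)
  \<comment> \<open>As B is at least 1 it is dominated by its square, so the energy bound also
    yields integrability of the derivative.\<close>
  have gint: "integrable lborel (g c)" if "cmod c = 1" for c
  proof (rule integrableI_bounded)
    have "(\<integral>\<^sup>+z. ennreal (norm (g c z)) \<partial>lborel) \<le> (\<integral>\<^sup>+z. indicator A z * ennreal ((B z)\<^sup>2) \<partial>lborel)"
    proof (rule nn_integral_mono)
      fix z
      show "ennreal (norm (g c z)) \<le> indicator A z * ennreal ((B z)\<^sup>2)"
      proof (cases "z \<in> A")
        case True
        have "cmod (g c z) \<le> B z" using Bd[OF True, of c] that True by (simp add: g_def)
        also have "\<dots> \<le> (B z)\<^sup>2" using B1[OF True] by (simp add: power2_eq_square)
        finally show ?thesis using True by (simp add: ennreal_leI)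
      qed (simp add: g_def)
    qed
    also note Bfin
    finally show "(\<integral>\<^sup>+z. ennreal (norm (g c z)) \<partial>lborel) < \<infinity>" .
  qed simp
  have ibp: "(LINT z|lborel. of_real (pc z) * H z) = - (LINT z|lborel. of_real (\<psi> z) * g c z)"
    if test: "test_function (ball 0 1) \<psi>" and c: "c = 1 \<or> c = \<i>" and psic: "continuous_on UNIV \<psi>" "continuous_on UNIV pc"
      and pd: "\<And>z. ((\<lambda>t. \<psi> (z + of_real t * c)) has_real_derivative pc z) (at 0)" for \<psi> pc c
  proof -
    define K where "K = closure {z. \<psi> z \<noteq> 0}"
    have K: "compact K" "K \<subseteq> ball 0 1" using test by (auto simp: test_function_def K_def)
    have out\<psi>: "\<psi> z = 0" if "z \<notin> K" for z using that closure_subset[of "{z. \<psi> z \<noteq> 0}"] by (auto simp: K_def)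
    have near0: "open {t::real. z + of_real t * c \<in> - K}" for z
      using K(1) by (intro open_vimage[of "- K" "\<lambda>t. z + of_real t * c", unfolded vimage_def] continuous_intros open_Compl compact_imp_closed)
    have outp: "pc z = 0" if "z \<notin> K" for z
    proof -
      have "((\<lambda>t. 0) has_real_derivative 0) (at 0)" by simp
      then have "((\<lambda>t. \<psi> (z + of_real t * c)) has_real_derivative 0) (at 0)"
        by (rule has_field_derivative_transform_within_open[OF _ near0[of z]]) (use that out\<psi> in auto)
      with pd[of z] show ?thesis by (rule DERIV_unique)
    qed
    \<comment> \<open>This is the derivative of the product \<psi> H in the direction c; its
      integral is the defect in the integration by parts.\<close>
    define f where "f z = of_real (pc z) * H z + of_real (\<psi> z) * g c z" for z
    have [measurable]: "\<psi> \<in> borel_measurable borel" using psic(1) by (rule borel_measurable_continuous_onI)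
    have "integrable lborel (\<lambda>z. indicator K z *\<^sub>R (of_real (pc z) * H z))"
      using K by (intro borel_integrable_compact continuous_intros continuous_on_subset[OF Hc] continuous_on_subset[OF psic(2)]) auto
    moreover have "(\<lambda>z. indicator K z *\<^sub>R (of_real (pc z) * H z)) = (\<lambda>z. of_real (pc z) * H z)"
      using outp by (auto simp: indicator_def fun_eq_iff)
    ultimately have i1: "integrable lborel (\<lambda>z. of_real (pc z) * H z)" by simp
    obtain M where M: "\<And>z. z \<in> K \<Longrightarrow> norm (\<psi> z) \<le> M"
      by (rule continuous_on_compact_bound[OF K(1) continuous_on_subset[OF psic(1) subset_UNIV]], rule that)
    have M': "\<bar>\<psi> z\<bar> \<le> max M 0" for z using M[of z] out\<psi>[of z] by (cases "z \<in> K") auto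
    have gi: "integrable lborel (g c)" using c by (intro gint) auto
    have i2: "integrable lborel (\<lambda>z. of_real (\<psi> z) * g c z)"
    proof (rule Bochner_Integration.integrable_bound[of _ "\<lambda>z. max M 0 *\<^sub>R g c z"])
      show "integrable lborel (\<lambda>z. max M 0 *\<^sub>R g c z)" using gi by simp
      show "AE z in lborel. norm (of_real (\<psi> z) * g c z) \<le> norm (max M 0 *\<^sub>R g c z)"
        using M' by (intro AE_I2) (simp add: norm_mult mult_right_mono)
    qed measurable
    have fi: "integrable lborel f" unfolding f_def using i1 i2 by (rule Bochner_Integration.integrable_add)
    \<comment> \<open>Inside \<open>K\<close> this is the product rule. Outside \<open>K\<close> the
      product vanishes near the point, so the differential of \<open>H\<close> is not consulted
      there.\<close>
    have line: "((\<lambda>t. of_real (\<psi> (z + of_real t * c)) * H (z + of_real t * c)) has_vector_derivative f z) (at 0)"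
      if z0: "z \<noteq> 0" for z
    proof (cases "z \<in> K")
      case True
      then have zA: "z \<in> A" using z0 K by (auto simp: A_def)
      have "((\<lambda>t. of_real (\<psi> (z + of_real t * c))) has_vector_derivative of_real (pc z)) (at 0)"
        using pd[of z] by (intro has_vector_derivative_of_real) (simp add: has_real_derivative_iff_has_vector_derivative)
      from has_vector_derivative_mult[OF this dir[OF Hd[OF zA], of c]]
      show ?thesis using zA by (simp add: f_def g_def add.commute)
    next
      case False
      have "((\<lambda>t. 0) has_vector_derivative 0) (at (0::real))" by simp
      then have "((\<lambda>t. of_real (\<psi> (z + of_real t * c)) * H (z + of_real t * c)) has_vector_derivative 0) (at 0)"
        by (rule has_vector_derivative_transform_within_open[OF _ near0[of z]]) (use False out\<psi> in auto)
      then show ?thesis using False outp out\<psi> by (simp add: f_def)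
    qed
    have fout: "of_real (\<psi> z) * H z = 0 \<and> f z = 0" if "cmod z \<ge> 1" for z
    proof -
      have "z \<notin> K" using that K(2) by auto
      then show ?thesis using outp out\<psi> by (simp add: f_def)
    qed
    have shift: "((\<lambda>s. G (s - x)) has_vector_derivative d) (at x)"
      if "(G has_vector_derivative d) (at 0)" for G :: "real \<Rightarrow> complex" and d x
    proof -
      have "((\<lambda>s. s - x) has_vector_derivative 1) (at x)" by (auto intro!: derivative_eq_intros)
      from vector_diff_chain_at[OF this, of G d] that show ?thesis by (simp add: o_def)
    qed
    have "(LINT z|lborel. f z) = 0"
    proof (cases "c = 1")
      case True
      show ?thesis
      proof (rule integral_complex_zero_horizontal[OF fi])
        fix y :: real assume y: "y \<noteq> 0" and i: "integrable lborel (\<lambda>x. f (Complex x y))"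
        show "(LINT x|lborel. f (Complex x y)) = 0"
        proof (rule integral_derivative_eq_0[OF _ _ i, of "\<lambda>x. of_real (\<psi> (Complex x y)) * H (Complex x y)"])
          fix x :: real
          have e: "Complex x y + of_real (s - x) * c = Complex s y" for s by (simp add: True complex_eq_iff)
          have "Complex x y \<noteq> 0" using y by (simp add: complex_eq_iff)
          from shift[OF line[OF this], of x]
          show "((\<lambda>x. of_real (\<psi> (Complex x y)) * H (Complex x y)) has_vector_derivative f (Complex x y)) (at x)"
            unfolding e .
          show "of_real (\<psi> (Complex x y)) * H (Complex x y) = 0 \<and> f (Complex x y) = 0" if "\<bar>x\<bar> \<ge> 1"
            by (rule fout) (use that abs_Re_le_cmod[of "Complex x y"] in simp)
        qed
      qed
    next
      case False
      then have ci: "c = \<i>" using c by simp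
      show ?thesis
      proof (rule integral_complex_zero_vertical[OF fi])
        fix x :: real assume x: "x \<noteq> 0" and i: "integrable lborel (\<lambda>y. f (Complex x y))"
        show "(LINT y|lborel. f (Complex x y)) = 0"
        proof (rule integral_derivative_eq_0[OF _ _ i, of "\<lambda>y. of_real (\<psi> (Complex x y)) * H (Complex x y)"])
          fix y :: real
          have e: "Complex x y + of_real (s - y) * c = Complex x s" for s by (simp add: ci complex_eq_iff)
          have "Complex x y \<noteq> 0" using x by (simp add: complex_eq_iff)
          from shift[OF line[OF this], of y]
          show "((\<lambda>y. of_real (\<psi> (Complex x y)) * H (Complex x y)) has_vector_derivative f (Complex x y)) (at y)"
            unfolding e .
          show "of_real (\<psi> (Complex x y)) * H (Complex x y) = 0 \<and> f (Complex x y) = 0" if "\<bar>y\<bar> \<ge> 1"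
            by (rule fout) (use that abs_Im_le_cmod[of "Complex x y"] in simp)
        qed
      qed
    qed
    then show ?thesis using i1 i2 by (simp add: f_def eq_neg_iff_add_eq_0)
  qed
  have "weak_partials H (ball 0 1) (g 1) (g \<i>)"
    unfolding weak_partials_def
  proof (intro conjI allI impI)
    show "locally_integrable_on (ball 0 1) H"
      unfolding locally_integrable_on_def set_integrable_def
      by (intro allI impI borel_integrable_compact continuous_on_subset[OF Hc]) auto
    show "locally_integrable_on (ball 0 1) (g 1)" "locally_integrable_on (ball 0 1) (g \<i>)"
      unfolding locally_integrable_on_def set_integrable_def
      by (intro allI impI integrable_mult_indicator gint; auto intro: borel_compact)+
    fix \<psi> assume test: "test_function (ball 0 1) \<psi>"
    then obtain E :: "bool list \<Rightarrow> complex \<Rightarrow> real" where E: "E [] = \<psi>" "\<And>ds. continuous_on UNIV (E ds)"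
        "\<And>ds z. ((\<lambda>t. E ds (z + of_real t)) has_real_derivative E (True # ds) z) (at 0)"
        "\<And>ds z. ((\<lambda>t. E ds (z + \<i> * of_real t)) has_real_derivative E (False # ds) z) (at 0)"
      unfolding test_function_def smooth_fun_def by blast
    have "dx \<psi> = E [True]" "dy \<psi> = E [False]"
      unfolding dx_def dy_def fun_eq_iff using E(3,4)[of "[]"] by (auto simp: E(1) intro: DERIV_imp_deriv)
    then show "(LINT z|lborel. of_real (dx \<psi> z) * H z) = - (LINT z|lborel. of_real (\<psi> z) * g 1 z)"
      "(LINT z|lborel. of_real (dy \<psi> z) * H z) = - (LINT z|lborel. of_real (\<psi> z) * g \<i> z)"
      using ibp[OF test, of 1 "E [True]"] ibp[OF test, of \<i> "E [False]"] E(2)[of "[]"] E(2)[of "[True]"] E(2)[of "[False]"]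
        E(3,4)[of "[]"] by (simp_all add: E(1) mult.commute[of \<i>])
  qed
  moreover have "(\<integral>\<^sup>+ z. indicator (ball 0 1) z * ennreal ((onorm (\<lambda>v. Re v *\<^sub>R g 1 z + Im v *\<^sub>R g \<i> z))\<^sup>2) \<partial>lborel)
     \<le> (\<integral>\<^sup>+z. indicator A z * ennreal ((B z)\<^sup>2) \<partial>lborel)"
  proof (rule nn_integral_mono_AE)
    have "AE z in lborel. z \<noteq> (0::complex)" by (rule AE_lborel_singleton)
    then show "AE z in lborel. indicator (ball 0 1) z * ennreal ((onorm (\<lambda>v. Re v *\<^sub>R g 1 z + Im v *\<^sub>R g \<i> z))\<^sup>2)
        \<le> indicator A z * ennreal ((B z)\<^sup>2)"
    proof eventually_elim
      case (elim z)
      show ?case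
      proof (cases "z \<in> ball 0 1")
        case True
        then have z: "z \<in> A" using elim by (simp add: A_def)
        have lin: "linear (D z)" by (rule has_derivative_linear[OF Hd[OF z]])
        have "(\<lambda>v. Re v *\<^sub>R g 1 z + Im v *\<^sub>R g \<i> z) = D z"
        proof
          fix v
          have "D z v = D z (Re v *\<^sub>R 1 + Im v *\<^sub>R \<i>)" by (rule arg_cong[where f="D z"]) (simp add: complex_eq_iff)
          also have "\<dots> = Re v *\<^sub>R D z 1 + Im v *\<^sub>R D z \<i>"
            by (simp only: linear_add[OF lin] linear_scale[OF lin])
          finally show "Re v *\<^sub>R g 1 z + Im v *\<^sub>R g \<i> z = D z v" using z by (simp add: g_def)
        qed
        moreover have "onorm (D z) \<le> B z" "0 \<le> onorm (D z)"
          using B1[OF z] by (auto intro!: onorm_bound Bd[OF z] onorm_pos_le has_derivative_bounded_linear[OF Hd[OF z]])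
        ultimately show ?thesis using True z by (simp add: ennreal_leI power_mono)
      qed simp
    qed
  qed
  ultimately show ?thesis
    unfolding finite_sobolev_energy_def using Bfin order.strict_trans1 by blast
qed

section \<open>The extension\<close>

text \<open>In polar coordinates the weight r <= 1 is dropped and d = 1 - r is the variable. For
  small d the increment of \<Phi> is comparable to the chord between the image points, so the slope
  is controlled by the Douglas kernel at t - d and t + d. For the other d the slope is
  bounded.\<close>

lemma mean_slope_energy_finite:
  assumes lift: "lift_map \<Phi>" and fin: "douglas_energy (\<lambda>s. cis (\<Phi> s)) < \<infinity>"
  shows "(\<integral>\<^sup>+z. indicator (ball 0 1 - {0}) z * ennreal ((3 + 2 * mean_slope \<Phi> (Arg z) (cmod z))\<^sup>2) \<partial>lborel) < \<infinity>"
proof -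
  let ?A = "ball 0 1 - {0 :: complex}"
  let ?k = "\<lambda>t d. douglas_kernel (\<lambda>s. cis (\<Phi> s)) (t - d) (t + d)"
  note Phi = lift_cont[OF lift] lift_le_iff[OF lift] lift_per[OF lift]
  have pm[measurable]: "(\<lambda>s. cis (\<Phi> s)) \<in> borel_measurable borel"
    by (intro borel_measurable_continuous_onI continuous_intros Phi)
  have [measurable]: "\<Phi> \<in> borel_measurable borel" by (intro borel_measurable_continuous_onI Phi)
  have pper: "cis (\<Phi> (x + 2*pi)) = cis (\<Phi> x)" for x by (simp add: Phi)
  have "continuous_on {z. z \<noteq> 0 \<and> cmod z \<in> {..<1}} (\<lambda>z. mean_slope \<Phi> (Arg z) (cmod z))"
  proof (rule periodic_polar_continuous_on)
    show "continuous_on (UNIV \<times> {..<1}) (\<lambda>p. mean_slope \<Phi> (fst p) (snd p))"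
      unfolding mean_slope_def
      by (intro continuous_intros continuous_on_compose2[OF Phi(1)]) auto
  qed (simp add: mean_slope_period[OF lift])
  moreover have "{z. z \<noteq> 0 \<and> cmod z \<in> {..<1}} = ?A" by auto
  ultimately have c: "continuous_on ?A (\<lambda>z. 3 + 2 * mean_slope \<Phi> (Arg z) (cmod z))"
    by (auto intro!: continuous_intros)
  have Aop: "open ?A" by (intro open_Diff) auto
  have [measurable]: "(\<lambda>z. indicator ?A z *\<^sub>R (3 + 2 * mean_slope \<Phi> (Arg z) (cmod z))) \<in> borel_measurable borel"
    using Aop by (intro borel_measurable_continuous_on_indicator c) simp
  have Feq: "indicator ?A z * ennreal ((3 + 2 * mean_slope \<Phi> (Arg z) (cmod z))\<^sup>2)
      = ennreal ((indicator ?A z *\<^sub>R (3 + 2 * mean_slope \<Phi> (Arg z) (cmod z)))\<^sup>2)" for z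
    by (auto simp: indicator_def)
  have polar: "indicator {0<..} r * (ennreal r * (indicator ?A (of_real r * cis t) * ennreal ((3 + 2 * mean_slope \<Phi> (Arg (of_real r * cis t)) (cmod (of_real r * cis t)))\<^sup>2)))
      \<le> indicator {0<..<1} r * ennreal ((3 + 2 * mean_slope \<Phi> t r)\<^sup>2)" for r t :: real
  proof (cases "0 < r \<and> r < 1")
    case True
    then have "mean_slope \<Phi> (Arg (of_real r * cis t)) r = mean_slope \<Phi> t r"
      by (intro periodic_polar_eq[of _ t "\<lambda>x. mean_slope \<Phi> x r"]) (auto simp: norm_mult mean_slope_period[OF lift])
    moreover have "ennreal r * x \<le> 1 * x" for x using True by (intro mult_right_mono) auto
    ultimately show ?thesis using True by (simp add: norm_mult)
  next
    case False
    then show ?thesis by (auto simp: indicator_def norm_mult)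
  qed
  have "(\<integral>\<^sup>+z. indicator ?A z * ennreal ((3 + 2 * mean_slope \<Phi> (Arg z) (cmod z))\<^sup>2) \<partial>lborel)
    = nnint {0..2*pi} (\<lambda>t. nnint {0<..} (\<lambda>r. ennreal r * (indicator ?A (of_real r * cis t) *
        ennreal ((3 + 2 * mean_slope \<Phi> (Arg (of_real r * cis t)) (cmod (of_real r * cis t)))\<^sup>2))))"
    by (rule nn_integral_polar) (unfold Feq, measurable)
  also have "\<dots> \<le> nnint {0..2*pi} (\<lambda>t. nnint {0<..<1} (\<lambda>r. ennreal ((3 + 2 * mean_slope \<Phi> t r)\<^sup>2)))"
    by (rule nn_integral_mono, rule mult_left_mono, rule nn_integral_mono, rule polar) auto
  also have "\<dots> = nnint {0..2*pi} (\<lambda>t. nnint {0<..<1} (\<lambda>d. ennreal ((3 + 2 * mean_slope \<Phi> t (1 - d))\<^sup>2)))"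
  proof -
    have [measurable]: "(\<lambda>r. mean_slope \<Phi> t r) \<in> borel_measurable borel" for t unfolding mean_slope_def by measurable
    have "nnint {0<..<1} (\<lambda>r. ennreal ((3 + 2 * mean_slope \<Phi> t r)\<^sup>2))
      = nnint {0<..<1} (\<lambda>d. ennreal ((3 + 2 * mean_slope \<Phi> t (1 - d))\<^sup>2))" for t
      by (subst nn_integral_real_affine[of "\<lambda>r. indicator {0<..<1} r * ennreal ((3 + 2 * mean_slope \<Phi> t r)\<^sup>2)" "-1" 1])
         (auto simp: indicator_def intro!: nn_integral_cong)
    then show ?thesis by simp
  qed
  also have "\<dots> < \<infinity>"
  proof -
    \<comment> \<open>The interval contains t - d and t + d for all t in [0, 2 pi] and d in (0, 1).
      Increments of \<Phi> below 2 are those for which the chord is at least half the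
      increment.\<close>
    have uc: "uniformly_continuous_on {-1..2*pi+1} \<Phi>"
      by (intro compact_uniformly_continuous continuous_on_subset[OF Phi(1)]) auto
    obtain e where e: "e > 0" "\<And>x y. x \<in> {-1..2*pi+1} \<Longrightarrow> y \<in> {-1..2*pi+1} \<Longrightarrow> dist y x < e \<Longrightarrow> dist (\<Phi> y) (\<Phi> x) < 2"
      by (rule uniformly_continuous_onE[OF uc, of 2], simp, rule that)
    define C where "C = 18 + 8 * (2 * pi / e)\<^sup>2"
    have C0: "C \<ge> 0" by (simp add: C_def)
    have pt: "ennreal ((3 + 2 * mean_slope \<Phi> t (1 - d))\<^sup>2) \<le> ennreal C + 32 * ?k t d"
      if t: "t \<in> {0..2*pi}" and d: "d \<in> {0<..<1}" for t d
    proof -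
      define u where "u = mean_slope \<Phi> t (1 - d)"
      have u: "u = (\<Phi> (t + d) - \<Phi> (t - d)) / (2 * d)" by (simp add: u_def mean_slope_def)
      have u0: "u \<ge> 0" unfolding u using d by (intro divide_nonneg_pos) (auto simp: Phi)
      \<comment> \<open>Expanding this square yields 12 u <= 9 + 4 u^2, whence the numbers 18 and
        8.\<close>
      have "0 \<le> (2 * u - 3)\<^sup>2" by simp
      then have sq: "(3 + 2 * u)\<^sup>2 \<le> 18 + 8 * u\<^sup>2" by (simp add: power2_eq_square algebra_simps)
      show ?thesis
      proof (cases "2 * d < e")
        case True
        let ?q = "cmod ((cis (\<Phi> (t - d)) - cis (\<Phi> (t + d))) / (cis (t - d) - cis (t + d)))"
        have "dist (\<Phi> (t + d)) (\<Phi> (t - d)) < 2"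
          using t d True by (intro e(2)) (auto simp: dist_real_def)
        then have "\<bar>\<Phi> (t - d) - \<Phi> (t + d)\<bar> \<le> 2" by (simp add: dist_real_def abs_minus_commute)
        moreover have "\<Phi> (t - d) \<le> \<Phi> (t + d)" using d by (simp add: Phi)
        ultimately have n: "(\<Phi> (t + d) - \<Phi> (t - d)) / 2 \<le> cmod (cis (\<Phi> (t - d)) - cis (\<Phi> (t + d)))"
          using cmod_cis_diff_ge[of "\<Phi> (t - d)" "\<Phi> (t + d)"] by simp
        have m: "cmod (cis (t - d) - cis (t + d)) \<le> 2 * d"
          using cmod_cis_diff_le[of "t - d" "t + d"] d by simp
        have m0: "0 < cmod (cis (t - d) - cis (t + d))"
          using cmod_cis_diff_ge[of "t - d" "t + d"] d by auto
        have "u / 2 = ((\<Phi> (t + d) - \<Phi> (t - d)) / 2) / (2 * d)" by (simp add: u)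
        also have "\<dots> \<le> ?q" unfolding norm_divide
          using n m m0 d by (intro frac_le) auto
        finally have "(u / 2)\<^sup>2 \<le> ?q\<^sup>2" using u0 by (intro power_mono) auto
        then have "8 * u\<^sup>2 \<le> 32 * ?q\<^sup>2" by (simp add: power_divide)
        then have "(3 + 2 * u)\<^sup>2 \<le> C + 32 * ?q\<^sup>2" using sq zero_le_power2[of "2 * pi / e"] unfolding C_def by linarith
        then have "ennreal ((3 + 2 * u)\<^sup>2) \<le> ennreal (C + 32 * ?q\<^sup>2)" by (rule ennreal_leI)
        also have "\<dots> = ennreal C + 32 * ennreal (?q\<^sup>2)" using C0 by (simp add: ennreal_mult)
        finally show ?thesis by (simp add: u_def douglas_kernel_def)
      next
        case False
        \<comment> \<open>The two points lie within one period, so \<Phi> grows by at most 2 pi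
          between them, while 2 d is at least e.\<close>
        have "t + d \<le> (t - d) + 2*pi" using d pi_gt3 by auto
        then have "\<Phi> (t + d) \<le> \<Phi> ((t - d) + 2*pi)" by (simp only: Phi(2))
        then have "\<Phi> (t + d) - \<Phi> (t - d) \<le> 2*pi" by (simp add: Phi)
        then have "u \<le> 2 * pi / e" unfolding u using False e(1) d by (intro frac_le) (auto simp: Phi)
        then have "u\<^sup>2 \<le> (2 * pi / e)\<^sup>2" using u0 by (intro power_mono)
        then have "(3 + 2 * u)\<^sup>2 \<le> C" using sq by (simp add: C_def)
        then have "ennreal ((3 + 2 * u)\<^sup>2) \<le> ennreal C" by (rule ennreal_leI)
        then show ?thesis unfolding u_def by (rule order_trans) simp
      qed
    qed
    have "(nnint {0..2*pi} (\<lambda>t. nnint {0<..<1} (\<lambda>d. ennreal ((3 + 2 * mean_slope \<Phi> t (1 - d))\<^sup>2))))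
      \<le> nnint {0..2*pi} (\<lambda>t. (\<integral>\<^sup>+d. ennreal C * indicator {0<..<1} d + 32 * (indicator {0<..<1} d * ?k t d) \<partial>lborel))"
    proof (rule nn_integral_mono)
      fix t :: real
      show "indicator {0..2*pi} t * (nnint {0<..<1} (\<lambda>d. ennreal ((3 + 2 * mean_slope \<Phi> t (1 - d))\<^sup>2)))
        \<le> indicator {0..2*pi} t * (\<integral>\<^sup>+d. ennreal C * indicator {0<..<1} d + 32 * (indicator {0<..<1} d * ?k t d) \<partial>lborel)"
      proof (cases "t \<in> {0..2*pi}")
        case True
        have "indicator {0<..<1} d * ennreal ((3 + 2 * mean_slope \<Phi> t (1 - d))\<^sup>2)
          \<le> ennreal C * indicator {0<..<1} d + 32 * (indicator {0<..<1} d * ?k t d)" for d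
          using pt[OF True, of d] by (cases "d \<in> {0<..<1}") auto
        then show ?thesis by (intro mult_left_mono nn_integral_mono) auto
      qed simp
    qed
    also have "\<dots> = (\<integral>\<^sup>+t. ennreal C * indicator {0..2*pi} t + 32 * (indicator {0..2*pi} t * (nnint {0<..<1} (\<lambda>d. ?k t d))) \<partial>lborel)"
    proof (rule nn_integral_cong)
      fix t :: real
      have "(\<integral>\<^sup>+d. ennreal C * indicator {0<..<1} d + 32 * (indicator {0<..<1} d * ?k t d) \<partial>lborel)
         = (\<integral>\<^sup>+d. ennreal C * indicator {0<..<1} d \<partial>(lborel::real measure)) + (\<integral>\<^sup>+d. 32 * (indicator {0<..<1} d * ?k t d) \<partial>lborel)"
        by (rule nn_integral_add) measurable
      also have "\<dots> = ennreal C + 32 * (nnint {0<..<1} (\<lambda>d. ?k t d))"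
        by (simp add: nn_integral_cmult)
      finally show "indicator {0..2*pi} t * (\<integral>\<^sup>+d. ennreal C * indicator {0<..<1} d + 32 * (indicator {0<..<1} d * ?k t d) \<partial>lborel)
        = ennreal C * indicator {0..2*pi} t + 32 * (indicator {0..2*pi} t * (nnint {0<..<1} (\<lambda>d. ?k t d)))"
        by (cases "t \<in> {0..2*pi}") auto
    qed
    also have "\<dots> = (\<integral>\<^sup>+t. ennreal C * indicator {0..2*pi} t \<partial>(lborel::real measure)) + (\<integral>\<^sup>+t. 32 * (indicator {0..2*pi} t * (nnint {0<..<1} (\<lambda>d. ?k t d))) \<partial>lborel)"
      by (rule nn_integral_add) measurable
    also have "\<dots> = ennreal C * ennreal (2*pi) + 32 * (nnint {0..2*pi} (\<lambda>t. nnint {0<..<1} (\<lambda>d. ?k t d)))"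
      by (simp add: nn_integral_cmult)
    also have "\<dots> \<le> ennreal C * ennreal (2*pi) + 32 * douglas_energy (\<lambda>s. cis (\<Phi> s))"
      by (intro add_left_mono mult_left_mono nn_integral_douglas_kernel_centered_le pm pper) auto
    also have "\<dots> < \<infinity>" using fin by (simp add: ennreal_mult_less_top)
    finally show ?thesis .
  qed
  finally show ?thesis .
qed

lemma polar_shear_energy_finite:
  assumes lifts: "lift_map \<Phi>" "lift_map \<Psi>" and fin: "douglas_energy (\<lambda>s. cis (\<Phi> s)) < \<infinity>"
  shows "finite_sobolev_energy (polar_map (shear_map \<Phi> \<Psi>))"
proof -
  let ?H = "polar_map (shear_map \<Phi> \<Psi>)" and ?A = "ball 0 1 - {0 :: complex}"
  \<comment> \<open>This is 1 + |A| + |B| with both coefficients replaced by their bound 1 +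
    \<open>mean_slope\<close>.\<close>
  let ?B = "\<lambda>z. 3 + 2 * mean_slope \<Phi> (Arg z) (cmod z)"
  have "\<exists>D. (?H has_derivative D) (at z) \<and> (\<forall>v. cmod (D v) \<le> ?B z * cmod v)" if z: "z \<in> ?A" for z
  proof -
    have c: "z \<noteq> 0" "cmod z < 1" using z by auto
    obtain A B where AB: "((\<lambda>p. shear_map \<Phi> \<Psi> (fst p) (snd p)) has_derivative (\<lambda>v. fst v * A + snd v * B)) (at (Arg z, cmod z))"
      "\<bar>A\<bar> \<le> 1 + mean_slope \<Phi> (Arg z) (cmod z)" "\<bar>B\<bar> \<le> 1 + mean_slope \<Phi> (Arg z) (cmod z)"
      using shear_map_has_derivative[OF lifts c(2)] by blast
    obtain D where D: "(?H has_derivative D) (at z)" "\<And>v. cmod (D v) \<le> (1 + \<bar>A\<bar> + \<bar>B\<bar>) * cmod v"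
      using polar_map_has_derivative[where P="shear_map \<Phi> \<Psi>", OF shear_map_period[OF lifts] c AB(1)] by blast
    have "cmod (D v) \<le> ?B z * cmod v" for v
      by (rule order_trans[OF D(2)], rule mult_right_mono) (use AB(2,3) in auto)
    then show ?thesis using D(1) by blast
  qed
  then obtain D where D: "\<And>z. z \<in> ?A \<Longrightarrow> (?H has_derivative D z) (at z)"
      "\<And>z v. z \<in> ?A \<Longrightarrow> cmod (D z v) \<le> ?B z * cmod v" by metis
  show ?thesis
  proof (rule finite_sobolev_energy_punctured[OF _ D])
    show "continuous_on (cball 0 1) ?H"
      by (intro polar_map_continuous shear_map_period shear_map_continuous lifts)
    show "1 \<le> ?B z" if "z \<in> ?A" for z
      using mean_slope_nonneg[OF lifts(1), of "cmod z" "Arg z"] that by auto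
    show "(\<integral>\<^sup>+z. indicator ?A z * ennreal ((?B z)\<^sup>2) \<partial>lborel) < \<infinity>"
      by (rule mean_slope_energy_finite[OF lifts(1) fin])
  qed
qed

lemma polar_shear_inverse:
  assumes lifts: "lift_map \<Phi>" "lift_map \<Psi>" and z: "cmod z \<le> 1"
  shows "polar_map (shear_map \<Psi> \<Phi>) (polar_map (shear_map \<Phi> \<Psi>) z) = z"
proof -
  let ?w = "polar_map (shear_map \<Phi> \<Psi>) z"
  have "polar_map (shear_map \<Psi> \<Phi>) ?w = of_real (cmod ?w) * cis (shear_map \<Psi> \<Phi> (shear_map \<Phi> \<Psi> (Arg z) (cmod z)) (cmod ?w))"
    by (rule polar_map_eq[where P="shear_map \<Psi> \<Phi>", OF shear_map_period[OF lifts(2,1)]]) (use z in \<open>simp_all add: polar_map_def norm_mult\<close>)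
  also have "\<dots> = of_real (cmod z) * cis (Arg z)"
    using z by (simp add: shear_map_inverse[OF lifts])
  finally show ?thesis using rcis_cmod_Arg[of z] by (simp add: rcis_def)
qed

section \<open>From the circle to lifts on the line, and the equivalence itself\<close>

lemma circle_homeomorphism_lift:
  assumes hom: "homeomorphism (sphere 0 1) (sphere 0 1) \<phi> \<phi>'" and ori: "circle_orient_pres \<phi>"
  obtains \<Phi> \<Psi> where "lift_map \<Phi>" "lift_map \<Psi>" "\<And>x. \<phi> (cis x) = cis (\<Phi> x)" "\<And>x. \<phi>' (cis x) = cis (\<Psi> x)"
    "\<And>x. \<Psi> (\<Phi> x) = x" "\<And>x. \<Phi> (\<Psi> x) = x"
proof -
  have inS: "cis x \<in> sphere 0 1" for x by simp
  have phiS: "cmod (\<phi> (cis x)) = 1" for x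
    using hom inS[of x] unfolding homeomorphism_def by (metis imageI mem_sphere_0)
  have phic: "continuous_on UNIV (\<lambda>x. \<phi> (cis x))"
    by (intro continuous_on_compose2[OF homeomorphism_cont1[OF hom]] continuous_intros) auto
  \<comment> \<open>The line is contractible and \<phi> does not vanish on the circle, so a
    continuous logarithm exists; its imaginary part is the lift.\<close>
  obtain g where g: "continuous_on UNIV g" "\<And>x. \<phi> (cis x) = exp (g x)"
  proof (rule continuous_logarithm_on_contractible[OF phic])
    show "contractible (UNIV :: real set)" by (simp add: convex_imp_contractible)
    show "\<phi> (cis z) \<noteq> 0" for z using phiS[of z] by auto
  qed (use that in auto)
  define \<Phi> where "\<Phi> x = Im (g x)" for x
  have Re0: "Re (g x) = 0" for x using phiS[of x] g(2)[of x] by simp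
  have phi: "\<phi> (cis x) = cis (\<Phi> x)" for x
    using g(2)[of x] exp_eq_polar[of "g x"] Re0 by (simp add: \<Phi>_def)
  have Pc: "continuous_on UNIV \<Phi>" unfolding \<Phi>_def by (intro continuous_intros g)
  \<comment> \<open>The winding number of exp \<circ> p about 0 is the increment of p divided by 2
    pi i, so orientation fixes the increment of the lift over one period.\<close>
  have P2: "\<Phi> (2*pi) - \<Phi> 0 = 2*pi"
  proof -
    define p where "p t = g (2*pi*t)" for t :: real
    have "path p" unfolding path_def p_def by (intro continuous_on_compose2[OF g(1)] continuous_intros) auto
    then have "winding_number (exp \<circ> p) 0 = (pathfinish p - pathstart p) / (2 * of_real pi * \<i>)"
      by (rule winding_number_compose_exp)
    moreover have "exp \<circ> p = \<phi> \<circ> circlepath 0 1"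
      by (simp add: fun_eq_iff p_def g(2)[symmetric] circlepath cis_conv_exp mult_ac)
    ultimately have "(pathfinish p - pathstart p) / (2 * of_real pi * \<i>) = 1"
      using ori by (simp add: circle_orient_pres_def)
    then have "g (2*pi) - g 0 = 2 * of_real pi * \<i>"
      by (simp add: p_def pathfinish_def pathstart_def field_simps)
    then have "Im (g (2*pi) - g 0) = Im (2 * of_real pi * \<i>)" by (rule arg_cong)
    then show ?thesis by (simp add: \<Phi>_def)
  qed
  have per: "\<Phi> (x + 2*pi) = \<Phi> x + 2*pi" for x
  proof -
    \<comment> \<open>A continuous integer-valued function on the line is constant, which carries
      the increment from 0 to every x.\<close>
    define e where "e x = (\<Phi> (x + 2*pi) - \<Phi> x) / (2*pi)" for x
    have e_int: "\<exists>k::int. e x = of_int k" for x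
    proof -
      have "cis (\<Phi> (x + 2*pi)) = cis (\<Phi> x)" by (simp add: phi[symmetric])
      then obtain k :: int where "\<Phi> (x + 2*pi) = \<Phi> x + 2*pi * of_int k" by (rule cis_eq_cisE)
      then show ?thesis by (intro exI[of _ k]) (simp add: e_def)
    qed
    have "e constant_on UNIV"
    proof (rule continuous_discrete_range_constant)
      show "continuous_on UNIV e" unfolding e_def by (intro continuous_intros continuous_on_compose2[OF Pc]) auto
      fix x :: real
      have "1 \<le> norm (e y - e x)" if "e y \<noteq> e x" for y
      proof -
        obtain k l :: int where "e y = of_int k" "e x = of_int l" using e_int by metis
        then show ?thesis using that by (simp flip: of_int_diff)
      qed
      then show "\<exists>r>0. \<forall>y. y \<in> UNIV \<and> e y \<noteq> e x \<longrightarrow> r \<le> norm (e y - e x)" by (intro exI[of _ 1]) auto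
    qed simp
    then have "e x = e 0" unfolding constant_on_def by (metis UNIV_I)
    also have "e 0 = 1" using P2 by (simp add: e_def)
    finally show ?thesis by (simp add: e_def field_simps)
  qed
  have per_int: "\<Phi> (x + 2*pi * of_int k) = \<Phi> x + 2*pi * of_int k" for x k
    using periodic_2pi_int[of "\<lambda>x. \<Phi> x - x" x k] per by simp
  have inj: "x = y" if "\<Phi> x = \<Phi> y" for x y
  proof -
    have "\<phi> (cis x) = \<phi> (cis y)" using that by (simp add: phi)
    then have "cis x = cis y" using homeomorphism_apply1[OF hom inS] by metis
    then obtain k :: int where k: "x = y + 2*pi * of_int k" by (rule cis_eq_cisE)
    then have "of_int k = (0::real)" using that per_int[of y k] by simp
    then show ?thesis using k by simp
  qed
  have mono: "strict_mono \<Phi>"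
  proof (rule strict_monoI)
    fix x y :: real assume xy: "x < y"
    \<comment> \<open>Choosing n with x + 2 pi n beyond y places y between two points where the
      order of the values is known; this decides the direction in which the injective function is
      monotone.\<close>
    obtain n :: nat where n: "y - x < of_nat n * (2*pi)" using ex_less_of_nat_mult[of "2*pi" "y - x"] by auto
    let ?b = "x + 2*pi * of_int (int n)"
    have "0 < of_nat n * (2*pi)" using xy n by linarith
    then have "\<Phi> x < \<Phi> ?b" unfolding per_int by (simp add: mult.commute)
    moreover have "(\<Phi> x < \<Phi> y \<and> \<Phi> y < \<Phi> ?b) \<or> (\<Phi> ?b < \<Phi> y \<and> \<Phi> y < \<Phi> x)"
      using n xy by (intro continuous_inj_imp_mono continuous_on_subset[OF Pc]) (auto simp: inj_on_def inj mult.commute)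
    ultimately show "\<Phi> x < \<Phi> y" by linarith
  qed
  have lift: "lift_map \<Phi>" using Pc mono per by (simp add: lift_map_def)
  have surj: "\<exists>x. \<Phi> x = y" for y
  proof -
    obtain n :: nat where n: "\<bar>y - \<Phi> 0\<bar> < of_nat n * (2*pi)" using ex_less_of_nat_mult[of "2*pi" "\<bar>y - \<Phi> 0\<bar>"] by auto
    have "\<Phi> (2*pi * of_int (- int n)) \<le> y" "y \<le> \<Phi> (2*pi * of_int (int n))"
      using per_int[of 0 "- int n"] per_int[of 0 "int n"] n by (auto simp: mult.commute abs_less_iff)
    then have "\<exists>x. 2*pi * of_int (- int n) \<le> x \<and> x \<le> 2*pi * of_int (int n) \<and> \<Phi> x = y"
      by (intro IVT' continuous_on_subset[OF Pc]) auto
    then show ?thesis by blast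
  qed
  define \<Psi> where "\<Psi> y = (THE x. \<Phi> x = y)" for y
  have PsiPhi: "\<Psi> (\<Phi> x) = x" for x unfolding \<Psi>_def using inj by blast
  have PhiPsi: "\<Phi> (\<Psi> y) = y" for y using surj[of y] PsiPhi by auto
  have "isCont \<Psi> y" for y
  proof -
    have "isCont \<Psi> (\<Phi> (\<Psi> y))"
      by (rule isCont_inverse_function2[of "\<Psi> y - 1" _ "\<Psi> y + 1"]) (auto simp: PsiPhi lift_isCont[OF lift])
    then show ?thesis by (simp add: PhiPsi)
  qed
  then have "continuous_on UNIV \<Psi>" by (simp add: continuous_at_imp_continuous_on)
  moreover have "strict_mono \<Psi>"
    by (rule strict_monoI) (metis PhiPsi lift_less_iff[OF lift])
  moreover have "\<Psi> (y + 2*pi) = \<Psi> y + 2*pi" for y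
    using PsiPhi[of "\<Psi> y + 2*pi"] per[of "\<Psi> y"] by (simp add: PhiPsi)
  ultimately have lift': "lift_map \<Psi>" by (simp add: lift_map_def)
  have "\<phi>' (cis y) = cis (\<Psi> y)" for y
    using homeomorphism_apply1[OF hom inS[of "\<Psi> y"]] by (simp add: phi PhiPsi)
  then show ?thesis using that[OF lift lift' phi] PsiPhi PhiPsi by blast
qed

lemma bi_douglas_eq:
  assumes hom: "homeomorphism (sphere 0 1) (sphere 0 1) \<phi> \<phi>'"
  shows "bi_douglas \<phi> \<phi>' = douglas_energy (\<lambda>s. \<phi> (cis s)) + douglas_energy (\<lambda>s. \<phi>' (cis s))"
proof -
  let ?p = "\<lambda>s. \<phi> (cis s)" and ?q = "\<lambda>s. \<phi>' (cis s)"
  have "continuous_on UNIV ?p" "continuous_on UNIV ?q"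
    by (intro continuous_on_compose2[OF homeomorphism_cont1[OF hom]] continuous_on_compose2[OF homeomorphism_cont2[OF hom]] continuous_intros; auto)+
  then have [measurable]: "?p \<in> borel_measurable borel" "?q \<in> borel_measurable borel"
    by (auto intro: borel_measurable_continuous_onI)
  have "bi_douglas \<phi> \<phi>' = nnint {0..2*pi} (\<lambda>s. (\<integral>\<^sup>+t. indicator {0..2*pi} t * douglas_kernel ?p s t + indicator {0..2*pi} t * douglas_kernel ?q s t \<partial>lborel))"
    unfolding bi_douglas_def douglas_kernel_def by (simp add: distrib_left[symmetric])
  also have "\<dots> = nnint {0..2*pi} (\<lambda>s. (nnint {0..2*pi} (\<lambda>t. douglas_kernel ?p s t)) + (nnint {0..2*pi} (\<lambda>t. douglas_kernel ?q s t)))"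
    by (intro nn_integral_cong arg_cong[where f="\<lambda>y. _ * y"] nn_integral_add) measurable
  also have "\<dots> = (\<integral>\<^sup>+s. indicator {0..2*pi} s * (nnint {0..2*pi} (\<lambda>t. douglas_kernel ?p s t)) + indicator {0..2*pi} s * (nnint {0..2*pi} (\<lambda>t. douglas_kernel ?q s t)) \<partial>lborel)"
    by (simp add: distrib_left)
  also have "\<dots> = douglas_energy ?p + douglas_energy ?q"
    unfolding douglas_energy_def by (rule nn_integral_add) measurable
  finally show ?thesis .
qed

theorem theorem1p4:
  fixes \<phi> \<phi>' :: "complex \<Rightarrow> complex"
  assumes "homeomorphism (sphere 0 1) (sphere 0 1) \<phi> \<phi>'"
    and "circle_orient_pres \<phi>"
  shows "bi_douglas \<phi> \<phi>' < \<infinity> \<longleftrightarrow>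
    (\<exists>h f. homeomorphism (cball 0 1) (cball 0 1) h f \<and> disk_orient_pres h \<and>
       (\<forall>z\<in>sphere 0 1. h z = \<phi> z) \<and>
       finite_sobolev_energy h \<and> finite_sobolev_energy f)"
proof
  assume "bi_douglas \<phi> \<phi>' < \<infinity>"
  then have fin: "douglas_energy (\<lambda>s. \<phi> (cis s)) < \<infinity>" "douglas_energy (\<lambda>s. \<phi>' (cis s)) < \<infinity>"
    unfolding bi_douglas_eq[OF assms(1)] by auto
  obtain \<Phi> \<Psi> where lifts: "lift_map \<Phi>" "lift_map \<Psi>"
      and phi: "\<And>x. \<phi> (cis x) = cis (\<Phi> x)" "\<And>x. \<phi>' (cis x) = cis (\<Psi> x)"
      and inv: "\<And>x. \<Psi> (\<Phi> x) = x" "\<And>x. \<Phi> (\<Psi> x) = x"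
    by (rule circle_homeomorphism_lift[OF assms], rule that)
  let ?h = "polar_map (shear_map \<Phi> \<Psi>)" and ?f = "polar_map (shear_map \<Psi> \<Phi>)"
  show "\<exists>h f. homeomorphism (cball 0 1) (cball 0 1) h f \<and> disk_orient_pres h \<and>
       (\<forall>z\<in>sphere 0 1. h z = \<phi> z) \<and> finite_sobolev_energy h \<and> finite_sobolev_energy f"
  proof (rule exI[of _ ?h], rule exI[of _ ?f], intro conjI ballI)
    show "homeomorphism (cball 0 1) (cball 0 1) ?h ?f"
    proof (rule homeomorphismI)
      show "continuous_on (cball 0 1) ?h" "continuous_on (cball 0 1) ?f"
        by (intro polar_map_continuous shear_map_period shear_map_continuous lifts; assumption)+
      show "?f (?h z) = z" if "z \<in> cball 0 1" for z using polar_shear_inverse[OF lifts, of z] that by simp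
      show "?h (?f z) = z" if "z \<in> cball 0 1" for z using polar_shear_inverse[OF lifts(2,1), of z] that by simp
    qed auto
    show "disk_orient_pres ?h"
      by (intro polar_map_orient_pres shear_map_period shear_map_continuous shear_map_less lifts)
    show "?h z = \<phi> z" if "z \<in> sphere 0 1" for z
    proof -
      have z: "z = cis (Arg z)" "cmod z = 1" using that rcis_cmod_Arg[of z] by (auto simp: rcis_def)
      have "?h z = cis (\<Phi> (Arg z))"
        using z(2) by (simp add: polar_map_def shear_map_boundary[OF lifts inv(1)])
      also have "\<dots> = \<phi> z" by (subst (2) z(1)) (simp add: phi)
      finally show ?thesis .
    qed
    show "finite_sobolev_energy ?h" "finite_sobolev_energy ?f"
      using fin by (intro polar_shear_energy_finite lifts; simp add: phi)+
  qed
next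
  assume "\<exists>h f. homeomorphism (cball 0 1) (cball 0 1) h f \<and> disk_orient_pres h \<and>
       (\<forall>z\<in>sphere 0 1. h z = \<phi> z) \<and> finite_sobolev_energy h \<and> finite_sobolev_energy f"
  then obtain h f where hom: "homeomorphism (cball 0 1) (cball 0 1) h f"
      and bd: "\<And>z. z \<in> sphere 0 1 \<Longrightarrow> h z = \<phi> z"
      and en: "finite_sobolev_energy h" "finite_sobolev_energy f" by blast
  have hp: "h (cis s) = \<phi> (cis s)" for s by (rule bd) simp
  \<comment> \<open>The boundary values of the inverse are not given but follow from h (\<phi>'
    \<xi>) = \<xi> on the circle.\<close>
  have fp: "f (cis s) = \<phi>' (cis s)" for s
  proof -
    have s: "cis s \<in> sphere 0 1" by simp
    have m: "\<phi>' (cis s) \<in> sphere 0 1" using assms(1) s unfolding homeomorphism_def by blast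
    have "h (\<phi>' (cis s)) = cis s" using bd[OF m] homeomorphism_apply2[OF assms(1) s] by simp
    moreover have "f (h (\<phi>' (cis s))) = \<phi>' (cis s)"
      by (rule homeomorphism_apply1[OF hom]) (use m in auto)
    ultimately show ?thesis by simp
  qed
  have "douglas_energy (\<lambda>s. \<phi> (cis s)) < \<infinity>" "douglas_energy (\<lambda>s. \<phi>' (cis s)) < \<infinity>"
    using finite_sobolev_energy_imp_douglas_energy[OF homeomorphism_cont1[OF hom] en(1)]
      finite_sobolev_energy_imp_douglas_energy[OF homeomorphism_cont2[OF hom] en(2)] by (simp_all add: hp fp)
  then show "bi_douglas \<phi> \<phi>' < \<infinity>"
    unfolding bi_douglas_eq[OF assms(1)] by simp
qed

end
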